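(* Let $G$ be a simple graph with $m$ edges, $n$ nodes, and minimum degree $\delta$, and fix an arbitrary constant $\varepsilon\in(0,1]$. Then, in $O(m)$ time, one can randomly contract $G$ down to $O(n/\delta)$ nodes and $O(n)$ edges such that, for any fixed non-trivial $(2-\varepsilon)$-min-cut, the cut is preserved with probability at least some constant $p_\varepsilon>0$ (depending only on $\varepsilon$).
   Context: A cut of $G=(V,E)$ is given by $\emptyset\ne S\subsetneq V$; $C(S)$ is the set of edges with exactly one endpoint in $S$. $\lambda$ denotes the edge connectivity. A cut is a $(2-\varepsilon)$-min-cut if $|C(S)|\le(2-\varepsilon)\lambda$. A cut is trivial (singleton) if one side consists of exactly one vertex, otherwise non-trivial. Contracting an edge set $D$ (edges keep their identities, self-loops removed) preserves a cut $C$ iff $C\cap D=\emptyset$. *)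

theory Defs
  imports "HOL-Probability.Probability"
begin

section \<open>Undirected multigraphs, cuts and contractions\<close>

text \<open>Edges carry identities, so that parallel edges can arise by contraction; an edge \<open>e\<close> has
  endpoint set \<open>ends G e\<close>.\<close>

record ('v, 'e) mgraph =
  verts :: "'v set"
  edges :: "'e set"
  ends :: "'e \<Rightarrow> 'v set"

definition simple_graph :: "('v, 'e) mgraph \<Rightarrow> bool" where
  "simple_graph G \<longleftrightarrow>
     finite (verts G) \<and> verts G \<noteq> {} \<and> finite (edges G) \<and>
     (\<forall>e\<in>edges G. ends G e \<subseteq> verts G \<and> card (ends G e) = 2) \<and>
     inj_on (ends G) (edges G)"

definition degree :: "('v, 'e) mgraph \<Rightarrow> 'v \<Rightarrow> nat" where
  "degree G v = card {e \<in> edges G. v \<in> ends G e}"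

definition min_degree :: "('v, 'e) mgraph \<Rightarrow> nat" where
  "min_degree G = Min (degree G ` verts G)"

definition is_cut :: "('v, 'e) mgraph \<Rightarrow> 'v set \<Rightarrow> bool" where
  "is_cut G S \<longleftrightarrow> S \<noteq> {} \<and> S \<subset> verts G"

definition cut_edges :: "('v, 'e) mgraph \<Rightarrow> 'v set \<Rightarrow> 'e set" where
  "cut_edges G S = {e \<in> edges G. card (ends G e \<inter> S) = 1}"

definition nontrivial_cut :: "('v, 'e) mgraph \<Rightarrow> 'v set \<Rightarrow> bool" where
  "nontrivial_cut G S \<longleftrightarrow> is_cut G S \<and> card S \<noteq> 1 \<and> card (verts G - S) \<noteq> 1"

text \<open>Only meaningful for graphs with at least two vertices (otherwise there are no cuts).\<close>

definition edge_connectivity :: "('v, 'e) mgraph \<Rightarrow> nat" where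
  "edge_connectivity G = Min ((\<lambda>S. card (cut_edges G S)) ` {S. is_cut G S})"

definition approx_min_cut :: "real \<Rightarrow> ('v, 'e) mgraph \<Rightarrow> 'v set \<Rightarrow> bool" where
  "approx_min_cut \<alpha> G S \<longleftrightarrow>
     is_cut G S \<and> real (card (cut_edges G S)) \<le> \<alpha> * real (edge_connectivity G)"

definition conn_via :: "('v, 'e) mgraph \<Rightarrow> 'e set \<Rightarrow> ('v \<times> 'v) set" where
  "conn_via G D =
     {(u, v). u \<in> verts G \<and> v \<in> verts G \<and> (u, v) \<in> {(x, y). \<exists>e\<in>D. ends G e = {x, y}}\<^sup>*}"

text \<open>Nodes of \<open>contract G D\<close> are the vertex sets of the connected components of \<open>(verts G, D)\<close>.
  Surviving edges keep their identity; those whose endpoints are merged become self-loops and are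
  removed.\<close>

definition contract :: "('v, 'e) mgraph \<Rightarrow> 'e set \<Rightarrow> ('v set, 'e) mgraph" where
  "contract G D =
     (let en = (\<lambda>e. (\<lambda>v. conn_via G D `` {v}) ` ends G e)
      in \<lparr> verts = verts G // conn_via G D,
           edges = {e \<in> edges G. card (en e) \<noteq> 1},
           ends = en \<rparr>)"

definition preserves_cut :: "('v, 'e) mgraph \<Rightarrow> 'e set \<Rightarrow> 'v set \<Rightarrow> bool" where
  "preserves_cut G D S \<longleftrightarrow> cut_edges G S \<inter> D = {}"


section \<open>A randomized word RAM\<close>

text \<open>Programs are structured programs over finitely many scalar variables and arrays of
  \<open>w\<close>-bit words. Every value produced by an arithmetic operation is reduced modulo \<open>2 ^ w\<close>;
  subtraction is truncated at zero. A step is one transition of the small-step semantics: an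
  elementary command, a test, an unfolding of a loop, or the removal of a finished first half of a
  sequence. The expressions occurring in a fixed program have bounded size, so each step costs
  a constant number of machine instructions.\<close>

record state =
  var :: "string \<Rightarrow> nat"
  arr :: "string \<Rightarrow> nat \<Rightarrow> nat"

datatype aexp =
    Const nat | Var string | Load string aexp
  | Add aexp aexp | Sub aexp aexp | Mult aexp aexp | Div aexp aexp

datatype bexp = Less aexp aexp | Eq aexp aexp | Neg bexp | Conj bexp bexp

datatype com =
    Skip
  | Assign string aexp
  | Store string aexp aexp
  | Rand string aexp
  | Seq com com
  | Cond bexp com com
  | While bexp com

primrec aval :: "nat \<Rightarrow> state \<Rightarrow> aexp \<Rightarrow> nat" where
  "aval w s (Const k) = k mod 2 ^ w"
| "aval w s (Var x) = var s x"
| "aval w s (Load a i) = arr s a (aval w s i)"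
| "aval w s (Add a b) = (aval w s a + aval w s b) mod 2 ^ w"
| "aval w s (Sub a b) = aval w s a - aval w s b"
| "aval w s (Mult a b) = (aval w s a * aval w s b) mod 2 ^ w"
| "aval w s (Div a b) = aval w s a div aval w s b"

primrec bval :: "nat \<Rightarrow> state \<Rightarrow> bexp \<Rightarrow> bool" where
  "bval w s (Less a b) \<longleftrightarrow> aval w s a < aval w s b"
| "bval w s (Eq a b) \<longleftrightarrow> aval w s a = aval w s b"
| "bval w s (Neg b) \<longleftrightarrow> \<not> bval w s b"
| "bval w s (Conj b c) \<longleftrightarrow> bval w s b \<and> bval w s c"

definition set_var :: "string \<Rightarrow> nat \<Rightarrow> state \<Rightarrow> state" where
  "set_var x k s = s\<lparr>var := (var s)(x := k)\<rparr>"

definition set_arr :: "string \<Rightarrow> nat \<Rightarrow> nat \<Rightarrow> state \<Rightarrow> state" where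
  "set_arr a i k s = s\<lparr>arr := (arr s)(a := (arr s a)(i := k))\<rparr>"

text \<open>\<open>Rand x a\<close> draws a fresh uniformly random number from \<open>{..<k}\<close>, where \<open>k\<close> is the value of
  \<open>a\<close> (the result is \<open>0\<close> if \<open>k = 0\<close>).\<close>

primrec step :: "nat \<Rightarrow> com \<Rightarrow> state \<Rightarrow> (com \<times> state) pmf" where
  "step w Skip s = return_pmf (Skip, s)"
| "step w (Assign x a) s = return_pmf (Skip, set_var x (aval w s a) s)"
| "step w (Store x i a) s = return_pmf (Skip, set_arr x (aval w s i) (aval w s a) s)"
| "step w (Rand x a) s =
     map_pmf (\<lambda>k. (Skip, set_var x k s)) (pmf_of_set {..<max 1 (aval w s a)})"
| "step w (Seq c d) s =
     (if c = Skip then return_pmf (d, s)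
      else map_pmf (\<lambda>(c', s'). (Seq c' d, s')) (step w c s))"
| "step w (Cond b c d) s = return_pmf (if bval w s b then c else d, s)"
| "step w (While b c) s = return_pmf (Cond b (Seq c (While b c)) Skip, s)"

text \<open>Distribution of configurations after \<open>t\<close> steps; a configuration with program \<open>Skip\<close> has
  halted and no longer changes.\<close>

primrec run :: "nat \<Rightarrow> nat \<Rightarrow> com \<times> state \<Rightarrow> (com \<times> state) pmf" where
  "run w 0 cs = return_pmf cs"
| "run w (Suc t) cs = bind_pmf (step w (fst cs) (snd cs)) (run w t)"


section \<open>Input and output conventions\<close>

text \<open>A graph is given to the machine as an edge list in arbitrary order: \<open>n\<close> vertices
  \<open>0, \<dots>, n - 1\<close> and \<open>m\<close> edges \<open>0, \<dots>, m - 1\<close>, the endpoints of edge \<open>e\<close> (in either order) being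
  stored in \<open>tail[e]\<close> and \<open>head[e]\<close>. All other memory is zero.\<close>

definition encodes_input :: "(nat, nat) mgraph \<Rightarrow> state \<Rightarrow> bool" where
  "encodes_input G s \<longleftrightarrow>
     verts G = {..<var s ''n''} \<and> edges G = {..<var s ''m''} \<and>
     (\<forall>e\<in>edges G. ends G e = {arr s ''tail'' e, arr s ''head'' e}) \<and>
     (\<forall>x. x \<notin> {''n'', ''m''} \<longrightarrow> var s x = 0) \<and>
     (\<forall>a i. a \<notin> {''tail'', ''head''} \<or> i \<ge> var s ''m'' \<longrightarrow> arr s a i = 0)"

text \<open>The set of edges the machine reports as contracted.\<close>

definition contracted_edges :: "(nat, nat) mgraph \<Rightarrow> state \<Rightarrow> nat set" where
  "contracted_edges G s = {e \<in> edges G. arr s ''contracted'' e \<noteq> 0}"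

text \<open>The memory also holds the contracted graph \<open>H\<close> explicitly: its nodes are numbered
  \<open>0, \<dots>, n_out - 1\<close>, the node containing an original vertex \<open>v\<close> has number \<open>label[v]\<close>, and the
  surviving edges are listed by their identities together with the numbers of their endpoints
  in \<open>H\<close>.\<close>

definition encodes_output :: "(nat set, nat) mgraph \<Rightarrow> state \<Rightarrow> bool" where
  "encodes_output H s \<longleftrightarrow>
     (\<exists>f. bij_betw f (verts H) {..<var s ''n_out''} \<and>
          (\<forall>X\<in>verts H. \<forall>v\<in>X. arr s ''label'' v = f X) \<and>
          bij_betw (arr s ''id_out'') {..<var s ''m_out''} (edges H) \<and>
          (\<forall>j<var s ''m_out''.
             f ` ends H (arr s ''id_out'' j) = {arr s ''tail_out'' j, arr s ''head_out'' j}))"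

end

theory Submission
  imports Defs
begin

text \<open>The algorithm contracts, for every vertex, two random incident edges (random 2-out contraction)
  and, independently, every edge with probability \<open>1 / (\<delta> + 1)\<close>; if the result is too large it
  contracts all edges, which leaves at most \<open>n / \<delta>\<close> nodes and no edge because the graph is simple.

  A non-trivial \<open>(2 - \<epsilon>)\<close>-min-cut contains at most a fraction \<open>1 - \<epsilon> / 2\<close> of the edges at any vertex:
  otherwise moving the vertex to the other side would give a cut with fewer than \<open>\<lambda>\<close> edges. As the cut
  has at most \<open>2 \<delta>\<close> edges, the estimate \<open>1 - x \<ge> exp (- 2 x / \<epsilon>)\<close> shows that it avoids all sampled
  edges with probability at least \<open>exp (- 20 / \<epsilon>)\<close>.

  The number of components is the sum over all vertices of the inverse size of their component.
  Exploring a component of the 2-out graph choice by choice shows that each summand has expectation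
  at most \<open>5 / \<delta>\<close>. Revealing the independent edge samples one by one, an edge can survive only if it
  joins two current components when it is revealed, and then it merges them with probability
  \<open>1 / (\<delta> + 1)\<close>; so the expected number of surviving edges is at most \<open>\<delta> + 1\<close> times the number of
  components. Markov's inequality turns both bounds into events of small failure probability.\<close>

section \<open>Connected components and contraction\<close>

text \<open>Two choices per vertex are what makes the exploration work. A revealed choice that
  leaves the explored set raises the number of pending choices by one, a choice that stays inside
  lowers it by one, and the latter has probability at most 1/4 while the set has at most
  \<open>\<delta> / 4\<close> vertices. The process drifts away from extinction, and a bound that
  halves with every pending choice absorbs the risk of dying out. With one choice per vertex a
  single choice would stay pending, and a contribution of order \<open>1 / \<delta>\<close> from
  each of about \<open>\<delta> / 4\<close> steps would add up to a constant.

  The size bounds have to hold for every outcome, but Markov's inequality grants them only with some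
  probability. The full contraction closes that gap. It may destroy the cut, so survival is counted
  only over runs that do not use it.\<close>

definition adj :: "('v, 'e) mgraph \<Rightarrow> 'e set \<Rightarrow> ('v \<times> 'v) set" where
  "adj G D = {(x, y). \<exists>e\<in>D. ends G e = {x, y}}"

lemma sym_adj: "sym (adj G D)"
  by (auto simp: adj_def sym_def insert_commute)

lemma conn_via_iff: "(u, v) \<in> conn_via G D \<longleftrightarrow> u \<in> verts G \<and> v \<in> verts G \<and> (u, v) \<in> (adj G D)\<^sup>*"
  by (simp add: conn_via_def adj_def)

lemma equiv_conn_via: "equiv (verts G) (conn_via G D)"
proof (rule equivI)
  show "refl_on (verts G) (conn_via G D)"
    by (auto simp: refl_on_def conn_via_iff)
  show "sym (conn_via G D)"
    using sym_rtrancl[OF sym_adj[of G D]] by (auto simp: sym_def conn_via_iff)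
  show "trans (conn_via G D)"
    by (auto simp: trans_def conn_via_iff)
qed (auto simp: conn_via_iff)

lemma conn_via_mono: "D \<subseteq> D' \<Longrightarrow> conn_via G D \<subseteq> conn_via G D'"
proof -
  assume "D \<subseteq> D'"
  then have "adj G D \<subseteq> adj G D'" by (auto simp: adj_def)
  from rtrancl_mono[OF this] show ?thesis by (auto simp: conn_via_iff)
qed

lemma conn_via_edge:
  "\<lbrakk>e \<in> D; ends G e = {x, y}; x \<in> verts G; y \<in> verts G\<rbrakk> \<Longrightarrow> (x, y) \<in> conn_via G D"
  by (auto simp: conn_via_iff adj_def)

lemma conn_via_sym: "(x, y) \<in> conn_via G D \<Longrightarrow> (y, x) \<in> conn_via G D"
  by (meson equiv_conn_via equivE symE)

lemma conn_via_trans: "\<lbrakk>(x, y) \<in> conn_via G D; (y, z) \<in> conn_via G D\<rbrakk> \<Longrightarrow> (x, z) \<in> conn_via G D"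
  by (meson equiv_conn_via equivE transE)

lemma conn_via_refl: "x \<in> verts G \<Longrightarrow> (x, x) \<in> conn_via G D"
  by (simp add: conn_via_iff)

text \<open>Induction along the path. With \<open>S\<close> the set of queued vertices it shows
  later that a search with an empty queue has exhausted whole components.\<close>

lemma conn_via_closed:
  assumes "(u, v) \<in> conn_via G D" "u \<in> S"
    and "\<And>e. \<lbrakk>e \<in> D; ends G e \<inter> S \<noteq> {}\<rbrakk> \<Longrightarrow> ends G e \<subseteq> S"
  shows "v \<in> S"
proof -
  have "(u, v) \<in> (adj G D)\<^sup>*" using assms(1) by (simp add: conn_via_iff)
  then show ?thesis
  proof (induction rule: rtrancl_induct)
    case base show ?case by (fact assms(2))
  next
    case (step y z)
    then obtain e where "e \<in> D" "ends G e = {y, z}" by (auto simp: adj_def)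
    with assms(3)[of e] step.IH show ?case by auto
  qed
qed

lemma conn_via_insert_intra:
  assumes "ends G e = {x, y}" "(x, y) \<in> conn_via G D"
  shows "conn_via G (insert e D) = conn_via G D"
proof
  show "conn_via G (insert e D) \<subseteq> conn_via G D"
  proof (rule subrelI)
    fix u v assume uv: "(u, v) \<in> conn_via G (insert e D)"
    \<comment> \<open>A step along the new edge is replaced by the old path between its
      endpoints.\<close>
    have "adj G (insert e D) \<subseteq> (adj G D)\<^sup>*"
    proof (rule subrelI)
      fix a b assume "(a, b) \<in> adj G (insert e D)"
      then consider "(a, b) \<in> adj G D" | "{a, b} = {x, y}" using assms(1) by (auto simp: adj_def)
      then show "(a, b) \<in> (adj G D)\<^sup>*"
        using assms(2) conn_via_sym[OF assms(2)]
        by cases (auto simp: conn_via_iff doubleton_eq_iff)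
    qed
    from rtrancl_subset_rtrancl[OF this] uv show "(u, v) \<in> conn_via G D" by (auto simp: conn_via_iff)
  qed
qed (rule conn_via_mono, blast)

lemma simple_graph_ends:
  assumes "simple_graph G" "e \<in> edges G"
  obtains x y where "ends G e = {x, y}" "x \<noteq> y" "x \<in> verts G" "y \<in> verts G"
proof -
  have "ends G e \<subseteq> verts G" "card (ends G e) = 2"
    using assms by (auto simp: simple_graph_def)
  then show ?thesis using that by (auto simp: card_2_iff)
qed

lemma verts_contract [simp]: "verts (contract G D) = verts G // conn_via G D"
  by (simp add: contract_def Let_def)

lemma ends_contract [simp]: "ends (contract G D) e = (\<lambda>v. conn_via G D `` {v}) ` ends G e"
  by (simp add: contract_def Let_def)

text \<open>\<open>contract\<close> drops an edge when the image of its endpoint set is a single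
  class; two classes in the image mean that no path in \<open>D\<close> joins the endpoints.\<close>

lemma edges_contract_iff:
  assumes "ends G e = {x, y}" "x \<in> verts G" "y \<in> verts G"
  shows "e \<in> edges (contract G D) \<longleftrightarrow> e \<in> edges G \<and> (x, y) \<notin> conn_via G D"
proof -
  have "card {conn_via G D `` {x}, conn_via G D `` {y}} = 1 \<longleftrightarrow> conn_via G D `` {x} = conn_via G D `` {y}"
    by (auto simp: card_insert_if)
  also have "\<dots> \<longleftrightarrow> (x, y) \<in> conn_via G D"
    using eq_equiv_class_iff[OF equiv_conn_via assms(2,3)] by blast
  finally show ?thesis using assms(1) by (simp add: contract_def Let_def)
qed

lemma edges_contract_subset: "edges (contract G D) \<subseteq> edges G"
  by (auto simp: contract_def Let_def)

lemma edges_contract_antimono: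
  assumes "simple_graph G" "D \<subseteq> D'"
  shows "edges (contract G D') \<subseteq> edges (contract G D)"
proof
  fix e assume e: "e \<in> edges (contract G D')"
  then have "e \<in> edges G" using edges_contract_subset[of G D'] by blast
  then obtain x y where "ends G e = {x, y}" "x \<in> verts G" "y \<in> verts G"
    using simple_graph_ends[OF assms(1)] by metis
  with e show "e \<in> edges (contract G D)"
    using edges_contract_iff[of G e x y] conn_via_mono[OF assms(2), of G] by blast
qed

section \<open>Numbers of classes under coarsening\<close>

lemma Image_equiv_class_finer:
  assumes "equiv A r" "equiv A r'" "r \<subseteq> r'" "v \<in> A"
  shows "r' `` (r `` {v}) = r' `` {v}"
proof
  show "r' `` (r `` {v}) \<subseteq> r' `` {v}"
    using assms(2,3) by (auto dest!: subsetD[OF assms(3)] elim!: equivE dest: transD)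
  show "r' `` {v} \<subseteq> r' `` (r `` {v})"
    using equiv_class_self[OF assms(1,4)] by blast
qed

lemma card_quotient_antimono:
  assumes "finite A" "equiv A r" "equiv A r'" "r \<subseteq> r'"
  shows "card (A // r') \<le> card (A // r)"
proof (rule surj_card_le)
  show "finite (A // r)" using assms(1,2) by (meson equivE finite_quotient)
  show "A // r' \<subseteq> (\<lambda>X. r' `` X) ` (A // r)"
  proof
    fix Y assume "Y \<in> A // r'"
    then obtain v where v: "v \<in> A" "Y = r' `` {v}" by (auto elim: quotientE)
    then show "Y \<in> (\<lambda>X. r' `` X) ` (A // r)"
      using Image_equiv_class_finer[OF assms(2-4)] by (metis image_eqI quotientI)
  qed
qed

text \<open>Sending a class of \<open>r\<close> to the class of \<open>r'\<close> around it is onto.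
  It stays onto without the class of \<open>y\<close>, since the class of \<open>x\<close> has the
  same image.\<close>

lemma card_quotient_less:
  assumes "finite A" "equiv A r" "equiv A r'" "r \<subseteq> r'" "(x, y) \<in> r'" "(x, y) \<notin> r"
  shows "card (A // r') < card (A // r)"
proof -
  have fin: "finite (A // r)" using assms(1,2) by (meson equivE finite_quotient)
  have xy: "x \<in> A" "y \<in> A" using assms(3,5) by (auto simp: equiv_def)
  let ?B = "A // r - {r `` {y}}"
  have "card (A // r') \<le> card ?B"
  proof (rule surj_card_le)
    show "finite ?B" using fin by simp
    note im = Image_equiv_class_finer[OF assms(2-4)]
    show "A // r' \<subseteq> (\<lambda>X. r' `` X) ` ?B"
    proof
      fix Y assume "Y \<in> A // r'"
      then obtain v where v: "v \<in> A" "Y = r' `` {v}" by (auto elim: quotientE)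
      show "Y \<in> (\<lambda>X. r' `` X) ` ?B"
      proof (cases "r `` {v} = r `` {y}")
        case True
        then have "(v, y) \<in> r'" using assms(2,4) v xy eq_equiv_class_iff[OF assms(2)] by blast
        then have "Y = r' `` {x}" using v assms(3,5) equiv_class_eq[OF assms(3)] by metis
        moreover have "r `` {x} \<noteq> r `` {y}" using assms(2,6) xy eq_equiv_class_iff by metis
        ultimately show ?thesis using im[OF xy(1)] xy by (auto intro!: image_eqI[of _ _ "r `` {x}"] quotientI)
      next
        case False
        then show ?thesis using v im by (auto intro!: image_eqI[of _ _ "r `` {v}"] quotientI)
      qed
    qed
  qed
  also have "\<dots> < card (A // r)"
    using fin xy by (intro psubset_card_mono) (auto intro: quotientI)
  finally show ?thesis .
qed

text \<open>A class of size \<open>s\<close> receives \<open>1 / s\<close> from each of its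
  \<open>s\<close> elements. This form makes linearity of expectation applicable vertex by
  vertex.\<close>

lemma card_quotient_eq_sum:
  assumes "finite A" "equiv A r"
  shows "real (card (A // r)) = (\<Sum>v\<in>A. 1 / card (r `` {v}))"
proof -
  have fin: "finite X" if "X \<in> A // r" for X
    using that assms finite_equiv_class by (metis equivE)
  have "(\<Sum>v\<in>A. 1 / real (card (r `` {v}))) = (\<Sum>v\<in>\<Union>(A // r). 1 / real (card (r `` {v})))"
    using Union_quotient[OF assms(2)] by simp
  also have "\<dots> = (\<Sum>X\<in>A // r. \<Sum>v\<in>X. 1 / real (card (r `` {v})))"
    using fin quotient_disj[OF assms(2)] by (subst sum.Union_disjoint) (simp_all add: Ball_def, blast)
  also have "\<dots> = (\<Sum>X\<in>A // r. 1)"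
  proof (rule sum.cong[OF refl])
    fix X assume X: "X \<in> A // r"
    have "r `` {v} = X" if "v \<in> X" for v
      using that X assms(2) by (metis Image_singleton_iff equiv_class_eq quotientE)
    then have "(\<Sum>v\<in>X. 1 / real (card (r `` {v}))) = (\<Sum>v\<in>X. 1 / real (card X))" by simp
    also have "\<dots> = 1" using fin[OF X] in_quotient_imp_non_empty[OF assms(2) X] by simp
    finally show "(\<Sum>v\<in>X. 1 / real (card (r `` {v}))) = 1" .
  qed
  finally show ?thesis by simp
qed

section \<open>Random 2-out contraction and edge sampling\<close>

lemma finite_set_Pi_pmf_of_set:
  assumes "finite A" "\<And>i. finite (B i)" "\<And>i. B i \<noteq> {}"
  shows "finite (set_pmf (Pi_pmf A d (\<lambda>i. pmf_of_set (B i))))"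
  using assms by (simp add: set_Pi_pmf finite_PiE_dflt)

lemma lessThan_max_1_nonempty [simp]: "{..<max (Suc 0) k} \<noteq> {}"
  by (auto simp: lessThan_empty_iff)

text \<open>Reveals a single coordinate and leaves the others random. The inductions over unrevealed
  choices and over unrevealed coins both take their step with it.\<close>

lemma expectation_Pi_pmf_insert:
  fixes h :: "('a \<Rightarrow> 'b) \<Rightarrow> real"
  assumes "finite A" "x \<notin> A" "\<And>i. finite (B i)" "\<And>i. B i \<noteq> {}"
  shows "measure_pmf.expectation (Pi_pmf (insert x A) d (\<lambda>i. pmf_of_set (B i))) h =
    (\<Sum>y\<in>B x. measure_pmf.expectation (Pi_pmf A d (\<lambda>i. pmf_of_set (B i))) (\<lambda>f. h (f(x := y)))) / card (B x)"
proof -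
  have "Pi_pmf (insert x A) d (\<lambda>i. pmf_of_set (B i)) =
      pmf_of_set (B x) \<bind> (\<lambda>y. map_pmf (\<lambda>f. f(x := y)) (Pi_pmf A d (\<lambda>i. pmf_of_set (B i))))"
    using assms by (simp add: Pi_pmf_insert' map_pmf_def)
  then show ?thesis
    using assms finite_set_Pi_pmf_of_set[OF assms(1,3,4)]
    by (simp add: pmf_expectation_bind_pmf_of_set divide_inverse_commute sum_distrib_left)
qed

lemma expectation_le_const:
  fixes h :: "'a \<Rightarrow> real"
  assumes "finite (set_pmf p)" "\<And>x. x \<in> set_pmf p \<Longrightarrow> h x \<le> c"
  shows "measure_pmf.expectation p h \<le> c"
  using assms by (intro measure_pmf.integral_le_const) (auto simp: AE_measure_pmf_iff integrable_measure_pmf_finite)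

lemma expectation_mono:
  fixes h :: "'a \<Rightarrow> real"
  assumes "finite (set_pmf p)" "\<And>x. x \<in> set_pmf p \<Longrightarrow> h x \<le> h' x"
  shows "measure_pmf.expectation p h \<le> measure_pmf.expectation p h'"
  using assms by (intro integral_mono_AE) (auto simp: AE_measure_pmf_iff integrable_measure_pmf_finite)

lemma simple_graph_ends_at:
  assumes "simple_graph G" "e \<in> edges G" "u \<in> ends G e"
  obtains x where "ends G e = {u, x}" "x \<in> verts G"
proof -
  obtain a b where ab: "ends G e = {a, b}" "a \<in> verts G" "b \<in> verts G"
    using simple_graph_ends[OF assms(1,2)] by blast
  with assms(3) consider "u = a" | "u = b" by blast
  then show ?thesis using that ab by cases (auto simp: insert_commute)
qed

section \<open>Components and edges left by independent sampling\<close>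

definition comps :: "('v, 'e) mgraph \<Rightarrow> 'e set \<Rightarrow> nat" where
  "comps G D = card (verts G // conn_via G D)"

text \<open>Light edges: process the edges one by one; only an edge joining two different current
  components can survive or matter, and each such edge is contracted with probability \<open>1 / k\<close>,
  which merges two components.\<close>

lemma expectation_surviving_edges:
  fixes G :: "('v, nat) mgraph"
  assumes G: "simple_graph G" and k: "1 \<le> k" and L: "finite L" "L \<subseteq> edges G"
  shows "measure_pmf.expectation (Pi_pmf L 0 (\<lambda>_. pmf_of_set {..<k}))
      (\<lambda>c. real (card (L \<inter> edges (contract G (D \<union> {e \<in> L. c e = 0}))))) \<le> real k * real (comps G D)"
  using L
\<comment> \<open>\<open>D\<close> collects the edges contracted so far, so outcome 0 for
  \<open>e\<close> calls the induction hypothesis at \<open>insert e D\<close>.\<close>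
proof (induction L arbitrary: D rule: finite_induct)
  case empty
  then show ?case by simp
next
  case (insert e L)
  define N where "N = (\<lambda>D. real (card (L \<inter> edges (contract G D))))"
  define E where "E = (\<lambda>h. measure_pmf.expectation (Pi_pmf L 0 (\<lambda>_. pmf_of_set {..<k})) (h :: (nat \<Rightarrow> nat) \<Rightarrow> real))"
  have fin: "finite (set_pmf (Pi_pmf L 0 (\<lambda>_. pmf_of_set {..<k})))"
    using insert.hyps(1) k by (intro finite_set_Pi_pmf_of_set) (auto simp: lessThan_empty_iff)
  from insert.prems obtain x y where xy: "ends G e = {x, y}" "x \<in> verts G" "y \<in> verts G" "e \<in> edges G"
    using simple_graph_ends[OF G] by (metis insert_subset)
  have IH: "E (\<lambda>c. N (D \<union> {e \<in> L. c e = 0})) \<le> real k * real (comps G D)" for D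
    using insert.IH[of D] insert.prems by (simp add: E_def N_def)
  \<comment> \<open>\<open>t\<close> indicates that \<open>e\<close> joins two components of
    \<open>D\<close>. Only then can \<open>e\<close> survive, and then contracting it reduces
    \<open>comps\<close>.\<close>
  define t :: real where "t = (if e \<in> edges (contract G D) then 1 else 0)"
  have crossing: "real (comps G (insert e D)) \<le> real (comps G D) - t"
  proof (cases "e \<in> edges (contract G D)")
    case True
    then have "(x, y) \<notin> conn_via G D" using edges_contract_iff[OF xy(1-3)] by blast
    moreover have "(x, y) \<in> conn_via G (insert e D)" by (rule conn_via_edge) (use xy in auto)
    ultimately have "comps G (insert e D) < comps G D"
      unfolding comps_def using G
      by (intro card_quotient_less[OF _ equiv_conn_via equiv_conn_via conn_via_mono[OF subset_insertI]])
         (auto simp: simple_graph_def)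
    then show ?thesis by (simp add: t_def True)
  next
    case False
    then have "(x, y) \<in> conn_via G D" using edges_contract_iff[OF xy(1-3)] xy(4) by blast
    from conn_via_insert_intra[OF xy(1) this] False show ?thesis by (simp add: t_def comps_def)
  qed
  have eq0: "D \<union> {e' \<in> insert e L. (c(e := 0)) e' = 0} = insert e D \<union> {e' \<in> L. c e' = 0}" for c :: "nat \<Rightarrow> nat"
    using insert.hyps(2) by auto
  have e0: "e \<notin> edges (contract G (insert e D \<union> X))" for X
  proof -
    have "(x, y) \<in> conn_via G (insert e D \<union> X)" by (rule conn_via_edge) (use xy in auto)
    then show ?thesis using edges_contract_iff[OF xy(1-3)] by simp
  qed
  have case0: "E (\<lambda>c. real (card (insert e L \<inter> edges (contract G (D \<union> {e' \<in> insert e L. (c(e := 0)) e' = 0})))))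
      \<le> real k * (real (comps G D) - t)"
  proof -
    have "E (\<lambda>c. real (card (insert e L \<inter> edges (contract G (D \<union> {e' \<in> insert e L. (c(e := 0)) e' = 0})))))
       = E (\<lambda>c. N (insert e D \<union> {e \<in> L. c e = 0}))"
      unfolding eq0 N_def using e0 by (simp add: Int_insert_left)
    also have "\<dots> \<le> real k * real (comps G (insert e D))" by (rule IH)
    finally show ?thesis using crossing by (meson mult_left_mono of_nat_0_le_iff order_trans)
  qed
  have case1: "E (\<lambda>c. real (card (insert e L \<inter> edges (contract G (D \<union> {e' \<in> insert e L. (c(e := i)) e' = 0})))))
      \<le> t + real k * real (comps G D)" if "i \<noteq> 0" for i
  proof -
    have eq1: "D \<union> {e' \<in> insert e L. (c(e := i)) e' = 0} = D \<union> {e' \<in> L. c e' = 0}" for c :: "nat \<Rightarrow> nat"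
      using insert.hyps(2) that by auto
    have "real (card (insert e L \<inter> edges (contract G (D \<union> X)))) \<le> t + N (D \<union> X)" for X
    proof (cases "e \<in> edges (contract G (D \<union> X))")
      case True
      then have "e \<in> edges (contract G D)" using edges_contract_antimono[OF G, of D "D \<union> X"] by blast
      with True insert.hyps show ?thesis by (simp add: t_def N_def Int_insert_left)
    next
      case False
      then show ?thesis by (simp add: t_def N_def Int_insert_left)
    qed
    then have "E (\<lambda>c. real (card (insert e L \<inter> edges (contract G (D \<union> {e' \<in> insert e L. (c(e := i)) e' = 0})))))
      \<le> E (\<lambda>c. t + N (D \<union> {e \<in> L. c e = 0}))"
      unfolding eq1 E_def by (intro expectation_mono fin)
    also have "\<dots> = t + E (\<lambda>c. N (D \<union> {e \<in> L. c e = 0}))"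
      unfolding E_def using fin by (subst Bochner_Integration.integral_add) (auto intro: integrable_measure_pmf_finite)
    finally show ?thesis using IH[of D] by linarith
  qed
  have "measure_pmf.expectation (Pi_pmf (insert e L) 0 (\<lambda>_. pmf_of_set {..<k}))
      (\<lambda>c. real (card (insert e L \<inter> edges (contract G (D \<union> {e' \<in> insert e L. c e' = 0})))))
    = (\<Sum>i<k. E (\<lambda>c. real (card (insert e L \<inter> edges (contract G (D \<union> {e' \<in> insert e L. (c(e := i)) e' = 0})))))) / k"
    unfolding E_def using insert.hyps k
    by (subst expectation_Pi_pmf_insert) (auto simp: lessThan_empty_iff)
  also have "\<dots> \<le> (\<Sum>i<k. real k * real (comps G D) + (if i = 0 then - (real k * t) else t)) / k"
  proof (intro divide_right_mono sum_mono)
    fix i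
    show "E (\<lambda>c. real (card (insert e L \<inter> edges (contract G (D \<union> {e' \<in> insert e L. (c(e := i)) e' = 0})))))
      \<le> real k * real (comps G D) + (if i = 0 then - (real k * t) else t)"
    proof (cases "i = 0")
      case True
      then have "(if i = 0 then - (real k * t) else t) = - (real k * t)" by simp
      with case0 True show ?thesis by (simp only: right_diff_distrib)
    next
      case False
      then have "(if i = 0 then - (real k * t) else t) = t" by simp
      with case1[OF False] show ?thesis by linarith
    qed
  qed simp
  \<comment> \<open>Outcome 0 saves \<open>k * t\<close> and the other \<open>k - 1\<close> outcomes
    cost \<open>t\<close> each, so the balance is not positive.\<close>
  also have "(\<Sum>i<k. real k * real (comps G D) + (if i = 0 then - (real k * t) else t))
    = real k * (real k * real (comps G D)) + (- (real k * t) + (real k - 1) * t)"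
  proof -
    obtain k' where k': "k = Suc k'" using k by (cases k) auto
    show ?thesis unfolding k' by (subst sum.lessThan_Suc_shift) (simp add: algebra_simps)
  qed
  also have "\<dots> / k \<le> real k * real (comps G D)"
    using k by (simp add: field_simps t_def)
  finally show ?case .
qed

section \<open>Exploration of a random 2-out graph\<close>

locale out_choice =
  fixes G :: "(nat, nat) mgraph" and ch :: "nat \<Rightarrow> nat \<Rightarrow> nat" and \<delta> :: nat
  assumes simple: "simple_graph G"
    and \<delta>_pos: "1 \<le> \<delta>"
    and \<delta>_eq: "\<delta> = min_degree G"
    and ch: "\<And>v. v \<in> verts G \<Longrightarrow> bij_betw (ch v) {..<degree G v} {e \<in> edges G. v \<in> ends G e}"
begin

lemma \<delta>_le: "v \<in> verts G \<Longrightarrow> \<delta> \<le> degree G v"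
  using simple by (simp add: \<delta>_eq min_degree_def simple_graph_def)

text \<open>Index \<open>j\<close> stands for one of the two random choices \<open>2 v\<close>, \<open>2 v + 1\<close> of the vertex \<open>v\<close>.\<close>

definition slots :: "nat set" where
  "slots = {j. j div 2 \<in> verts G}"

text \<open>\<open>ch v\<close> is an arbitrary enumeration of the edges at \<open>v\<close>, so
  that the order in which the machine numbers them can be inserted later.\<close>

definition outs :: "nat set \<Rightarrow> (nat \<Rightarrow> nat) \<Rightarrow> nat set" where
  "outs I r = (\<lambda>j. ch (j div 2) (r j)) ` I"

text \<open>The \<open>max\<close> follows the behaviour of \<open>Rand\<close> at 0 and keeps every
  factor a distribution on a nonempty set, also at indices outside \<open>slots\<close>.\<close>

abbreviation out_pmf :: "nat set \<Rightarrow> (nat \<Rightarrow> nat) pmf" where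
  "out_pmf I \<equiv> Pi_pmf I 0 (\<lambda>j. pmf_of_set {..<max (Suc 0) (degree G (j div 2))})"

lemma finite_out_pmf: "finite I \<Longrightarrow> finite (set_pmf (out_pmf I))"
  by (intro finite_set_Pi_pmf_of_set) auto

text \<open>Bounds what the risk of a small component adds to the \<open>4 / \<delta>\<close> paid
  for stopping at a large one, with \<open>u\<close> explored vertices and \<open>q\<close> pending
  choices. At \<open>q = 0\<close> the component is complete; otherwise every further pending choice
  halves the bound.\<close>

definition bnd :: "nat \<Rightarrow> nat \<Rightarrow> real" where
  "bnd u q = (if q = 0 then 1 / real u else 4 / (2 ^ q * real \<delta>))"

text \<open>At \<open>q = 1\<close> both sides equal \<open>2 / \<delta>\<close>: dying out with
  probability \<open>u / \<delta>\<close> leaves the inverse size \<open>1 / u\<close>. For larger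
  \<open>q\<close> each summand is at most half of the right side, the first one because
  \<open>u / \<delta> \<le> 1 / 4\<close> while one choice fewer doubles the bound.\<close>

lemma bnd_rec:
  assumes "1 \<le> q" "1 \<le> u" "4 * u \<le> \<delta>"
  shows "real u / real \<delta> * bnd u (q - 1) + bnd (Suc u) (Suc q) \<le> bnd u q"
proof (cases "q = 1")
  case True
  then show ?thesis using assms \<delta>_pos by (simp add: bnd_def field_simps)
next
  case False
  then obtain q' where q: "q = Suc (Suc q')" using assms(1) by (metis One_nat_def Suc_le_D old.nat.exhaust)
  have "real u / real \<delta> * bnd u (q - 1) \<le> 1 / 4 * bnd u (q - 1)"
    using assms \<delta>_pos by (intro mult_right_mono) (auto simp: bnd_def field_simps)
  also have "\<dots> = bnd u q / 2" by (simp add: bnd_def q)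
  moreover have "bnd (Suc u) (Suc q) = bnd u q / 2" by (simp add: bnd_def q)
  ultimately show ?thesis by linarith
qed

lemma conn_class_card_ge:
  assumes "U \<subseteq> conn_via G D `` {v}" "D \<subseteq> D'" "finite (verts G)"
  shows "card U \<le> card (conn_via G D' `` {v})"
proof (rule card_mono)
  show "finite (conn_via G D' `` {v})"
    using assms(3) by (rule rev_finite_subset) (auto simp: conn_via_iff)
  show "U \<subseteq> conn_via G D' `` {v}" using assms(1) conn_via_mono[OF assms(2), of G] by blast
qed

text \<open>Distinct edges at \<open>u\<close> have distinct endpoint sets in a simple graph, and
  such a set inside \<open>U\<close> has the form \<open>{u, x}\<close> with \<open>x\<close> in
  \<open>U\<close>.\<close>

lemma card_bad_choices:
  assumes "u \<in> verts G" "finite U"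
  shows "card {k. k < degree G u \<and> ends G (ch u k) \<subseteq> U} \<le> card U"
proof -
  let ?B = "{k. k < degree G u \<and> ends G (ch u k) \<subseteq> U}"
  have inj: "inj_on (\<lambda>k. ends G (ch u k)) ?B"
  proof (rule inj_onI)
    fix k k' assume k: "k \<in> ?B" "k' \<in> ?B" "ends G (ch u k) = ends G (ch u k')"
    have mem: "ch u i \<in> edges G" if "i < degree G u" for i
      using bij_betwE[OF ch[OF assms(1)]] that by blast
    have "ch u k = ch u k'"
      using k mem simple by (auto simp: simple_graph_def dest: inj_onD)
    then show "k = k'" using k bij_betw_imp_inj_on[OF ch[OF assms(1)]] by (auto dest: inj_onD)
  qed
  have "card ?B = card ((\<lambda>k. ends G (ch u k)) ` ?B)" using inj by (simp add: card_image)
  also have "\<dots> \<le> card ((\<lambda>x. {u, x}) ` U)"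
  proof (intro card_mono finite_imageI assms(2) subsetI)
    fix X assume "X \<in> (\<lambda>k. ends G (ch u k)) ` ?B"
    then obtain k where k: "k < degree G u" "ends G (ch u k) \<subseteq> U" "X = ends G (ch u k)" by blast
    have "ch u k \<in> edges G" "u \<in> ends G (ch u k)"
      using bij_betwE[OF ch[OF assms(1)]] k(1) by blast+
    then obtain x where "ends G (ch u k) = {u, x}"
      by (rule simple_graph_ends_at[OF simple])
    with k show "X \<in> (\<lambda>x. {u, x}) ` U" by auto
  qed
  also have "\<dots> \<le> card U" by (rule card_image_le[OF assms(2)])
  finally show ?thesis .
qed

text \<open>Deferred decisions: \<open>U\<close> is the part of the component of \<open>v\<close> explored so far, \<open>Q\<close> the choices
  of explored vertices that have not been revealed yet. A revealed choice either stays inside \<open>U\<close>,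
  with probability at most \<open>card U / \<delta>\<close>, or adds a vertex to \<open>U\<close> and two choices to \<open>Q\<close>. The
  exploration stops when \<open>Q\<close> is empty or \<open>4 * card U > \<delta>\<close>. Until then \<open>bnd\<close> is a supermartingale along
  this process, by \<open>bnd_rec\<close>.\<close>

lemma expectation_inverse_component:
  assumes "finite I" "v \<in> U" "U \<subseteq> verts G" "U \<subseteq> conn_via G D `` {v}" "Q \<subseteq> I"
    and "I = Q \<union> {j. j div 2 \<in> verts G - U}" "\<And>j. j \<in> Q \<Longrightarrow> j div 2 \<in> U"
  shows "measure_pmf.expectation (out_pmf I) (\<lambda>r. 1 / real (card (conn_via G (D \<union> outs I r) `` {v})))
    \<le> 4 / real \<delta> + bnd (card U) (card Q)"
  using assms
\<comment> \<open>\<open>I\<close> holds all unrevealed choices, the pending ones and those of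
  unexplored vertices, and every reveal removes one of them.\<close>
proof (induction "card I" arbitrary: I U Q D)
  case (0 I U Q D)
  then have "Q = {}" "I = {}" by auto
  have finV: "finite (verts G)" using simple by (simp add: simple_graph_def)
  have "1 / real (card (conn_via G D `` {v})) \<le> 1 / real (card U)"
    using conn_class_card_ge[OF "0.prems"(4) order_refl finV] "0.prems"(2,3) finV
    by (intro frac_le) (auto simp: card_gt_0_iff dest: finite_subset)
  then show ?case using \<open>I = {}\<close> \<open>Q = {}\<close> by (simp add: outs_def bnd_def) (smt (verit) of_nat_0_le_iff divide_nonneg_nonneg)
next
  case (Suc i I U Q D)
  have finV: "finite (verts G)" using simple by (simp add: simple_graph_def)
  have finU: "finite U" using Suc.prems(3) finV finite_subset by blast
  have U_pos: "1 \<le> card U" using Suc.prems(2) finU by (metis One_nat_def Suc_leI card_gt_0_iff empty_iff)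
  have inv_le: "1 / real (card (conn_via G (D \<union> X) `` {v})) \<le> 1 / real (card U)" for X
    using conn_class_card_ge[OF Suc.prems(4) Un_upper1 finV, of X] U_pos
    by (intro frac_le) auto
  have triv: "measure_pmf.expectation (out_pmf I) (\<lambda>r. 1 / real (card (conn_via G (D \<union> outs I r) `` {v})))
    \<le> 1 / real (card U)"
    using inv_le by (intro expectation_le_const finite_out_pmf Suc.prems(1))
  consider "4 * card U > \<delta>" | "Q = {}" | "4 * card U \<le> \<delta>" "Q \<noteq> {}" by linarith
  then show ?case
  proof cases
    case 1
    then have "1 / real (card U) \<le> 4 / real \<delta>" using U_pos \<delta>_pos by (simp add: field_simps)
    moreover have "0 \<le> bnd (card U) (card Q)" by (simp add: bnd_def)
    ultimately show ?thesis using triv by linarith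
  next
    case 2
    moreover have "0 \<le> 4 / real \<delta>" by simp
    moreover have "bnd (card U) (card Q) = 1 / real (card U)" using 2 by (simp add: bnd_def)
    ultimately show ?thesis using triv by linarith
  next
    case 3
    then obtain j where j: "j \<in> Q" by blast
    define u where "u = j div 2"
    have u: "u \<in> U" "u \<in> verts G" using Suc.prems(3,7) j by (auto simp: u_def)
    define d where "d = degree G u"
    have d: "\<delta> \<le> d" "1 \<le> d" using \<delta>_le[OF u(2)] \<delta>_pos by (auto simp: d_def)
    have finQ: "finite Q" using Suc.prems(1,5) finite_subset by blast
    define I' where "I' = I - {j}"
    have I: "I = insert j I'" "j \<notin> I'" "finite I'" using j Suc.prems(1,5) by (auto simp: I'_def)
    have cI': "i = card I'" using Suc.hyps(2) I by simp
    define q where "q = card Q"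
    have q: "1 \<le> q" using j finQ by (auto simp: q_def Suc_le_eq card_gt_0_iff)
    define F where "F = (\<lambda>D. measure_pmf.expectation (out_pmf I')
      (\<lambda>r. 1 / real (card (conn_via G (D \<union> outs I' r) `` {v}))))"
    have outs_upd: "D \<union> outs (insert j I') (r(j := k)) = insert (ch u k) D \<union> outs I' r" for r k
      using I(2) by (auto simp: outs_def u_def)
    let ?bad = "\<lambda>k. ends G (ch u k) \<subseteq> U"
    have Fk: "F (insert (ch u k) D) \<le> 4 / real \<delta> + (if ?bad k then bnd (card U) (q - 1) else bnd (Suc (card U)) (Suc q))"
      if k: "k < d" for k
    proof (cases "?bad k")
      case True
      have "F (insert (ch u k) D) \<le> 4 / real \<delta> + bnd (card U) (card (Q - {j}))"
        unfolding F_def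
      proof (rule Suc.hyps(1)[OF cI' I(3)])
        show "U \<subseteq> conn_via G (insert (ch u k) D) `` {v}"
          using Suc.prems(4) conn_via_mono[of D "insert (ch u k) D" G] by blast
        show "I' = Q - {j} \<union> {j. j div 2 \<in> verts G - U}"
          using Suc.prems(6) u(1) by (auto simp: I'_def u_def)
      qed (use Suc.prems I'_def in auto)
      then show ?thesis using True j finQ by (simp add: q_def)
    next
      case False
      have e: "ch u k \<in> edges G" "u \<in> ends G (ch u k)"
        using bij_betwE[OF ch[OF u(2)]] k by (auto simp: d_def)
      then obtain x where x: "ends G (ch u k) = {u, x}" "x \<in> verts G"
        by (rule simple_graph_ends_at[OF simple])
      then have xU: "x \<notin> U" using False u by auto
      define Q' where "Q' = (Q - {j}) \<union> {2 * x, 2 * x + 1}"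
      have new: "2 * x \<notin> Q" "2 * x + 1 \<notin> Q" using Suc.prems(7) xU by force+
      have "F (insert (ch u k) D) \<le> 4 / real \<delta> + bnd (card (insert x U)) (card Q')"
        unfolding F_def
      proof (rule Suc.hyps(1)[OF cI' I(3)])
        have "(v, u) \<in> conn_via G (insert (ch u k) D)"
          using Suc.prems(4) u(1) conn_via_mono[of D "insert (ch u k) D" G] by blast
        moreover have "(u, x) \<in> conn_via G (insert (ch u k) D)"
          by (rule conn_via_edge) (use x u in auto)
        ultimately have "(v, x) \<in> conn_via G (insert (ch u k) D)" by (rule conn_via_trans)
        then show "insert x U \<subseteq> conn_via G (insert (ch u k) D) `` {v}"
          using Suc.prems(4) conn_via_mono[of D "insert (ch u k) D" G] by blast
        have dx: "{j'. j' div 2 = x} = {2 * x, 2 * x + 1}" by auto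
        have "I' = Q - {j} \<union> {j. j div 2 \<in> verts G - U}"
          using Suc.prems(6) u(1) by (auto simp: I'_def u_def)
        also have "{j. j div 2 \<in> verts G - U} = {j'. j' div 2 = x} \<union> {j. j div 2 \<in> verts G - insert x U}"
          using x xU by auto
        finally show "I' = Q' \<union> {j. j div 2 \<in> verts G - insert x U}"
          by (simp only: dx Q'_def Un_assoc)
        then show "Q' \<subseteq> I'" by blast
      qed (use Suc.prems x in \<open>auto simp: Q'_def\<close>)
      moreover have "card (insert x U) = Suc (card U)" using xU finU by simp
      moreover have "card Q' = Suc q"
      proof -
        have "card Q' = card (Q - {j}) + card {2 * x, 2 * x + 1}"
          unfolding Q'_def using new finQ by (intro card_Un_disjoint) auto
        then show ?thesis using j finQ q by (simp add: q_def)
      qed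
      ultimately show ?thesis using False by simp
    qed
    define t where "t = card {k. k < d \<and> ?bad k}"
    have t: "t \<le> card U" using card_bad_choices[OF u(2) finU] by (simp add: t_def d_def)
    have "measure_pmf.expectation (out_pmf I) (\<lambda>r. 1 / real (card (conn_via G (D \<union> outs I r) `` {v})))
      = (\<Sum>k<d. F (insert (ch u k) D)) / d"
    proof -
      have "{..<max (Suc 0) (degree G (j div 2))} = {..<d}" "card {..<d} = d"
        using d(2) by (simp_all add: u_def[symmetric] d_def max_def)
      then show ?thesis
        unfolding I(1) F_def using I(2,3) by (subst expectation_Pi_pmf_insert) (simp_all add: outs_upd)
    qed
    \<comment> \<open>The term of the good case is charged to bad choices as well. The bound then
      increases with the number of bad choices, so an upper estimate of that number
      suffices.\<close>
    also have "\<dots> \<le> (\<Sum>k<d. (4 / real \<delta> + bnd (Suc (card U)) (Suc q)) + (if ?bad k then bnd (card U) (q - 1) else 0)) / d"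
    proof (intro divide_right_mono sum_mono)
      fix k assume "k \<in> {..<d}"
      then have "F (insert (ch u k) D) \<le> 4 / real \<delta> + (if ?bad k then bnd (card U) (q - 1) else bnd (Suc (card U)) (Suc q))"
        using Fk by simp
      moreover have "0 \<le> bnd (Suc (card U)) (Suc q)" by (simp add: bnd_def)
      ultimately show "F (insert (ch u k) D) \<le> (4 / real \<delta> + bnd (Suc (card U)) (Suc q)) + (if ?bad k then bnd (card U) (q - 1) else 0)"
        by (auto split: if_splits)
    qed simp
    also have "\<dots> = 4 / real \<delta> + bnd (Suc (card U)) (Suc q) + real t / real d * bnd (card U) (q - 1)"
    proof -
      have "(\<Sum>k<d. if ?bad k then bnd (card U) (q - 1) else 0) = real t * bnd (card U) (q - 1)"
        by (simp add: sum.If_cases t_def Collect_conj_eq lessThan_def)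
      then show ?thesis using d(2) by (simp add: sum.distrib add_divide_distrib)
    qed
    also have "real t / real d * bnd (card U) (q - 1) \<le> real (card U) / real \<delta> * bnd (card U) (q - 1)"
      using t d \<delta>_pos by (intro mult_right_mono frac_le) (auto simp: bnd_def)
    also have "4 / real \<delta> + bnd (Suc (card U)) (Suc q) + real (card U) / real \<delta> * bnd (card U) (q - 1)
      \<le> 4 / real \<delta> + bnd (card U) q"
      using bnd_rec[OF q U_pos 3(1)] by linarith
    finally show ?thesis by (simp add: q_def)
  qed
qed

lemma finite_slots: "finite slots"
proof (rule finite_subset)
  show "slots \<subseteq> (\<lambda>x. 2 * x) ` verts G \<union> (\<lambda>x. 2 * x + 1) ` verts G"
  proof
    fix j assume "j \<in> slots"
    then have "j div 2 \<in> verts G" by (simp add: slots_def)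
    moreover have "j = 2 * (j div 2) \<or> j = 2 * (j div 2) + 1" by presburger
    ultimately show "j \<in> (\<lambda>x. 2 * x) ` verts G \<union> (\<lambda>x. 2 * x + 1) ` verts G" by blast
  qed
  show "finite ((\<lambda>x. 2 * x) ` verts G \<union> (\<lambda>x. 2 * x + 1) ` verts G)"
    using simple by (simp add: simple_graph_def)
qed

lemma expectation_comps:
  "measure_pmf.expectation (out_pmf slots) (\<lambda>r. real (comps G (outs slots r)))
    \<le> 5 * real (card (verts G)) / real \<delta>"
proof -
  have finV: "finite (verts G)" using simple by (simp add: simple_graph_def)
  have "measure_pmf.expectation (out_pmf slots) (\<lambda>r. real (comps G (outs slots r)))
     = (\<Sum>v\<in>verts G. measure_pmf.expectation (out_pmf slots)
          (\<lambda>r. 1 / real (card (conn_via G ({} \<union> outs slots r) `` {v}))))"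
    unfolding comps_def card_quotient_eq_sum[OF finV equiv_conn_via]
    by (subst Bochner_Integration.integral_sum)
       (simp_all add: integrable_measure_pmf_finite finite_out_pmf finite_slots)
  also have "\<dots> \<le> (\<Sum>v\<in>verts G. 5 / real \<delta>)"
  proof (rule sum_mono)
    fix v assume v: "v \<in> verts G"
    have "measure_pmf.expectation (out_pmf slots)
          (\<lambda>r. 1 / real (card (conn_via G ({} \<union> outs slots r) `` {v})))
      \<le> 4 / real \<delta> + bnd (card {v}) (card {2 * v, 2 * v + 1})"
    proof (rule expectation_inverse_component[OF finite_slots])
      show "slots = {2 * v, 2 * v + 1} \<union> {j. j div 2 \<in> verts G - {v}}"
        using v by (auto simp: slots_def)
    qed (use v in \<open>auto simp: slots_def conn_via_refl\<close>)
    \<comment> \<open>\<open>bnd 1 2\<close> is \<open>4 / (4 * \<delta>)\<close>, that is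
      \<open>1 / \<delta>\<close>.\<close>
    also have "\<dots> = 5 / real \<delta>" by (simp add: bnd_def)
    finally show "measure_pmf.expectation (out_pmf slots)
          (\<lambda>r. 1 / real (card (conn_via G ({} \<union> outs slots r) `` {v}))) \<le> 5 / real \<delta>" .
  qed
  also have "\<dots> = 5 * real (card (verts G)) / real \<delta>" by simp
  finally show ?thesis .
qed

end

section \<open>Survival of near-minimum cuts\<close>

lemma edge_connectivity_le:
  assumes "finite (verts G)" "is_cut G S"
  shows "edge_connectivity G \<le> card (cut_edges G S)"
proof -
  have "{S. is_cut G S} \<subseteq> Pow (verts G)" by (auto simp: is_cut_def)
  then have "finite {S. is_cut G S}" using assms(1) by (meson finite_Pow_iff finite_subset)
  then show ?thesis using assms(2) by (simp add: edge_connectivity_def)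
qed

lemma mem_cut_edges_iff:
  assumes "ends G e = {x, y}" "x \<noteq> y"
  shows "e \<in> cut_edges G S \<longleftrightarrow> e \<in> edges G \<and> (x \<in> S \<longleftrightarrow> y \<notin> S)"
  using assms by (auto simp: cut_edges_def Int_insert_left)

definition cut_degree :: "('v, 'e) mgraph \<Rightarrow> 'v set \<Rightarrow> 'v \<Rightarrow> nat" where
  "cut_degree G S v = card {e \<in> cut_edges G S. v \<in> ends G e}"

text \<open>Compares with the cut that isolates \<open>v\<close>.\<close>

lemma edge_connectivity_le_degree:
  assumes G: "simple_graph G" and v: "v \<in> verts G" and "verts G \<noteq> {v}"
  shows "edge_connectivity G \<le> degree G v"
proof -
  have "is_cut G {v}" using assms by (auto simp: is_cut_def)
  then have "edge_connectivity G \<le> card (cut_edges G {v})"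
    using G by (intro edge_connectivity_le) (auto simp: simple_graph_def)
  also have "cut_edges G {v} = {e \<in> edges G. v \<in> ends G e}"
    by (auto simp: cut_edges_def Int_insert_right split: if_splits)
  finally show ?thesis by (simp add: degree_def)
qed

text \<open>Moving \<open>v\<close> to the other side of a non-trivial cut gives another cut, which has at least
  \<open>\<lambda>\<close> edges.\<close>

lemma cut_degree_le:
  assumes G: "simple_graph G" and S: "nontrivial_cut G S" "approx_min_cut (2 - \<epsilon>) G S"
    and v: "v \<in> verts G" and \<epsilon>: "0 < \<epsilon>" "\<epsilon> \<le> 1"
  shows "real (cut_degree G S v) \<le> (1 - \<epsilon> / 2) * real (degree G v)"
proof -
  have fin: "finite (verts G)" "finite (edges G)" using G by (auto simp: simple_graph_def)
  define S' where "S' = (if v \<in> S then S - {v} else insert v S)"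
  have S0: "S \<noteq> {}" "S \<subset> verts G" "card S \<noteq> 1" "card (verts G - S) \<noteq> 1"
    using S(1) by (auto simp: nontrivial_cut_def is_cut_def)
  \<comment> \<open>An empty side of \<open>S'\<close> would mean that \<open>v\<close> was alone on
    its side of \<open>S\<close>, which non-triviality excludes.\<close>
  have "is_cut G S'"
  proof (cases "v \<in> S")
    case True
    have "S \<noteq> {v}" using S0(3) by auto
    with True S0(1,2) show ?thesis by (auto simp: is_cut_def S'_def)
  next
    case False
    have "verts G - S \<noteq> {v}" using S0(4) by auto
    with False S0(1,2) v show ?thesis by (auto simp: is_cut_def S'_def)
  qed
  then have conn_le: "edge_connectivity G \<le> card (cut_edges G S')"
    by (rule edge_connectivity_le[OF fin(1)])
  define C where "C = cut_edges G S"
  define Iv where "Iv = {e \<in> edges G. v \<in> ends G e}"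
  have C': "cut_edges G S' = (C - Iv) \<union> (Iv - C)"
  proof (rule set_eqI)
    fix e
    show "e \<in> cut_edges G S' \<longleftrightarrow> e \<in> (C - Iv) \<union> (Iv - C)"
    proof (cases "e \<in> edges G")
      case True
      from simple_graph_ends[OF G this] obtain x y where xy: "ends G e = {x, y}" "x \<noteq> y" by metis
      show ?thesis
        unfolding C_def Iv_def using True xy
        by (auto simp: mem_cut_edges_iff[OF xy] S'_def)
    qed (auto simp: cut_edges_def C_def Iv_def)
  qed
  have finC: "finite C" "finite Iv" using fin by (auto simp: C_def Iv_def cut_edges_def)
  have "C \<inter> Iv = {e \<in> C. v \<in> ends G e}" by (auto simp: C_def Iv_def cut_edges_def)
  then have cd: "cut_degree G S v = card (C \<inter> Iv)" by (simp add: cut_degree_def C_def)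
  have "card (C - Iv) + card (C \<inter> Iv) = card C" "card (Iv - C) + card (C \<inter> Iv) = card Iv"
    using card_Int_Diff[OF finC(1), of Iv] card_Int_Diff[OF finC(2), of C] by (simp_all add: Int_commute)
  moreover have "card (cut_edges G S') = card (C - Iv) + card (Iv - C)"
    unfolding C' using finC by (intro card_Un_disjoint) auto
  \<comment> \<open>The new cut loses the \<open>card (C \<inter> Iv)\<close> old cut edges at
    \<open>v\<close> and gains the remaining edges at \<open>v\<close>.\<close>
  ultimately have "edge_connectivity G + 2 * card (C \<inter> Iv) \<le> card C + card Iv"
    using conn_le by linarith
  moreover have "real (card C) \<le> (2 - \<epsilon>) * real (edge_connectivity G)"
    using S(2) by (simp add: approx_min_cut_def C_def)
  moreover have "card Iv = degree G v" by (simp add: degree_def Iv_def)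
  ultimately have "2 * real (cut_degree G S v) \<le> (1 - \<epsilon>) * real (edge_connectivity G) + real (degree G v)"
    unfolding cd by (simp add: algebra_simps)
  \<comment> \<open>By \<open>\<epsilon> \<le> 1\<close> the factor \<open>1 - \<epsilon>\<close> is
    non-negative, so the connectivity may be replaced by the degree.\<close>
  also have "edge_connectivity G \<le> degree G v"
    using S0(1,2) by (intro edge_connectivity_le_degree[OF G v]) auto
  then have "(1 - \<epsilon>) * real (edge_connectivity G) \<le> (1 - \<epsilon>) * real (degree G v)"
    using \<epsilon> by (intro mult_left_mono) auto
  finally show ?thesis by (simp add: algebra_simps)
qed

text \<open>Double counting: the sums are exchanged, and every cut edge has two endpoints.\<close>

lemma sum_cut_degree:
  assumes G: "simple_graph G"
  shows "(\<Sum>v\<in>verts G. cut_degree G S v) = 2 * card (cut_edges G S)"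
proof -
  have fin: "finite (verts G)" "finite (cut_edges G S)"
    using G by (auto simp: simple_graph_def cut_edges_def)
  have "(\<Sum>v\<in>verts G. cut_degree G S v) = (\<Sum>v\<in>verts G. \<Sum>e\<in>cut_edges G S. if v \<in> ends G e then 1 else 0)"
    unfolding cut_degree_def using fin by (simp add: sum.If_cases Int_def)
  also have "\<dots> = (\<Sum>e\<in>cut_edges G S. \<Sum>v\<in>verts G. if v \<in> ends G e then 1 else 0)"
    by (rule sum.swap)
  also have "\<dots> = (\<Sum>e\<in>cut_edges G S. 2)"
  proof (rule sum.cong[OF refl])
    fix e assume "e \<in> cut_edges G S"
    then have "e \<in> edges G" by (simp add: cut_edges_def)
    then have "ends G e \<subseteq> verts G" "card (ends G e) = 2" using G by (auto simp: simple_graph_def)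
    then show "(\<Sum>v\<in>verts G. if v \<in> ends G e then 1 else 0) = (2 :: nat)"
      using fin by (simp add: sum.If_cases Int_absorb1)
  qed
  finally show ?thesis by simp
qed

text \<open>Uses \<open>ln t \<le> t - 1\<close> at \<open>t = 1 / (1 - x)\<close> together with
  \<open>\<eta> \<le> 1 - x\<close>. It turns a product of survival probabilities bounded away from
  0 into the exponential of a sum of failure probabilities.\<close>

lemma one_minus_ge_exp:
  fixes x \<eta> :: real
  assumes "0 < \<eta>" "0 \<le> x" "x \<le> 1 - \<eta>"
  shows "exp (- x / \<eta>) \<le> 1 - x"
proof -
  have "- x / \<eta> \<le> - x / (1 - x)" using assms by (simp add: frac_le)
  also have "\<dots> = 1 - 1 / (1 - x)" using assms by (simp add: field_simps)
  also have "\<dots> \<le> ln (1 - x)"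
    using ln_le_minus_one[of "1 / (1 - x)"] assms by (simp add: ln_div)
  finally show ?thesis using assms by (simp add: ln_ge_iff)
qed

section \<open>Product events and Markov's inequality\<close>

lemma measure_pair_pmf_Times:
  "measure_pmf.prob (pair_pmf M N) (A \<times> B) = measure_pmf.prob M A * measure_pmf.prob N B"
proof -
  \<comment> \<open>The events are cut down to the supports because the product rule asks for
    countable sets.\<close>
  have "measure_pmf.prob (pair_pmf M N) (A \<times> B) =
    measure_pmf.prob (pair_pmf M N) ((A \<inter> set_pmf M) \<times> (B \<inter> set_pmf N))"
    by (rule measure_prob_cong_0) (auto simp: pmf_pair set_pmf_iff)
  also have "\<dots> = measure_pmf.prob M (A \<inter> set_pmf M) * measure_pmf.prob N (B \<inter> set_pmf N)"
    by (intro measure_pmf_prob_product) auto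
  finally show ?thesis by (simp add: measure_Int_set_pmf)
qed

lemma prob_ge_le_expectation:
  fixes f :: "'a \<Rightarrow> real"
  assumes "finite (set_pmf p)" "\<And>x. 0 \<le> f x" "0 < c"
  shows "measure_pmf.prob p {x. c \<le> f x} \<le> measure_pmf.expectation p f / c"
  using integral_Markov_inequality_measure[of "measure_pmf p" f UNIV c] assms
  by (simp add: integrable_measure_pmf_finite)

section \<open>Survival probability and size of the sampled contraction\<close>

context out_choice
begin

text \<open>\<open>Suc \<delta>\<close> rather than \<open>\<delta>\<close>: an edge then stays
  unsampled with probability at least 1/2 even at \<open>\<delta> = 1\<close>, which is what
  \<open>one_minus_ge_exp\<close> needs for \<open>\<epsilon> \<le> 1\<close>.\<close>

definition coin_pmf :: "(nat \<Rightarrow> nat) pmf" where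
  "coin_pmf = Pi_pmf (edges G) 0 (\<lambda>_. pmf_of_set {..<Suc \<delta>})"

definition sampled :: "(nat \<Rightarrow> nat) \<times> (nat \<Rightarrow> nat) \<Rightarrow> nat set" where
  "sampled = (\<lambda>(r, c). outs slots r \<union> {e \<in> edges G. c e = 0})"

lemma fin: "finite (verts G)" "finite (edges G)" "verts G \<noteq> {}"
  using simple by (auto simp: simple_graph_def)

lemma sum_slots: "(\<Sum>j\<in>slots. f (j div 2)) = 2 * (\<Sum>v\<in>verts G. f v)" for f :: "nat \<Rightarrow> real"
proof -
  have "(\<Sum>j\<in>slots. f (j div 2)) = (\<Sum>v\<in>verts G. \<Sum>j\<in>{j \<in> slots. j div 2 = v}. f (j div 2))"
    by (rule sum.group[symmetric], rule finite_slots, rule fin(1)) (auto simp: slots_def)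
  also have "\<dots> = (\<Sum>v\<in>verts G. 2 * f v)"
  proof (rule sum.cong[OF refl])
    fix v assume "v \<in> verts G"
    then have "{j \<in> slots. j div 2 = v} = {2 * v, 2 * v + 1}" by (auto simp: slots_def)
    then show "(\<Sum>j\<in>{j \<in> slots. j div 2 = v}. f (j div 2)) = 2 * f v" by simp
  qed
  finally show ?thesis by (simp add: sum_distrib_left)
qed

text \<open>The singleton cut at a vertex of minimum degree bounds the edge connectivity by
  \<open>\<delta>\<close>.\<close>

lemma card_cut_le:
  assumes S: "nontrivial_cut G S" "approx_min_cut (2 - \<epsilon>) G S" and \<epsilon>: "0 < \<epsilon>" "\<epsilon> \<le> 1"
  shows "real (card (cut_edges G S)) \<le> 2 * real \<delta>"
proof -
  have "\<delta> \<in> degree G ` verts G" unfolding \<delta>_eq min_degree_def using fin by (intro Min_in) auto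
  then obtain v where v: "v \<in> verts G" "degree G v = \<delta>" by auto
  have "verts G \<noteq> {v}" using S(1) by (auto simp: nontrivial_cut_def is_cut_def)
  from edge_connectivity_le_degree[OF simple v(1) this] have le: "real (edge_connectivity G) \<le> real \<delta>" using v by simp
  have "real (card (cut_edges G S)) \<le> (2 - \<epsilon>) * real (edge_connectivity G)"
    using S(2) by (simp add: approx_min_cut_def)
  also have "\<dots> \<le> 2 * real \<delta>" using le \<epsilon> by (intro mult_mono) auto
  finally show ?thesis .
qed

lemma prob_choice_avoids:
  assumes v: "v \<in> verts G"
  shows "measure_pmf.prob (pmf_of_set {..<max (Suc 0) (degree G v)}) {k. ch v k \<notin> cut_edges G S}
    = 1 - real (cut_degree G S v) / real (degree G v)"
proof -
  have d: "1 \<le> degree G v" using \<delta>_le[OF v] \<delta>_pos by simp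
  define A where "A = {k \<in> {..<degree G v}. ch v k \<in> cut_edges G S}"
  have "bij_betw (ch v) A {e \<in> cut_edges G S. v \<in> ends G e}"
    unfolding bij_betw_def
  proof
    show "inj_on (ch v) A"
      using bij_betw_imp_inj_on[OF ch[OF v]] by (rule inj_on_subset) (auto simp: A_def)
    have "ch v ` {..<degree G v} = {e \<in> edges G. v \<in> ends G e}" using ch[OF v] by (simp add: bij_betw_def)
    moreover have "ch v ` A = {e \<in> ch v ` {..<degree G v}. e \<in> cut_edges G S}" by (auto simp: A_def)
    ultimately show "ch v ` A = {e \<in> cut_edges G S. v \<in> ends G e}" by (auto simp: cut_edges_def)
  qed
  then have A: "card A = cut_degree G S v" by (simp add: cut_degree_def bij_betw_same_card)
  have "{..<degree G v} \<inter> {k. ch v k \<notin> cut_edges G S} = {..<degree G v} - A" by (auto simp: A_def)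
  moreover have "card ({..<degree G v} - A) = degree G v - card A"
    by (subst card_Diff_subset) (auto simp: A_def)
  moreover have "card A \<le> card {..<degree G v}" by (intro card_mono) (auto simp: A_def)
  moreover have "{..<max (Suc 0) (degree G v)} = {..<degree G v}" using d by (simp add: max_def)
  ultimately show ?thesis using d
    by (simp add: measure_pmf_of_set lessThan_empty_iff A of_nat_diff diff_divide_distrib)
qed

text \<open>Origin of 16: the fractions of cut edges at the vertices sum to at most
  \<open>2 * (2 * \<delta>) / \<delta> = 4\<close>, each vertex chooses twice, and
  \<open>one_minus_ge_exp\<close> divides by \<open>\<epsilon> / 2\<close>.\<close>

lemma prob_outs_avoid:
  assumes S: "nontrivial_cut G S" "approx_min_cut (2 - \<epsilon>) G S" and \<epsilon>: "0 < \<epsilon>" "\<epsilon> \<le> 1"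
  shows "exp (- 16 / \<epsilon>) \<le> measure_pmf.prob (out_pmf slots) {r. outs slots r \<inter> cut_edges G S = {}}"
proof -
  define x where "x = (\<lambda>v. real (cut_degree G S v) / real (degree G v))"
  have deg: "1 \<le> degree G v" if "v \<in> verts G" for v using \<delta>_le[OF that] \<delta>_pos by simp
  have x_le: "x v \<le> 1 - \<epsilon> / 2" if "v \<in> verts G" for v
    using cut_degree_le[OF simple S that \<epsilon>] deg[OF that] by (simp add: x_def field_simps)
  have "(\<Sum>v\<in>verts G. x v) \<le> (\<Sum>v\<in>verts G. real (cut_degree G S v) / real \<delta>)"
    using \<delta>_le \<delta>_pos by (intro sum_mono) (auto simp: x_def intro!: frac_le)
  also have "\<dots> = real (\<Sum>v\<in>verts G. cut_degree G S v) / real \<delta>"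
    by (simp add: sum_divide_distrib)
  also have "\<dots> \<le> 4"
    unfolding sum_cut_degree[OF simple] using card_cut_le[OF S \<epsilon>] \<delta>_pos by (simp add: field_simps)
  finally have sum_x: "(\<Sum>v\<in>verts G. x v) \<le> 4" .
  have "- 16 / \<epsilon> \<le> - (\<Sum>j\<in>slots. x (j div 2)) / (\<epsilon> / 2)"
    unfolding sum_slots using sum_x \<epsilon> by (simp add: field_simps)
  then have "exp (- 16 / \<epsilon>) \<le> exp (\<Sum>j\<in>slots. - x (j div 2) / (\<epsilon> / 2))"
    by (simp add: sum_negf sum_divide_distrib[symmetric] del: divide_divide_eq_right)
  also have "\<dots> = (\<Prod>j\<in>slots. exp (- x (j div 2) / (\<epsilon> / 2)))"
    by (simp add: exp_sum finite_slots)
  also have "\<dots> \<le> (\<Prod>j\<in>slots. 1 - x (j div 2))"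
  proof (intro prod_mono conjI)
    fix j assume "j \<in> slots"
    then have "j div 2 \<in> verts G" by (simp add: slots_def)
    from x_le[OF this] show "exp (- x (j div 2) / (\<epsilon> / 2)) \<le> 1 - x (j div 2)"
      using \<epsilon> by (intro one_minus_ge_exp) (auto simp: x_def)
  qed simp
  also have "\<dots> = (\<Prod>j\<in>slots. measure_pmf.prob (pmf_of_set {..<max (Suc 0) (degree G (j div 2))})
      {k. ch (j div 2) k \<notin> cut_edges G S})"
    by (intro prod.cong refl) (simp add: prob_choice_avoids slots_def x_def)
  also have "\<dots> = measure_pmf.prob (out_pmf slots) (Pi slots (\<lambda>j. {k. ch (j div 2) k \<notin> cut_edges G S}))"
    by (rule measure_Pi_pmf_Pi[OF finite_slots, symmetric])
  also have "Pi slots (\<lambda>j. {k. ch (j div 2) k \<notin> cut_edges G S}) = {r. outs slots r \<inter> cut_edges G S = {}}"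
    by (auto simp: outs_def Pi_def)
  finally show ?thesis .
qed

text \<open>Origin of 4: at most \<open>2 * \<delta>\<close> cut edges with sampling probability
  \<open>1 / (\<delta> + 1)\<close> give a sum of at most 2, which is divided by
  \<open>\<epsilon> / 2\<close>.\<close>

lemma prob_coins_avoid:
  assumes S: "nontrivial_cut G S" "approx_min_cut (2 - \<epsilon>) G S" and \<epsilon>: "0 < \<epsilon>" "\<epsilon> \<le> 1"
  shows "exp (- 4 / \<epsilon>) \<le> measure_pmf.prob coin_pmf {c. {e \<in> edges G. c e = 0} \<inter> cut_edges G S = {}}"
proof -
  let ?C = "cut_edges G S"
  define y :: real where "y = 1 / real (Suc \<delta>)"
  have C: "?C \<subseteq> edges G" "finite ?C" using fin by (auto simp: cut_edges_def)
  have "real (card ?C) * y \<le> 2"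
    using card_cut_le[OF S \<epsilon>] by (simp add: y_def field_simps)
  then have "- 4 / \<epsilon> \<le> real (card ?C) * (- y / (\<epsilon> / 2))"
    using \<epsilon> by (simp add: field_simps)
  then have "exp (- 4 / \<epsilon>) \<le> exp (- y / (\<epsilon> / 2)) ^ card ?C"
    by (simp add: exp_of_nat_mult[symmetric])
  also have "\<dots> \<le> (1 - y) ^ card ?C"
  proof (intro power_mono one_minus_ge_exp)
    have "y \<le> 1 / 2" using \<delta>_pos by (simp add: y_def field_simps)
    then show "y \<le> 1 - \<epsilon> / 2" using \<epsilon>(2) by linarith
  qed (use \<epsilon> in \<open>simp_all add: y_def\<close>)
  \<comment> \<open>Edges off the cut contribute a factor 1, which brings the product into the form
    of independence over all coins.\<close>
  also have "\<dots> = (\<Prod>e\<in>edges G. if e \<in> ?C then 1 - y else 1)"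
    using C fin(2) by (simp add: prod.If_cases Int_absorb1)
  also have "\<dots> = (\<Prod>e\<in>edges G. measure_pmf.prob (pmf_of_set {..<Suc \<delta>}) (if e \<in> ?C then {1..} else UNIV))"
  proof (intro prod.cong refl)
    fix e
    have "{..<Suc \<delta>} \<inter> {1..} = {1..<Suc \<delta>}" by auto
    moreover have "1 - y = real \<delta> / real (Suc \<delta>)" by (simp add: y_def field_simps)
    ultimately show "(if e \<in> ?C then 1 - y else 1) =
      measure_pmf.prob (pmf_of_set {..<Suc \<delta>}) (if e \<in> ?C then {1..} else UNIV)"
      by (simp add: measure_pmf_of_set lessThan_empty_iff)
  qed
  also have "\<dots> = measure_pmf.prob coin_pmf (Pi (edges G) (\<lambda>e. if e \<in> ?C then {1..} else UNIV))"
    unfolding coin_pmf_def by (rule measure_Pi_pmf_Pi[OF fin(2), symmetric])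
  also have "Pi (edges G) (\<lambda>e. if e \<in> ?C then {1..} else UNIV) =
      {c :: nat \<Rightarrow> nat. {e \<in> edges G. c e = 0} \<inter> ?C = {}}"
  proof -
    have p1: "c \<in> Pi (edges G) (\<lambda>e. if e \<in> ?C then {1..} else UNIV) \<longleftrightarrow> (\<forall>e\<in>?C. c e \<noteq> 0)" for c :: "nat \<Rightarrow> nat"
    proof -
      have "(c e \<in> (if e \<in> ?C then {1..} else UNIV)) \<longleftrightarrow> (e \<in> ?C \<longrightarrow> c e \<noteq> 0)" for e
        by (cases "e \<in> ?C") (simp_all add: Suc_le_eq)
      then show ?thesis using C(1) by (simp only: Pi_iff) blast
    qed
    have p2: "{e \<in> edges G. c e = 0} \<inter> ?C = {} \<longleftrightarrow> (\<forall>e\<in>?C. c e \<noteq> 0)" for c :: "nat \<Rightarrow> nat"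
      using C(1) by (simp only: disjoint_iff) (auto dest: subsetD)
    show ?thesis by (intro set_eqI) (simp only: mem_Collect_eq p1 p2)
  qed
  finally show ?thesis .
qed

text \<open>Choices and coins are independent, so the exponents 16 and 4 add up.\<close>

lemma prob_preserved:
  assumes S: "nontrivial_cut G S" "approx_min_cut (2 - \<epsilon>) G S" and \<epsilon>: "0 < \<epsilon>" "\<epsilon> \<le> 1"
  shows "exp (- 20 / \<epsilon>) \<le> measure_pmf.prob (pair_pmf (out_pmf slots) coin_pmf)
    {x. preserves_cut G (sampled x) S}"
proof -
  have split: "{x. preserves_cut G (sampled x) S} =
      {r. outs slots r \<inter> cut_edges G S = {}} \<times> {c. {e \<in> edges G. c e = 0} \<inter> cut_edges G S = {}}"
  proof (intro set_eqI)
    fix x :: "(nat \<Rightarrow> nat) \<times> (nat \<Rightarrow> nat)"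
    have "X \<inter> (A \<union> B) = {} \<longleftrightarrow> A \<inter> X = {} \<and> B \<inter> X = {}" for X A B :: "nat set" by blast
    then show "x \<in> {x. preserves_cut G (sampled x) S} \<longleftrightarrow>
      x \<in> {r. outs slots r \<inter> cut_edges G S = {}} \<times> {c. {e \<in> edges G. c e = 0} \<inter> cut_edges G S = {}}"
      by (cases x) (simp only: sampled_def preserves_cut_def mem_Collect_eq mem_Times_iff fst_conv snd_conv case_prod_conv)
  qed
  have "- 20 / \<epsilon> = - 16 / \<epsilon> + - 4 / \<epsilon>" by (simp only: add_divide_distrib[symmetric]) simp
  then have "exp (- 20 / \<epsilon>) = exp (- 16 / \<epsilon>) * exp (- 4 / \<epsilon>)" by (simp only: exp_add)
  also have "\<dots> \<le> measure_pmf.prob (out_pmf slots) {r. outs slots r \<inter> cut_edges G S = {}} *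
      measure_pmf.prob coin_pmf {c. {e \<in> edges G. c e = 0} \<inter> cut_edges G S = {}}"
    by (intro mult_mono prob_outs_avoid[OF S \<epsilon>] prob_coins_avoid[OF S \<epsilon>]) simp_all
  finally show ?thesis unfolding split measure_pair_pmf_Times .
qed

lemma finite_coin_pmf: "finite (set_pmf coin_pmf)"
  unfolding coin_pmf_def by (rule finite_set_Pi_pmf_of_set[OF fin(2)]) (simp_all add: lessThan_empty_iff)

lemma finite_samples: "finite (set_pmf (pair_pmf (out_pmf slots) coin_pmf))"
  by (simp add: finite_coin_pmf finite_out_pmf finite_slots)

lemma comps_antimono: "D \<subseteq> D' \<Longrightarrow> comps G D' \<le> comps G D"
  unfolding comps_def
  by (intro card_quotient_antimono[OF fin(1) equiv_conn_via equiv_conn_via conn_via_mono])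

text \<open>Coins can only merge components further, so the bound for the choices alone carries over
  through their marginal distribution.\<close>

lemma expectation_comps_sampled:
  "measure_pmf.expectation (pair_pmf (out_pmf slots) coin_pmf) (\<lambda>x. real (comps G (sampled x)))
    \<le> 5 * real (card (verts G)) / real \<delta>"
proof -
  have "measure_pmf.expectation (pair_pmf (out_pmf slots) coin_pmf) (\<lambda>x. real (comps G (sampled x)))
    \<le> measure_pmf.expectation (pair_pmf (out_pmf slots) coin_pmf) (\<lambda>x. real (comps G (outs slots (fst x))))"
    by (intro expectation_mono finite_samples) (auto simp: sampled_def intro!: comps_antimono)
  also have "\<dots> = measure_pmf.expectation (map_pmf fst (pair_pmf (out_pmf slots) coin_pmf)) (\<lambda>r. real (comps G (outs slots r)))"
    by simp
  also have "\<dots> = measure_pmf.expectation (out_pmf slots) (\<lambda>r. real (comps G (outs slots r)))"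
    by (simp only: map_fst_pair_pmf)
  also have "\<dots> \<le> 5 * real (card (verts G)) / real \<delta>" by (rule expectation_comps)
  finally show ?thesis .
qed

text \<open>Given the choices, at most \<open>\<delta> + 1\<close> edges per component are expected
  to survive the coins. Averaging over the choices multiplies
  \<open>\<delta> + 1 \<le> 2 * \<delta>\<close> by the expected number of components, hence
  \<open>10 = 2 * 5\<close>.\<close>

lemma expectation_edges_sampled:
  "measure_pmf.expectation (pair_pmf (out_pmf slots) coin_pmf)
      (\<lambda>x. real (card (edges (contract G (sampled x))))) \<le> 10 * real (card (verts G))"
proof -
  let ?X = "\<lambda>x. real (card (edges (contract G (sampled x))))"
  have "measure_pmf.expectation (pair_pmf (out_pmf slots) coin_pmf) ?X
    = (\<Sum>r\<in>set_pmf (out_pmf slots). pmf (out_pmf slots) r * measure_pmf.expectation coin_pmf (\<lambda>c. ?X (r, c)))"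
    unfolding pair_pmf_def
    by (subst pmf_expectation_bind[of "set_pmf (out_pmf slots)"])
       (simp_all add: finite_out_pmf finite_slots finite_coin_pmf map_pmf_def[symmetric])
  also have "\<dots> \<le> (\<Sum>r\<in>set_pmf (out_pmf slots). pmf (out_pmf slots) r * (real (Suc \<delta>) * real (comps G (outs slots r))))"
  proof (intro sum_mono mult_left_mono pmf_nonneg)
    fix r
    have "measure_pmf.expectation (Pi_pmf (edges G) 0 (\<lambda>_. pmf_of_set {..<Suc \<delta>}))
      (\<lambda>c. real (card (edges G \<inter> edges (contract G (outs slots r \<union> {e \<in> edges G. c e = 0})))))
      \<le> real (Suc \<delta>) * real (comps G (outs slots r))"
      by (rule expectation_surviving_edges[OF simple _ fin(2)]) auto
    moreover have "edges G \<inter> edges (contract G D) = edges (contract G D)" for D :: "nat set"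
      using edges_contract_subset[of G D] by blast
    ultimately show "measure_pmf.expectation coin_pmf (\<lambda>c. ?X (r, c)) \<le> real (Suc \<delta>) * real (comps G (outs slots r))"
      by (simp add: coin_pmf_def sampled_def)
  qed
  also have "\<dots> = real (Suc \<delta>) * (\<Sum>r\<in>set_pmf (out_pmf slots). pmf (out_pmf slots) r * real (comps G (outs slots r)))"
    by (simp add: sum_distrib_left algebra_simps)
  also have "(\<Sum>r\<in>set_pmf (out_pmf slots). pmf (out_pmf slots) r * real (comps G (outs slots r)))
    = measure_pmf.expectation (out_pmf slots) (\<lambda>r. real (comps G (outs slots r)))"
    by (subst integral_measure_pmf[of "set_pmf (out_pmf slots)"]) (auto simp: finite_out_pmf finite_slots)
  also have "real (Suc \<delta>) * \<dots> \<le> (2 * real \<delta>) * (5 * real (card (verts G)) / real \<delta>)"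
    using \<delta>_pos by (intro mult_mono expectation_comps) auto
  also have "\<dots> = 10 * real (card (verts G))" using \<delta>_pos by simp
  finally show ?thesis .
qed

text \<open>Each size bound may fail with probability \<open>p / 4\<close>, where \<open>p\<close>
  is the lower bound for survival of the cut, so half of \<open>p\<close> remains. Markov's
  inequality then dictates the constants \<open>20 = 4 * 5\<close> and
  \<open>40 = 4 * 10\<close>.\<close>

lemma prob_good:
  assumes S: "nontrivial_cut G S" "approx_min_cut (2 - \<epsilon>) G S" and \<epsilon>: "0 < \<epsilon>" "\<epsilon> \<le> 1"
    and C1: "20 * exp (20 / \<epsilon>) \<le> C1" and C2: "40 * exp (20 / \<epsilon>) \<le> C2"
  shows "exp (- 20 / \<epsilon>) / 2 \<le> measure_pmf.prob (pair_pmf (out_pmf slots) coin_pmf)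
    {x. preserves_cut G (sampled x) S \<and>
        real (comps G (sampled x)) * real \<delta> \<le> C1 * real (card (verts G)) \<and>
        real (card (edges (contract G (sampled x)))) \<le> C2 * real (card (verts G))}"
proof -
  define \<mu> where "\<mu> = pair_pmf (out_pmf slots) coin_pmf"
  define n where "n = real (card (verts G))"
  define p where "p = exp (- 20 / \<epsilon>)"
  have n: "0 < n" using fin by (simp add: n_def card_gt_0_iff)
  have p: "0 < p" "exp (20 / \<epsilon>) = 1 / p" by (simp_all add: p_def exp_minus field_simps)
  have C: "0 < C1" "5 / C1 \<le> p / 4" "0 < C2" "10 / C2 \<le> p / 4"
  proof -
    have a: "20 / p \<le> C1" "40 / p \<le> C2" using C1 C2 p(2) by simp_all
    have "0 < 20 / p" "0 < 40 / p" using p(1) by simp_all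
    with a show pos: "0 < C1" "0 < C2" by linarith+
    show "5 / C1 \<le> p / 4" "10 / C2 \<le> p / 4" using a pos p(1) by (simp_all add: field_simps)
  qed
  define A where "A = {x. preserves_cut G (sampled x) S}"
  define B1 where "B1 = {x. C1 * n / real \<delta> \<le> real (comps G (sampled x))}"
  define B2 where "B2 = {x. C2 * n \<le> real (card (edges (contract G (sampled x))))}"
  have "measure_pmf.prob \<mu> B1 \<le> (5 * n / real \<delta>) / (C1 * n / real \<delta>)"
  proof -
    have pos: "0 < C1 * n / real \<delta>" using n C(1) \<delta>_pos by simp
    have "measure_pmf.prob \<mu> B1 \<le> measure_pmf.expectation \<mu> (\<lambda>x. real (comps G (sampled x))) / (C1 * n / real \<delta>)"
      unfolding B1_def \<mu>_def by (rule prob_ge_le_expectation[OF finite_samples _ pos]) simp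
    also have "\<dots> \<le> (5 * n / real \<delta>) / (C1 * n / real \<delta>)"
      unfolding \<mu>_def n_def[symmetric] using expectation_comps_sampled pos
      by (intro divide_right_mono) (simp_all add: n_def)
    finally show ?thesis .
  qed
  also have "\<dots> = 5 / C1" using n \<delta>_pos by simp
  finally have b1: "measure_pmf.prob \<mu> B1 \<le> p / 4" using C by linarith
  have "measure_pmf.prob \<mu> B2 \<le> (10 * n) / (C2 * n)"
  proof -
    have pos: "0 < C2 * n" using n C(3) by simp
    have "measure_pmf.prob \<mu> B2 \<le> measure_pmf.expectation \<mu> (\<lambda>x. real (card (edges (contract G (sampled x))))) / (C2 * n)"
      unfolding B2_def \<mu>_def by (rule prob_ge_le_expectation[OF finite_samples _ pos]) simp
    also have "\<dots> \<le> (10 * n) / (C2 * n)"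
      unfolding \<mu>_def using expectation_edges_sampled pos
      by (intro divide_right_mono) (simp_all add: n_def)
    finally show ?thesis .
  qed
  also have "\<dots> = 10 / C2" using n by simp
  finally have b2: "measure_pmf.prob \<mu> B2 \<le> p / 4" using C by linarith
  have "p \<le> measure_pmf.prob \<mu> A"
    unfolding A_def \<mu>_def p_def by (rule prob_preserved[OF S \<epsilon>])
  also have "\<dots> \<le> measure_pmf.prob \<mu> ((A - B1 - B2) \<union> (B1 \<union> B2))"
    by (intro measure_pmf.finite_measure_mono) auto
  also have "\<dots> \<le> measure_pmf.prob \<mu> (A - B1 - B2) + measure_pmf.prob \<mu> (B1 \<union> B2)"
    by (rule measure_Un_le) simp_all
  also have "measure_pmf.prob \<mu> (B1 \<union> B2) \<le> measure_pmf.prob \<mu> B1 + measure_pmf.prob \<mu> B2"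
    by (rule measure_Un_le) simp_all
  finally have "p / 2 \<le> measure_pmf.prob \<mu> (A - B1 - B2)" using b1 b2 by linarith
  also have "\<dots> \<le> measure_pmf.prob \<mu> {x. preserves_cut G (sampled x) S \<and>
        real (comps G (sampled x)) * real \<delta> \<le> C1 * n \<and>
        real (card (edges (contract G (sampled x)))) \<le> C2 * n}"
    using \<delta>_pos by (intro measure_pmf.finite_measure_mono) (auto simp: A_def B1_def B2_def field_simps)
  finally show ?thesis by (simp add: p_def \<mu>_def n_def)
qed

end

section \<open>Program logic for the word RAM\<close>

lemma run_Skip [simp]: "run w t (Skip, s) = return_pmf (Skip, s)"
  by (induction t) (simp_all add: bind_return_pmf)

lemma run_add: "run w (t + t') cs = bind_pmf (run w t cs) (run w t')"
proof (induction t arbitrary: cs)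
  case (Suc t)
  then have "run w (t + t') = (\<lambda>cs. bind_pmf (run w t cs) (run w t'))" by (rule ext)
  then show ?case by (simp add: bind_assoc_pmf)
qed (simp add: bind_return_pmf)

text \<open>One equation covers termination, the time bound and the law of the final state, so that
  all three compose through \<open>bind_pmf\<close>.\<close>

definition runs :: "nat \<Rightarrow> nat \<Rightarrow> com \<Rightarrow> state \<Rightarrow> state pmf \<Rightarrow> bool" where
  "runs w t c s \<mu> \<longleftrightarrow> run w t (c, s) = map_pmf (Pair Skip) \<mu>"

lemma runs_mono: "\<lbrakk>runs w t c s \<mu>; t \<le> t'\<rbrakk> \<Longrightarrow> runs w t' c s \<mu>"
  using run_add[of w t "t' - t" "(c, s)"]
  by (simp add: runs_def bind_map_pmf) (simp add: map_pmf_def)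

lemma runs_iff:
  "runs w t c s \<mu> \<longleftrightarrow> (\<forall>x\<in>set_pmf (run w t (c, s)). fst x = Skip) \<and> \<mu> = map_pmf snd (run w t (c, s))"
proof
  assume "runs w t c s \<mu>"
  then show "(\<forall>x\<in>set_pmf (run w t (c, s)). fst x = Skip) \<and> \<mu> = map_pmf snd (run w t (c, s))"
    by (auto simp: runs_def pmf.map_comp comp_def)
next
  assume R: "(\<forall>x\<in>set_pmf (run w t (c, s)). fst x = Skip) \<and> \<mu> = map_pmf snd (run w t (c, s))"
  have "map_pmf (Pair Skip) \<mu> = map_pmf (\<lambda>x. (Skip, snd x)) (run w t (c, s))"
    using R by (simp add: pmf.map_comp comp_def)
  also have "\<dots> = map_pmf (\<lambda>x. x) (run w t (c, s))"
    using R by (intro map_pmf_cong refl) (simp add: prod_eq_iff)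
  finally show "runs w t c s \<mu>" by (simp add: runs_def)
qed

lemma runs_Skip_iff: "runs w t Skip s \<mu> \<longleftrightarrow> \<mu> = return_pmf s"
  by (simp add: runs_iff)

lemma runs_Skip: "runs w t Skip s (return_pmf s)"
  by (simp add: runs_Skip_iff)

text \<open>The extra step discards the finished first half. The bound \<open>t'\<close> is uniform
  over the support of \<open>\<mu>\<close>, so the second half may start in a random state.\<close>

lemma runs_Seq:
  assumes "runs w t c s \<mu>" "\<And>s'. s' \<in> set_pmf \<mu> \<Longrightarrow> runs w t' d s' (\<nu> s')"
  shows "runs w (t + t' + 1) (Seq c d) s (bind_pmf \<mu> \<nu>)"
  using assms
proof (induction t arbitrary: c s \<mu>)
  case 0
  then have "c = Skip" "\<mu> = return_pmf s" by (auto simp: runs_iff)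
  with 0 show ?case by (simp add: runs_def bind_return_pmf)
next
  case (Suc t)
  show ?case
  proof (cases "c = Skip")
    case True
    with Suc.prems(1) have \<mu>: "\<mu> = return_pmf s" by (simp add: runs_Skip_iff)
    have "runs w t' d s (\<nu> s)" using Suc.prems(2) \<mu> by simp
    then have "runs w (Suc t + t') d s (\<nu> s)" by (rule runs_mono) simp
    with True \<mu> show ?thesis by (simp add: runs_def bind_return_pmf)
  next
    case False
    \<comment> \<open>Law of the final state of \<open>c\<close> once its first step has led to
      \<open>x\<close>.\<close>
    define \<mu>' where "\<mu>' = (\<lambda>x. map_pmf snd (run w t x))"
    have r: "runs w t (fst x) (snd x) (\<mu>' x)" "set_pmf (\<mu>' x) \<subseteq> set_pmf \<mu>" if "x \<in> set_pmf (step w c s)" for x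
      using Suc.prems(1) that by (fastforce simp: runs_iff \<mu>'_def set_bind_pmf)+
    have \<mu>: "\<mu> = bind_pmf (step w c s) \<mu>'"
      using Suc.prems(1) by (simp add: runs_iff map_bind_pmf \<mu>'_def)
    have "run w (Suc t + t' + 1) (Seq c d, s)
      = bind_pmf (step w c s) (\<lambda>x. run w (t + t' + 1) (Seq (fst x) d, snd x))"
      using False by (simp add: bind_map_pmf case_prod_beta)
    also have "\<dots> = bind_pmf (step w c s) (\<lambda>x. map_pmf (Pair Skip) (bind_pmf (\<mu>' x) \<nu>))"
    proof (rule bind_pmf_cong[OF refl])
      fix x assume x: "x \<in> set_pmf (step w c s)"
      have "runs w (t + t' + 1) (Seq (fst x) d) (snd x) (bind_pmf (\<mu>' x) \<nu>)"
        using r[OF x] Suc.prems(2) by (intro Suc.IH) auto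
      then show "run w (t + t' + 1) (Seq (fst x) d, snd x) = map_pmf (Pair Skip) (bind_pmf (\<mu>' x) \<nu>)"
        by (simp add: runs_def)
    qed
    also have "\<dots> = map_pmf (Pair Skip) (bind_pmf \<mu> \<nu>)"
      by (simp add: \<mu> map_bind_pmf bind_assoc_pmf)
    finally show ?thesis by (simp add: runs_def)
  qed
qed

lemma runs_Cond: "runs w t (if bval w s b then c else d) s \<mu> \<Longrightarrow> runs w (t + 1) (Cond b c d) s \<mu>"
  by (simp add: runs_def bind_return_pmf)

lemma runs_While_False: "\<not> bval w s b \<Longrightarrow> runs w 2 (While b c) s (return_pmf s)"
  by (simp add: runs_def bind_return_pmf numeral_2_eq_2)

text \<open>The three extra steps are the unfolding of the loop, the test and the removal of the
  finished body.\<close>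

lemma runs_While_True:
  assumes "bval w s b" "runs w t c s \<mu>" "\<And>s'. s' \<in> set_pmf \<mu> \<Longrightarrow> runs w t' (While b c) s' (\<nu> s')"
  shows "runs w (t + t' + 3) (While b c) s (bind_pmf \<mu> \<nu>)"
  using runs_Seq[OF assms(2,3)] assms(1) by (simp add: runs_def bind_return_pmf eval_nat_numeral)

text \<open>\<open>Rand\<close> is excluded too: what remains acts as a state transformer within a
  number of steps that the program text alone bounds.\<close>

primrec loop_free :: "com \<Rightarrow> bool" where
  "loop_free Skip \<longleftrightarrow> True"
| "loop_free (Assign x a) \<longleftrightarrow> True"
| "loop_free (Store x i a) \<longleftrightarrow> True"
| "loop_free (Rand x a) \<longleftrightarrow> False"
| "loop_free (Seq c d) \<longleftrightarrow> loop_free c \<and> loop_free d"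
| "loop_free (Cond b c d) \<longleftrightarrow> loop_free c \<and> loop_free d"
| "loop_free (While b c) \<longleftrightarrow> False"

text \<open>The clauses for \<open>Rand\<close> and \<open>While\<close> are junk here and in \<open>cost\<close> below.\<close>

primrec exec :: "nat \<Rightarrow> com \<Rightarrow> state \<Rightarrow> state" where
  "exec w Skip s = s"
| "exec w (Assign x a) s = set_var x (aval w s a) s"
| "exec w (Store x i a) s = set_arr x (aval w s i) (aval w s a) s"
| "exec w (Rand x a) s = s"
| "exec w (Seq c d) s = exec w d (exec w c s)"
| "exec w (Cond b c d) s = (if bval w s b then exec w c s else exec w d s)"
| "exec w (While b c) s = s"

primrec cost :: "com \<Rightarrow> nat" where
  "cost Skip = 0"
| "cost (Assign x a) = 1"
| "cost (Store x i a) = 1"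
| "cost (Rand x a) = 1"
| "cost (Seq c d) = cost c + cost d + 1"
| "cost (Cond b c d) = max (cost c) (cost d) + 1"
| "cost (While b c) = 0"

lemma runs_Assign: "runs w 1 (Assign x a) s (return_pmf (set_var x (aval w s a) s))"
  by (simp add: runs_def bind_return_pmf)

lemma runs_exec: "loop_free c \<Longrightarrow> runs w (cost c) c s (return_pmf (exec w c s))"
proof (induction c arbitrary: s)
  case (Seq c d)
  have "runs w (cost c + cost d + 1) (Seq c d) s
      (bind_pmf (return_pmf (exec w c s)) (\<lambda>s'. return_pmf (exec w d s')))"
    using Seq by (intro runs_Seq) auto
  then show ?case by (simp add: bind_return_pmf)
next
  case (Cond b c d)
  then have "runs w (max (cost c) (cost d)) (if bval w s b then c else d) s
      (return_pmf (if bval w s b then exec w c s else exec w d s))"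
    by (auto intro: runs_mono[OF _ max.cobounded1] runs_mono[OF _ max.cobounded2])
  then show ?case using runs_Cond by simp
qed (simp_all add: runs_def bind_return_pmf)

lemma runs_Seq_exec:
  assumes "runs w t c s \<mu>" "loop_free d"
  shows "runs w (t + cost d + 1) (Seq c d) s (map_pmf (exec w d) \<mu>)"
  unfolding map_pmf_def by (rule runs_Seq[OF assms(1) runs_exec[OF assms(2)]])

text \<open>A timed total-correctness triple for program pieces whose outcome is a single
  state.\<close>

definition ensures :: "nat \<Rightarrow> nat \<Rightarrow> com \<Rightarrow> state \<Rightarrow> (state \<Rightarrow> bool) \<Rightarrow> bool" where
  "ensures w t c s Q \<longleftrightarrow> (\<exists>s'. runs w t c s (return_pmf s') \<and> Q s')"

lemma ensures_conseq:
  assumes "ensures w t c s Q" "t \<le> t'" "\<And>s'. Q s' \<Longrightarrow> R s'"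
  shows "ensures w t' c s R"
proof -
  obtain s' where "runs w t c s (return_pmf s')" "Q s'" using assms(1) by (auto simp: ensures_def)
  with assms(2,3) show ?thesis unfolding ensures_def using runs_mono[of w t c s "return_pmf s'" t'] by auto
qed

lemma ensures_Seq:
  assumes "ensures w t c s Q" "\<And>s'. Q s' \<Longrightarrow> ensures w t' d s' R"
  shows "ensures w (t + t' + 1) (Seq c d) s R"
proof -
  obtain s' where s': "runs w t c s (return_pmf s')" "Q s'" using assms(1) by (auto simp: ensures_def)
  obtain s'' where s'': "runs w t' d s' (return_pmf s'')" "R s''"
    using assms(2)[OF s'(2)] by (auto simp: ensures_def)
  have "runs w (t + t' + 1) (Seq c d) s (bind_pmf (return_pmf s') (\<lambda>_. return_pmf s''))"
    using s'' by (intro runs_Seq[OF s'(1)]) simp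
  with s'' show ?thesis by (auto simp: ensures_def bind_return_pmf)
qed

lemma ensures_exec: "\<lbrakk>loop_free c; Q (exec w c s)\<rbrakk> \<Longrightarrow> ensures w (cost c) c s Q"
  using runs_exec[of c w s] by (auto simp: ensures_def)

text \<open>Every round costs the body and the 3 steps of \<open>runs_While_True\<close>; the
  failing test at the end costs 2. The initial value of \<open>M\<close> bounds the number of
  rounds.\<close>

lemma ensures_While:
  assumes body: "\<And>s. \<lbrakk>I s; bval w s b\<rbrakk> \<Longrightarrow> ensures w T c s (\<lambda>s'. I s' \<and> M s' < (M s :: nat))"
    and "I s"
  shows "ensures w ((T + 3) * M s + 2) (While b c) s (\<lambda>s'. I s' \<and> \<not> bval w s' b)"
  using assms(2)
proof (induction "M s" arbitrary: s rule: less_induct)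
  case less
  show ?case
  proof (cases "bval w s b")
    case False
    then have "runs w ((T + 3) * M s + 2) (While b c) s (return_pmf s)"
      by (rule runs_mono[OF runs_While_False]) simp
    with False less.prems show ?thesis by (auto simp: ensures_def)
  next
    case True
    obtain s' where s': "runs w T c s (return_pmf s')" "I s'" "M s' < M s"
      using body[OF less.prems True] by (auto simp: ensures_def)
    obtain s'' where s'': "runs w ((T + 3) * M s' + 2) (While b c) s' (return_pmf s'')" "I s''" "\<not> bval w s'' b"
      using less.hyps[OF s'(3,2)] by (auto simp: ensures_def)
    have "runs w (T + ((T + 3) * M s' + 2) + 3) (While b c) s (bind_pmf (return_pmf s') (\<lambda>_. return_pmf s''))"
      using s'' by (intro runs_While_True[OF True s'(1)]) simp
    moreover have "T + ((T + 3) * M s' + 2) + 3 \<le> (T + 3) * M s + 2"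
    proof -
      have "(T + 3) * Suc (M s') \<le> (T + 3) * M s" using s'(3) by (intro mult_le_mono) auto
      then show ?thesis by simp
    qed
    ultimately have "runs w ((T + 3) * M s + 2) (While b c) s (return_pmf s'')"
      using runs_mono by (simp add: bind_return_pmf)
    with s'' show ?thesis by (auto simp: ensures_def)
  qed
qed

section \<open>Frame rule for variables and arrays\<close>

primrec mod_vars :: "com \<Rightarrow> string set" where
  "mod_vars Skip = {}"
| "mod_vars (Assign x a) = {x}"
| "mod_vars (Store x i a) = {}"
| "mod_vars (Rand x a) = {x}"
| "mod_vars (Seq c d) = mod_vars c \<union> mod_vars d"
| "mod_vars (Cond b c d) = mod_vars c \<union> mod_vars d"
| "mod_vars (While b c) = mod_vars c"

primrec mod_arrs :: "com \<Rightarrow> string set" where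
  "mod_arrs Skip = {}"
| "mod_arrs (Assign x a) = {}"
| "mod_arrs (Store x i a) = {x}"
| "mod_arrs (Rand x a) = {}"
| "mod_arrs (Seq c d) = mod_arrs c \<union> mod_arrs d"
| "mod_arrs (Cond b c d) = mod_arrs c \<union> mod_arrs d"
| "mod_arrs (While b c) = mod_arrs c"

definition same_outside :: "string set \<Rightarrow> string set \<Rightarrow> state \<Rightarrow> state \<Rightarrow> bool" where
  "same_outside X A s s' \<longleftrightarrow> (\<forall>x. x \<notin> X \<longrightarrow> var s' x = var s x) \<and> (\<forall>a. a \<notin> A \<longrightarrow> arr s' a = arr s a)"

text \<open>The two sets of the remaining program can only shrink, which lets the frame property be
  iterated over a run.\<close>

lemma step_frame:
  "cs \<in> set_pmf (step w c s) \<Longrightarrow> mod_vars (fst cs) \<subseteq> mod_vars c \<and> mod_arrs (fst cs) \<subseteq> mod_arrs c \<and>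
     same_outside (mod_vars c) (mod_arrs c) s (snd cs)"
proof (induction c arbitrary: cs)
  case (Seq c d)
  show ?case
  proof (cases "c = Skip")
    case True
    then show ?thesis using Seq.prems by (auto simp: same_outside_def)
  next
    case False
    then obtain c' s' where cs': "(c', s') \<in> set_pmf (step w c s)" "cs = (Seq c' d, s')"
      using Seq.prems by auto
    from Seq.IH(1)[OF cs'(1)] cs'(2) show ?thesis by (auto simp: same_outside_def)
  qed
qed (auto simp: same_outside_def set_var_def set_arr_def)

lemma run_frame:
  "cs \<in> set_pmf (run w t (c, s)) \<Longrightarrow> same_outside (mod_vars c) (mod_arrs c) s (snd cs)"
proof (induction t arbitrary: c s)
  case 0
  then show ?case by (simp add: same_outside_def)
next
  case (Suc t)
  then obtain c' s' where 1: "(c', s') \<in> set_pmf (step w c s)" "cs \<in> set_pmf (run w t (c', s'))"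
    by auto
  from step_frame[OF 1(1)] Suc.IH[OF 1(2)] show ?case by (auto simp: same_outside_def)
qed

lemma ensures_frame:
  "ensures w t c s Q \<Longrightarrow> ensures w t c s (\<lambda>s'. Q s' \<and> same_outside (mod_vars c) (mod_arrs c) s s')"
proof -
  assume "ensures w t c s Q"
  then obtain s' where s': "runs w t c s (return_pmf s')" "Q s'" by (auto simp: ensures_def)
  from s'(1) have "(Skip, s') \<in> set_pmf (run w t (c, s))" by (simp add: runs_def)
  from run_frame[OF this] s' show ?thesis by (auto simp: ensures_def)
qed

section \<open>Counting loops and arrays of random numbers\<close>

definition For :: "string \<Rightarrow> aexp \<Rightarrow> com \<Rightarrow> com" where
  "For i N c = Seq (Assign i (Const 0))
     (While (Less (Var i) N) (Seq c (Assign i (Add (Var i) (Const 1)))))"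

lemma mod_vars_For [simp]: "mod_vars (For i N c) = insert i (mod_vars c)"
  and mod_arrs_For [simp]: "mod_arrs (For i N c) = mod_arrs c"
  by (auto simp: For_def)

lemma var_set_var [simp]: "var (set_var x k s) = (var s)(x := k)"
  and arr_set_var [simp]: "arr (set_var x k s) = arr s"
  and var_set_arr [simp]: "var (set_arr a i k s) = var s"
  and arr_set_arr [simp]: "arr (set_arr a i k s) = (arr s)(a := (arr s a)(i := k))"
  by (simp_all add: set_var_def set_arr_def)

text \<open>\<open>Const 1\<close> is reduced modulo \<open>2 ^ w\<close> and would be 0 at
  \<open>w = 0\<close>; a counter with a round left to do rules that out.\<close>

lemma less_imp_one_mod_2_pow: "\<lbrakk>k < n; n < (2 :: nat) ^ w\<rbrakk> \<Longrightarrow> 1 mod 2 ^ w = (1 :: nat)"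
proof -
  assume "k < n" "n < 2 ^ w"
  then have "1 < (2 :: nat) ^ w" by linarith
  then show ?thesis by (rule mod_less)
qed

text \<open>\<open>indep\<close> keeps the invariant free of the counter, which is tracked by
  \<open>k\<close> instead. A round costs \<open>cost c + 2\<close> with the increment and 3 for the
  loop; the final 4 pays for the initialisation and the failing test.\<close>

lemma ensures_For:
  assumes lf: "loop_free c" and i: "i \<notin> mod_vars c" and n: "n < 2 ^ w"
    and step: "\<And>k s. \<lbrakk>k < n; I k s; var s i = k\<rbrakk> \<Longrightarrow> I (Suc k) (exec w c s)"
    and indep: "\<And>k x s. I k s \<Longrightarrow> I k (set_var i x s)"
    and N: "\<And>k s. \<lbrakk>I k s; var s i = k; k \<le> n\<rbrakk> \<Longrightarrow> aval w s N = n"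
    and init: "I 0 s"
  shows "ensures w ((cost c + 5) * n + 4) (For i N c) s (\<lambda>s'. I n s')"
proof -
  let ?J = "\<lambda>s. \<exists>k\<le>n. I k s \<and> var s i = k"
  let ?c = "Seq c (Assign i (Add (Var i) (Const 1)))"
  have frame: "var (exec w c s) i = var s i" for s
  proof -
    have "(Skip, exec w c s) \<in> set_pmf (run w (cost c) (c, s))"
      using runs_exec[OF lf] by (simp add: runs_def)
    from run_frame[OF this] i show ?thesis by (simp add: same_outside_def)
  qed
  have "ensures w ((cost c + 2 + 3) * (n - var (set_var i 0 s) i) + 2) (While (Less (Var i) N) ?c) (set_var i 0 s)
      (\<lambda>s'. ?J s' \<and> \<not> bval w s' (Less (Var i) N))"
  proof (rule ensures_While[where M = "\<lambda>s. n - var s i"])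
    fix s assume J: "?J s" and b: "bval w s (Less (Var i) N)"
    then obtain k where k: "k \<le> n" "I k s" "var s i = k" by blast
    then have kn: "k < n" using b N by auto
    have "Suc k mod 2 ^ w = Suc k" "1 mod 2 ^ w = (1 :: nat)"
      using kn n less_imp_one_mod_2_pow[OF kn n] by simp_all
    then have ex: "exec w ?c s = set_var i (Suc k) (exec w c s)"
      using k kn by (simp add: frame mod_simps)
    have "ensures w (cost ?c) ?c s (\<lambda>s'. ?J s' \<and> n - var s' i < n - var s i)"
    proof (rule ensures_exec)
      show "loop_free ?c" using lf by simp
      show "?J (exec w ?c s) \<and> n - var (exec w ?c s) i < n - var s i"
        unfolding ex using indep[OF step[OF kn k(2,3)]] kn k by auto
    qed
    then show "ensures w (cost c + 2) ?c s (\<lambda>s'. ?J s' \<and> n - var s' i < n - var s i)" by simp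
  next
    show "?J (set_var i 0 s)" using indep[OF init] by auto
  qed
  then have W: "ensures w ((cost c + 5) * n + 2) (While (Less (Var i) N) ?c) (set_var i 0 s) (\<lambda>s'. I n s')"
    by (rule ensures_conseq) (use N in \<open>auto simp: not_less\<close>)
  have "ensures w (1 + ((cost c + 5) * n + 2) + 1) (For i N c) s (\<lambda>s'. I n s')"
    unfolding For_def
  proof (rule ensures_Seq[where Q = "\<lambda>s'. s' = set_var i 0 s"])
    show "ensures w 1 (Assign i (Const 0)) s (\<lambda>s'. s' = set_var i 0 s)"
      using runs_Assign[of w i "Const 0" s] by (simp add: ensures_def)
  qed (use W in simp)
  then show ?thesis by (rule ensures_conseq) simp_all
qed

text \<open>The scratch variable is reset after each store, so the state depends only on the counter
  and the array drawn so far. This makes the final law an image of a \<open>Pi_pmf\<close>.\<close>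

definition Sample :: "string \<Rightarrow> string \<Rightarrow> string \<Rightarrow> aexp \<Rightarrow> aexp \<Rightarrow> com" where
  "Sample j x a N B = For j N (Seq (Rand x B) (Seq (Store a (Var j) (Var x)) (Assign x (Const 0))))"

lemma runs_Sample:
  fixes s :: state and j x a :: string and b :: "nat \<Rightarrow> nat"
  defines "st \<equiv> \<lambda>k f. s\<lparr>var := (var s)(j := k, x := 0), arr := (arr s)(a := f)\<rparr>"
  defines "p \<equiv> \<lambda>k. pmf_of_set {..<max (Suc 0) (b k)}"
  assumes jx: "j \<noteq> x" and n: "n < 2 ^ w" and x: "var s x = 0" and a: "arr s a = (\<lambda>_. 0)"
    and N: "\<And>k f. k \<le> n \<Longrightarrow> aval w (st k f) N = n"
    and B: "\<And>k f. k < n \<Longrightarrow> aval w (st k f) B = b k"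
  shows "runs w (11 * n + 4) (Sample j x a N B) s (map_pmf (st n) (Pi_pmf {..<n} 0 p))"
proof -
  let ?r = "Seq (Store a (Var j) (Var x)) (Assign x (Const 0))"
  let ?c = "Seq (Seq (Rand x B) ?r) (Assign j (Add (Var j) (Const 1)))"
  let ?W = "While (Less (Var j) N) ?c"
  \<comment> \<open>Law of the final state when round \<open>k\<close> is next: entries from
    \<open>k\<close> on are still random, those below are read from the current state.\<close>
  define \<nu> where "\<nu> = (\<lambda>k (s' :: state). map_pmf (\<lambda>g. st n (\<lambda>i. if i \<in> {k..<n} then g i else arr s' a i)) (Pi_pmf {k..<n} 0 p))"
  have \<nu>_st: "\<nu> k (st k' f) = map_pmf (\<lambda>g. st n (\<lambda>i. if i \<in> {k..<n} then g i else f i)) (Pi_pmf {k..<n} 0 p)" for k k' f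
  proof -
    have "arr (st k' f) a = f" by (simp add: st_def)
    then show ?thesis by (simp only: \<nu>_def)
  qed
  have body: "runs w 7 ?c (st k f) (map_pmf (\<lambda>y. st (Suc k) (f(k := y))) (p k))" if k: "k < n" for k f
  proof -
    have R: "runs w 1 (Rand x B) (st k f) (map_pmf (\<lambda>y. set_var x y (st k f)) (p k))"
    proof -
      have "run w 0 = return_pmf" by (simp add: fun_eq_iff)
      then show ?thesis
        using B[OF k] by (simp add: runs_def p_def bind_return_pmf' pmf.map_comp comp_def)
    qed
    let ?i = "Assign j (Add (Var j) (Const 1))"
    have "runs w 7 ?c (st k f) (map_pmf (\<lambda>y. exec w ?i (exec w ?r (set_var x y (st k f)))) (p k))"
    proof -
      have lf: "loop_free ?r" "loop_free ?i" and t: "1 + cost ?r + 1 + cost ?i + 1 = 7" by simp_all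
      from runs_Seq_exec[OF runs_Seq_exec[OF R lf(1)] lf(2)] show ?thesis
        by (simp only: t pmf.map_comp comp_def)
    qed
    moreover have "exec w ?i (exec w ?r (set_var x y (st k f))) = st (Suc k) (f(k := y))" for y
    proof -
      have "Suc k mod 2 ^ w = Suc k" "1 mod 2 ^ w = (1 :: nat)"
        using k n less_imp_one_mod_2_pow[OF k n] by simp_all
      then show ?thesis
        using jx by (simp add: st_def set_var_def set_arr_def fun_upd_twist mod_simps)
    qed
    ultimately show ?thesis by simp
  qed
  have loop: "runs w (10 * (n - k) + 2) ?W (st k f) (\<nu> k (st k f))" if "k \<le> n" for k f
    using that
  proof (induction "n - k" arbitrary: k f)
    case 0
    then have k: "k = n" by simp
    have "\<nu> n (st n f) = return_pmf (st n f)" by (simp add: \<nu>_st)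
    moreover have "\<not> bval w (st n f) (Less (Var j) N)"
      using N[of n f] jx by (simp add: st_def)
    from runs_While_False[OF this, of ?c]
    have "runs w 2 ?W (st n f) (return_pmf (st n f))" .
    ultimately show ?case by (simp add: k numeral_2_eq_2)
  next
    case (Suc d)
    then have k: "k < n" by simp
    have b: "bval w (st k f) (Less (Var j) N)" using N[of k f] k jx by (simp add: st_def)
    have R: "runs w (7 + (10 * (n - Suc k) + 2) + 3) ?W (st k f)
      (bind_pmf (map_pmf (\<lambda>y. st (Suc k) (f(k := y))) (p k)) (\<nu> (Suc k)))"
    proof (rule runs_While_True[OF b body[OF k]])
      fix s' assume "s' \<in> set_pmf (map_pmf (\<lambda>y. st (Suc k) (f(k := y))) (p k))"
      then obtain y where "s' = st (Suc k) (f(k := y))" by auto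
      then show "runs w (10 * (n - Suc k) + 2) ?W s' (\<nu> (Suc k) s')"
        using Suc.hyps(1)[of "Suc k" "f(k := y)"] Suc.hyps(2) k by simp
    qed
    have T: "7 + (10 * (n - Suc k) + 2) + 3 = 10 * (n - k) + 2" using k by simp
    \<comment> \<open>Entry \<open>k\<close> is split off the product distribution: drawing it
      before the later entries is the same as drawing all of them together.\<close>
    have E: "bind_pmf (map_pmf (\<lambda>y. st (Suc k) (f(k := y))) (p k)) (\<nu> (Suc k)) = \<nu> k (st k f)"
    proof -
      have ins: "{k..<n} = insert k {Suc k..<n}" using k by auto
      have "\<nu> k (st k f) = map_pmf (\<lambda>(y, g). st n (\<lambda>i. if i \<in> {k..<n} then (g(k := y)) i else f i))
        (pair_pmf (p k) (Pi_pmf {Suc k..<n} 0 p))"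
        unfolding \<nu>_st
        by (subst (2) ins, subst Pi_pmf_insert) (auto simp: pmf.map_comp comp_def intro!: map_pmf_cong)
      also have "\<dots> = map_pmf (\<lambda>(y, g). st n (\<lambda>i. if i \<in> {Suc k..<n} then g i else (f(k := y)) i))
        (pair_pmf (p k) (Pi_pmf {Suc k..<n} 0 p))"
        using k by (intro map_pmf_cong refl) (auto intro!: arg_cong[of _ _ "st n"] simp: fun_eq_iff)
      also have "\<dots> = bind_pmf (map_pmf (\<lambda>y. st (Suc k) (f(k := y))) (p k)) (\<nu> (Suc k))"
        unfolding pair_pmf_def
        by (simp add: bind_map_pmf map_bind_pmf \<nu>_st) (simp add: map_pmf_def bind_assoc_pmf bind_return_pmf)
      finally show ?thesis ..
    qed
    show ?case using R unfolding T E .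
  qed
  have init: "runs w 1 (Assign j (Const 0)) s (return_pmf (st 0 (\<lambda>_. 0)))"
  proof -
    have "set_var j (aval w s (Const 0)) s = st 0 (\<lambda>_. 0)"
      using x a jx by (simp add: st_def set_var_def fun_upd_idem fun_upd_twist)
    then show ?thesis using runs_Assign[of w j "Const 0" s] by simp
  qed
  have "runs w (1 + (10 * n + 2) + 1) (Sample j x a N B) s (bind_pmf (return_pmf (st 0 (\<lambda>_. 0))) (\<nu> 0))"
    unfolding Sample_def For_def using loop[of 0 "\<lambda>_. 0"] by (intro runs_Seq[OF init]) simp
  moreover have "bind_pmf (return_pmf (st 0 (\<lambda>_. 0))) (\<nu> 0) = map_pmf (st n) (Pi_pmf {..<n} 0 p)"
  proof -
    have "\<nu> 0 (st 0 (\<lambda>_. 0)) = map_pmf (st n) (Pi_pmf {..<n} 0 p)"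
      unfolding \<nu>_def atLeast0LessThan
    proof (intro map_pmf_cong refl arg_cong[of _ _ "st n"] ext)
      \<comment> \<open>Outside the range the product distribution has its default 0, which is also
        the content of the zeroed array.\<close>
      fix g i assume "g \<in> set_pmf (Pi_pmf {..<n} 0 p)"
      then have "g i = 0" if "i \<notin> {..<n}" using set_Pi_pmf_subset[of "{..<n}" 0 p] that by auto
      then show "(if i \<in> {..<n} then g i else arr (st 0 (\<lambda>_. 0)) a i) = g i" by (auto simp: st_def)
    qed
    then show ?thesis by (simp add: bind_return_pmf)
  qed
  ultimately have "runs w (1 + (10 * n + 2) + 1) (Sample j x a N B) s (map_pmf (st n) (Pi_pmf {..<n} 0 p))" by simp
  then show ?thesis by (rule runs_mono) simp
qed

section \<open>Adjacency lists and simple passes over the graph\<close>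

text \<open>\<open>big\<close> makes vertices, edges, shifted pointers, slot numbers and sums of two
  vertices fit into a word, so that computing them never wraps around.\<close>

locale input_graph =
  fixes G :: "(nat, nat) mgraph" and n m w :: nat and src dst :: "nat \<Rightarrow> nat"
  assumes simple: "simple_graph G"
    and verts: "verts G = {..<n}" and edges: "edges G = {..<m}"
    and ends: "\<And>e. e < m \<Longrightarrow> ends G e = {src e, dst e}"
    and big: "2 * (n + m) + 2 < 2 ^ w"
begin

definition inc :: "nat \<Rightarrow> nat \<Rightarrow> bool" where
  "inc v e \<longleftrightarrow> v = src e \<or> v = dst e"

text \<open>For an edge \<open>e\<close> at \<open>v\<close>, \<open>cnt v e\<close> is the rank of
  \<open>e\<close> among the edges at \<open>v\<close>, counted from 0. The recursion mirrors the
  pass of \<open>Build\<close>.\<close>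

primrec cnt :: "nat \<Rightarrow> nat \<Rightarrow> nat" where
  "cnt v 0 = 0"
| "cnt v (Suc e) = cnt v e + (if inc v e then 1 else 0)"

text \<open>Adjacency lists are linked lists of edges in decreasing order, with pointers shifted by one:
  \<open>last_inc v k\<close> is \<open>e + 1\<close> for the largest edge \<open>e < k\<close> incident to \<open>v\<close>, and \<open>0\<close> if there is none.\<close>

primrec last_inc :: "nat \<Rightarrow> nat \<Rightarrow> nat" where
  "last_inc v 0 = 0"
| "last_inc v (Suc e) = (if inc v e then Suc e else last_inc v e)"

lemma src_dst: "e < m \<Longrightarrow> src e < n \<and> dst e < n \<and> src e \<noteq> dst e"
proof -
  assume e: "e < m"
  then have "ends G e \<subseteq> verts G" "card (ends G e) = 2"
    using simple edges by (auto simp: simple_graph_def)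
  then show ?thesis using ends[OF e] verts by (auto simp: card_insert_if split: if_splits)
qed

lemma cnt_le: "cnt v k \<le> k"
  by (induction k) auto

lemma cnt_eq_card: "cnt v k = card {e. e < k \<and> inc v e}"
proof (induction k)
  case (Suc k)
  have "{e. e < Suc k \<and> inc v e} = (if inc v k then insert k {e. e < k \<and> inc v e} else {e. e < k \<and> inc v e})"
    by (auto simp: less_Suc_eq)
  then show ?case using Suc by auto
qed auto

lemma last_inc_gt: "\<lbrakk>inc v e; e < k\<rbrakk> \<Longrightarrow> e < last_inc v k"
  by (induction k) (auto simp: less_Suc_eq)

lemma last_inc_le: "last_inc v k \<le> k"
  by (induction k) auto

lemma inc_last_inc: "0 < last_inc v k \<Longrightarrow> inc v (last_inc v k - 1)"
  by (induction k) auto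

text \<open>Following a list pointer skips only edges that are not at \<open>v\<close>, so
  \<open>cnt v p\<close> counts the list entries still ahead of pointer \<open>p\<close>.\<close>

lemma cnt_last_inc: "cnt v (last_inc v k) = cnt v k"
  by (induction k) auto

lemma sum_cnt: "k \<le> m \<Longrightarrow> (\<Sum>v<n. cnt v k) = 2 * k"
proof (induction k)
  case (Suc k)
  have "{..<n} \<inter> {v. inc v k} = {src k, dst k}" using src_dst[of k] Suc.prems by (auto simp: inc_def)
  then have "(\<Sum>v<n. if inc v k then 1 else 0) = (2 :: nat)"
    using src_dst[of k] Suc.prems by (simp add: sum.If_cases)
  then show ?case using Suc by (simp add: sum.distrib)
qed simp

definition base :: "state \<Rightarrow> bool" where
  "base s \<longleftrightarrow> var s ''n'' = n \<and> var s ''m'' = m \<and> arr s ''tail'' = src \<and> arr s ''head'' = dst"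

lemma big_facts: "m < 2 ^ w" "n < 2 ^ w" "1 < (2 :: nat) ^ w" "2 < (2 :: nat) ^ w"
  "k \<le> 2 * (n + m) + 2 \<Longrightarrow> k mod 2 ^ w = k"
  "1 mod 2 ^ w = (1 :: nat)" "Suc 0 mod 2 ^ w = Suc 0" "2 mod 2 ^ w = (2 :: nat)"
proof -
  show pos: "1 < (2 :: nat) ^ w" "2 < (2 :: nat) ^ w" "m < 2 ^ w" "n < 2 ^ w"
    by (rule le_less_trans[OF _ big], simp)+
  show "k mod 2 ^ w = k" if "k \<le> 2 * (n + m) + 2" using le_less_trans[OF that big] by (rule mod_less)
  show "1 mod 2 ^ w = (1 :: nat)" "2 mod 2 ^ w = (2 :: nat)" by (rule mod_less, rule pos)+
  then show "Suc 0 mod 2 ^ w = Suc 0" by (simp only: One_nat_def)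
qed

lemma mod_Suc_eq: "k \<le> 2 * (n + m) + 1 \<Longrightarrow> Suc k mod 2 ^ w = Suc k"
  using big_facts(5)[of "Suc k"] by simp

text \<open>\<open>rt\<close> and \<open>rh\<close> hold the rank of an edge at its tail and at its
  head, \<open>nt\<close> and \<open>nh\<close> its successors in the two adjacency lists.\<close>

definition adjacency :: "state \<Rightarrow> bool" where
  "adjacency s \<longleftrightarrow> (\<forall>v. arr s ''deg'' v = cnt v m) \<and> (\<forall>v. arr s ''first'' v = last_inc v m) \<and>
     (\<forall>e<m. arr s ''rt'' e = cnt (src e) e \<and> arr s ''rh'' e = cnt (dst e) e \<and>
            arr s ''nt'' e = last_inc (src e) e \<and> arr s ''nh'' e = last_inc (dst e) e)"

end

text \<open>Each edge is prepended to the lists of both endpoints, and the degree counted so far is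
  its rank there. The two halves do not interfere because the endpoints differ.\<close>

definition Build :: com where
  "Build = For ''e'' (Var ''m'')
    (Seq (Store ''rt'' (Var ''e'') (Load ''deg'' (Load ''tail'' (Var ''e''))))
    (Seq (Store ''nt'' (Var ''e'') (Load ''first'' (Load ''tail'' (Var ''e''))))
    (Seq (Store ''deg'' (Load ''tail'' (Var ''e'')) (Add (Load ''deg'' (Load ''tail'' (Var ''e''))) (Const 1)))
    (Seq (Store ''first'' (Load ''tail'' (Var ''e'')) (Add (Var ''e'') (Const 1)))
    (Seq (Store ''rh'' (Var ''e'') (Load ''deg'' (Load ''head'' (Var ''e''))))
    (Seq (Store ''nh'' (Var ''e'') (Load ''first'' (Load ''head'' (Var ''e''))))
    (Seq (Store ''deg'' (Load ''head'' (Var ''e'')) (Add (Load ''deg'' (Load ''head'' (Var ''e''))) (Const 1)))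
         (Store ''first'' (Load ''head'' (Var ''e'')) (Add (Var ''e'') (Const 1))))))))))"

definition Min_Deg :: com where
  "Min_Deg = Seq (Assign ''d'' (Load ''deg'' (Const 0)))
    (For ''v'' (Var ''n'')
      (Cond (Less (Load ''deg'' (Var ''v'')) (Var ''d'')) (Assign ''d'' (Load ''deg'' (Var ''v''))) Skip))"

text \<open>The edge picked by a slot is found without random access to the lists: every edge
  compares its two ranks with the numbers drawn by its endpoints. One pass over the edges thus
  suffices.\<close>

definition Mark :: com where
  "Mark = For ''e'' (Var ''m'')
    (Cond (Conj (Neg (Eq (Load ''coin'' (Var ''e'')) (Const 0)))
          (Conj (Conj (Neg (Eq (Load ''rt'' (Var ''e'')) (Load ''r'' (Add (Load ''tail'' (Var ''e'')) (Load ''tail'' (Var ''e''))))))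
                      (Neg (Eq (Load ''rt'' (Var ''e'')) (Load ''r'' (Add (Add (Load ''tail'' (Var ''e'')) (Load ''tail'' (Var ''e''))) (Const 1))))))
                (Conj (Neg (Eq (Load ''rh'' (Var ''e'')) (Load ''r'' (Add (Load ''head'' (Var ''e'')) (Load ''head'' (Var ''e''))))))
                      (Neg (Eq (Load ''rh'' (Var ''e'')) (Load ''r'' (Add (Add (Load ''head'' (Var ''e'')) (Load ''head'' (Var ''e''))) (Const 1))))))))
      Skip (Store ''contracted'' (Var ''e'') (Const 1)))"

definition Mark_All :: com where
  "Mark_All = For ''e'' (Var ''m'') (Store ''contracted'' (Var ''e'') (Const 1))"

definition Output :: com where
  "Output = Seq (Assign ''m_out'' (Const 0)) (For ''e'' (Var ''m'')
    (Cond (Eq (Load ''label'' (Load ''tail'' (Var ''e''))) (Load ''label'' (Load ''head'' (Var ''e'')))) Skip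
      (Seq (Store ''id_out'' (Var ''m_out'') (Var ''e''))
      (Seq (Store ''tail_out'' (Var ''m_out'') (Load ''label'' (Load ''tail'' (Var ''e''))))
      (Seq (Store ''head_out'' (Var ''m_out'') (Load ''label'' (Load ''head'' (Var ''e''))))
           (Assign ''m_out'' (Add (Var ''m_out'') (Const 1))))))))"

context input_graph
begin

lemma ensures_Build:
  assumes "base s" "arr s ''deg'' = (\<lambda>_. 0)" "arr s ''first'' = (\<lambda>_. 0)"
  shows "ensures w (20 * m + 4) Build s adjacency"
proof -
  define I where "I = (\<lambda>k s. base s \<and> (\<forall>v. arr s ''deg'' v = cnt v k) \<and> (\<forall>v. arr s ''first'' v = last_inc v k) \<and>
     (\<forall>e<k. arr s ''rt'' e = cnt (src e) e \<and> arr s ''rh'' e = cnt (dst e) e \<and>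
            arr s ''nt'' e = last_inc (src e) e \<and> arr s ''nh'' e = last_inc (dst e) e))"
  have "ensures w (20 * m + 4) Build s (\<lambda>s'. I m s')"
    unfolding Build_def
  proof (rule ensures_conseq[OF ensures_For[where n = m and I = I]])
    fix k s assume k: "k < m" and I: "I k s" and e: "var s ''e'' = k"
    have mods: "Suc k mod 2 ^ w = Suc k" "\<And>v. Suc (cnt v k) mod 2 ^ w = Suc (cnt v k)"
    proof -
      show "Suc k mod 2 ^ w = Suc k" using k by (intro mod_Suc_eq) simp
      show "Suc (cnt v k) mod 2 ^ w = Suc (cnt v k)" for v
        using cnt_le[of v k] k by (intro mod_Suc_eq) simp
    qed
    show "I (Suc k) (exec w (Seq (Store ''rt'' (Var ''e'') (Load ''deg'' (Load ''tail'' (Var ''e''))))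
      (Seq (Store ''nt'' (Var ''e'') (Load ''first'' (Load ''tail'' (Var ''e''))))
      (Seq (Store ''deg'' (Load ''tail'' (Var ''e'')) (Add (Load ''deg'' (Load ''tail'' (Var ''e''))) (Const 1)))
      (Seq (Store ''first'' (Load ''tail'' (Var ''e'')) (Add (Var ''e'') (Const 1)))
      (Seq (Store ''rh'' (Var ''e'') (Load ''deg'' (Load ''head'' (Var ''e''))))
      (Seq (Store ''nh'' (Var ''e'') (Load ''first'' (Load ''head'' (Var ''e''))))
      (Seq (Store ''deg'' (Load ''head'' (Var ''e'')) (Add (Load ''deg'' (Load ''head'' (Var ''e''))) (Const 1)))
           (Store ''first'' (Load ''head'' (Var ''e'')) (Add (Var ''e'') (Const 1)))))))))) s)"
      using I e src_dst[OF k] mods big_facts(6,7)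
      by (auto simp: I_def base_def inc_def less_Suc_eq)
  next
    fix k s x assume "I k s" then show "I k (set_var ''e'' x s)" by (simp add: I_def base_def)
  qed (use assms big_facts in \<open>auto simp: I_def base_def\<close>)
  then show ?thesis by (rule ensures_conseq) (auto simp: I_def adjacency_def)
qed

lemma ensures_Min_Deg:
  assumes "base s" "0 < n" "\<forall>v. arr s ''deg'' v = cnt v m"
  shows "ensures w (8 * n + 6) Min_Deg s (\<lambda>s'. var s' ''d'' = Min ((\<lambda>v. cnt v m) ` {..<n}))"
proof -
  define I where "I = (\<lambda>k (s' :: state). arr s' = arr s \<and> var s' ''n'' = n \<and>
    (\<forall>v<k. var s' ''d'' \<le> cnt v m) \<and> (\<exists>v<n. var s' ''d'' = cnt v m))"
  have "ensures w (1 + (8 * n + 4) + 1) Min_Deg s (\<lambda>s'. I n s')"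
    unfolding Min_Deg_def
  proof (rule ensures_Seq[where Q = "\<lambda>s'. s' = set_var ''d'' (cnt 0 m) s"])
    show "ensures w 1 (Assign ''d'' (Load ''deg'' (Const 0))) s (\<lambda>s'. s' = set_var ''d'' (cnt 0 m) s)"
      using runs_Assign[of w "''d''" "Load ''deg'' (Const 0)" s] assms by (simp add: ensures_def)
  next
    fix s' assume s': "s' = set_var ''d'' (cnt 0 m) s"
    show "ensures w (8 * n + 4) (For ''v'' (Var ''n'')
      (Cond (Less (Load ''deg'' (Var ''v'')) (Var ''d'')) (Assign ''d'' (Load ''deg'' (Var ''v''))) Skip)) s' (\<lambda>s'. I n s')"
    proof (rule ensures_conseq[OF ensures_For[where n = n and I = I]])
      fix k s assume "k < n" "I k s" "var s ''v'' = k"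
      then show "I (Suc k) (exec w (Cond (Less (Load ''deg'' (Var ''v'')) (Var ''d'')) (Assign ''d'' (Load ''deg'' (Var ''v''))) Skip) s)"
        using assms(3) by (auto simp: I_def less_Suc_eq intro: less_imp_le order_trans)
    qed (use assms big_facts s' in \<open>auto simp: I_def base_def\<close>)
  qed
  then show ?thesis
  proof (rule ensures_conseq)
    fix s' assume "I n s'"
    then show "var s' ''d'' = Min ((\<lambda>v. cnt v m) ` {..<n})"
      by (intro Min_eqI[symmetric]) (auto simp: I_def)
  qed simp
qed

text \<open>The sampled set as the machine sees it, in terms of ranks;
  \<open>choice_edges_eq_sampled\<close> identifies it with \<open>sampled\<close>.\<close>

definition choice_edges :: "(nat \<Rightarrow> nat) \<Rightarrow> (nat \<Rightarrow> nat) \<Rightarrow> nat set" where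
  "choice_edges r c = {e. e < m \<and> (c e = 0 \<or>
     cnt (src e) e = r (2 * src e) \<or> cnt (src e) e = r (2 * src e + 1) \<or>
     cnt (dst e) e = r (2 * dst e) \<or> cnt (dst e) e = r (2 * dst e + 1))}"

lemma ensures_Mark:
  assumes "base s" "adjacency s" "arr s ''contracted'' = (\<lambda>_. 0)"
  shows "ensures w (7 * m + 4) Mark s
    (\<lambda>s'. \<forall>e<m. arr s' ''contracted'' e \<noteq> 0 \<longleftrightarrow> e \<in> choice_edges (arr s ''r'') (arr s ''coin''))"
proof -
  let ?D = "choice_edges (arr s ''r'') (arr s ''coin'')"
  define I where "I = (\<lambda>k s'. base s' \<and> arr s' ''rt'' = arr s ''rt'' \<and> arr s' ''rh'' = arr s ''rh'' \<and>
    arr s' ''r'' = arr s ''r'' \<and> arr s' ''coin'' = arr s ''coin'' \<and>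
    (\<forall>e<k. arr s' ''contracted'' e \<noteq> 0 \<longleftrightarrow> e \<in> ?D) \<and> (\<forall>e\<ge>k. arr s' ''contracted'' e = 0))"
  have "ensures w (7 * m + 4) Mark s (\<lambda>s'. I m s')"
    unfolding Mark_def
  proof (rule ensures_conseq[OF ensures_For[where n = m and I = I]])
    fix k s' assume k: "k < m" and I: "I k s'" and e: "var s' ''e'' = k"
    have mods: "(src k + src k) mod 2 ^ w = 2 * src k" "(dst k + dst k) mod 2 ^ w = 2 * dst k"
      "Suc (2 * src k) mod 2 ^ w = Suc (2 * src k)" "Suc (2 * dst k) mod 2 ^ w = Suc (2 * dst k)"
      using src_dst[OF k] big_facts(5)[of "2 * src k"] big_facts(5)[of "2 * dst k"]
      by (simp_all add: mult_2 mod_Suc_eq)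
    have rank: "arr s ''rt'' k = cnt (src k) k" "arr s ''rh'' k = cnt (dst k) k"
      using assms(2) k by (auto simp: adjacency_def)
    show "I (Suc k) (exec w (Cond (Conj (Neg (Eq (Load ''coin'' (Var ''e'')) (Const 0)))
          (Conj (Conj (Neg (Eq (Load ''rt'' (Var ''e'')) (Load ''r'' (Add (Load ''tail'' (Var ''e'')) (Load ''tail'' (Var ''e''))))))
                      (Neg (Eq (Load ''rt'' (Var ''e'')) (Load ''r'' (Add (Add (Load ''tail'' (Var ''e'')) (Load ''tail'' (Var ''e''))) (Const 1))))))
                (Conj (Neg (Eq (Load ''rh'' (Var ''e'')) (Load ''r'' (Add (Load ''head'' (Var ''e'')) (Load ''head'' (Var ''e''))))))
                      (Neg (Eq (Load ''rh'' (Var ''e'')) (Load ''r'' (Add (Add (Load ''head'' (Var ''e'')) (Load ''head'' (Var ''e''))) (Const 1))))))))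
      Skip (Store ''contracted'' (Var ''e'') (Const 1))) s')"
      using I e k mods rank big_facts(6,7)
      by (auto simp: I_def base_def less_Suc_eq choice_edges_def)
  next
    fix k s' x assume "I k s'" then show "I k (set_var ''e'' x s')" by (simp add: I_def base_def)
  qed (use assms big_facts in \<open>auto simp: I_def base_def\<close>)
  then show ?thesis by (rule ensures_conseq) (auto simp: I_def)
qed

lemma ensures_Mark_All:
  assumes "base s"
  shows "ensures w (6 * m + 4) Mark_All s (\<lambda>s'. \<forall>e<m. arr s' ''contracted'' e \<noteq> 0)"
proof -
  define I where "I = (\<lambda>k s'. base s' \<and> (\<forall>e<k. arr s' ''contracted'' e \<noteq> 0))"
  have "ensures w (6 * m + 4) Mark_All s (\<lambda>s'. I m s')"
    unfolding Mark_All_def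
  proof (rule ensures_conseq[OF ensures_For[where n = m and I = I]])
    fix k s' x assume "I k s'" then show "I k (set_var ''e'' x s')" by (simp add: I_def base_def)
  qed (use assms big_facts in \<open>auto simp: I_def base_def less_Suc_eq\<close>)
  then show ?thesis by (rule ensures_conseq) (auto simp: I_def)
qed

text \<open>The bound \<open>k\<close> on the edges lets the same predicate serve as loop invariant
  of \<open>Output\<close>.\<close>

definition survivors_listed :: "nat \<Rightarrow> state \<Rightarrow> bool" where
  "survivors_listed k s \<longleftrightarrow>
     bij_betw (arr s ''id_out'') {..<var s ''m_out''} {e. e < k \<and> arr s ''label'' (src e) \<noteq> arr s ''label'' (dst e)} \<and>
     (\<forall>j<var s ''m_out''. arr s ''tail_out'' j = arr s ''label'' (src (arr s ''id_out'' j)) \<and>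
        arr s ''head_out'' j = arr s ''label'' (dst (arr s ''id_out'' j)))"

lemma survivors_listed_m_out_le: "survivors_listed k s \<Longrightarrow> var s ''m_out'' \<le> k"
proof -
  assume "survivors_listed k s"
  then have "var s ''m_out'' = card {e. e < k \<and> arr s ''label'' (src e) \<noteq> arr s ''label'' (dst e)}"
    using bij_betw_same_card by (fastforce simp: survivors_listed_def)
  also have "\<dots> \<le> card {..<k}" by (intro card_mono) auto
  finally show ?thesis by simp
qed

lemma ensures_Output:
  assumes "base s"
  shows "ensures w (13 * m + 6) Output s (survivors_listed m)"
proof -
  define I where "I = (\<lambda>k s'. base s' \<and> survivors_listed k s')"
  have "ensures w (1 + (13 * m + 4) + 1) Output s (\<lambda>s'. I m s')"
    unfolding Output_def
  proof (rule ensures_Seq[where Q = "\<lambda>s'. s' = set_var ''m_out'' 0 s"])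
    show "ensures w 1 (Assign ''m_out'' (Const 0)) s (\<lambda>s'. s' = set_var ''m_out'' 0 s)"
      using runs_Assign[of w "''m_out''" "Const 0" s] by (simp add: ensures_def)
  next
    fix s' assume s': "s' = set_var ''m_out'' 0 s"
    show "ensures w (13 * m + 4) (For ''e'' (Var ''m'')
    (Cond (Eq (Load ''label'' (Load ''tail'' (Var ''e''))) (Load ''label'' (Load ''head'' (Var ''e'')))) Skip
      (Seq (Store ''id_out'' (Var ''m_out'') (Var ''e''))
      (Seq (Store ''tail_out'' (Var ''m_out'') (Load ''label'' (Load ''tail'' (Var ''e''))))
      (Seq (Store ''head_out'' (Var ''m_out'') (Load ''label'' (Load ''head'' (Var ''e''))))
           (Assign ''m_out'' (Add (Var ''m_out'') (Const 1)))))))) s' (\<lambda>s'. I m s')"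
    proof (rule ensures_conseq[OF ensures_For[where n = m and I = I]])
      fix k s assume k: "k < m" and I: "I k s" and e: "var s ''e'' = k"
      let ?lab = "arr s ''label''" and ?i = "var s ''m_out''"
      have "?i \<le> k" using I survivors_listed_m_out_le by (simp add: I_def)
      then have md: "Suc ?i mod 2 ^ w = Suc ?i" using k by (simp add: mod_Suc_eq)
      have b: "base s" "bij_betw (arr s ''id_out'') {..<?i} {e. e < k \<and> ?lab (src e) \<noteq> ?lab (dst e)}"
        "\<And>j. j < ?i \<Longrightarrow> arr s ''tail_out'' j = ?lab (src (arr s ''id_out'' j)) \<and>
          arr s ''head_out'' j = ?lab (dst (arr s ''id_out'' j))"
        using I by (auto simp: I_def survivors_listed_def)
      show "I (Suc k) (exec w (Cond (Eq (Load ''label'' (Load ''tail'' (Var ''e''))) (Load ''label'' (Load ''head'' (Var ''e'')))) Skip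
      (Seq (Store ''id_out'' (Var ''m_out'') (Var ''e''))
      (Seq (Store ''tail_out'' (Var ''m_out'') (Load ''label'' (Load ''tail'' (Var ''e''))))
      (Seq (Store ''head_out'' (Var ''m_out'') (Load ''label'' (Load ''head'' (Var ''e''))))
           (Assign ''m_out'' (Add (Var ''m_out'') (Const 1))))))) s)"
      proof (cases "?lab (src k) = ?lab (dst k)")
        case True
        then have "{e. e < Suc k \<and> ?lab (src e) \<noteq> ?lab (dst e)} = {e. e < k \<and> ?lab (src e) \<noteq> ?lab (dst e)}"
          by (auto simp: less_Suc_eq)
        then show ?thesis using True I e b(1) by (simp add: I_def base_def survivors_listed_def)
      next
        case False
        then have "{e. e < Suc k \<and> ?lab (src e) \<noteq> ?lab (dst e)} = insert k {e. e < k \<and> ?lab (src e) \<noteq> ?lab (dst e)}"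
          by (auto simp: less_Suc_eq)
        moreover have "bij_betw ((arr s ''id_out'')(?i := k)) (insert ?i {..<?i}) (insert k {e. e < k \<and> ?lab (src e) \<noteq> ?lab (dst e)})"
        proof -
          have "bij_betw ((arr s ''id_out'')(?i := k)) {..<?i} {e. e < k \<and> ?lab (src e) \<noteq> ?lab (dst e)}"
            using b(2) by (subst bij_betw_cong[of _ _ "arr s ''id_out''"]) auto
          from notIn_Un_bij_betw[OF _ _ this, of ?i] show ?thesis by simp
        qed
        moreover have "{..<Suc ?i} = insert ?i {..<?i}" by auto
        ultimately show ?thesis
          using False e b(1,3) md big_facts(6,7)
          by (simp add: I_def base_def survivors_listed_def less_Suc_eq)
      qed
    next
      fix k s' x assume "I k s'" then show "I k (set_var ''e'' x s')" by (simp add: I_def base_def survivors_listed_def)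
    qed (use assms big_facts s' in \<open>auto simp: I_def base_def survivors_listed_def bij_betw_def\<close>)
  qed
  then show ?thesis by (rule ensures_conseq) (auto simp: I_def)
qed

end

section \<open>Breadth-first search\<close>

context input_graph
begin

text \<open>State of the breadth-first search: vertices with mark \<open>ph\<close> have been enqueued in \<open>q\<close>; the
  first \<open>qh\<close> of them have been dequeued. The edges of \<open>D\<close> at dequeued vertices have been scanned,
  except that at the current vertex \<open>u\<close> the edges below \<open>p\<close> are still pending.\<close>

definition bfs_inv :: "nat set \<Rightarrow> nat \<Rightarrow> (nat \<Rightarrow> nat) \<Rightarrow> (nat \<Rightarrow> nat) \<Rightarrow> (nat \<Rightarrow> nat) \<Rightarrow>
    nat \<Rightarrow> nat \<Rightarrow> nat \<Rightarrow> nat \<Rightarrow> nat \<Rightarrow> nat \<Rightarrow> bool" where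
  "bfs_inv D ph seen lab q p u qh qt cur k \<longleftrightarrow>
     qh \<le> qt \<and> cur \<le> n \<and> p \<le> m \<and> inj_on q {..<qt} \<and> q ` {..<qt} \<subseteq> {..<n} \<and>
     (\<forall>v. seen v \<le> ph) \<and> (\<forall>v. seen v = ph \<longleftrightarrow> v \<in> q ` {..<qt}) \<and>
     (\<forall>v\<in>q ` {..<qt}. lab v < k) \<and>
     (\<forall>v\<in>q ` {..<qt}. \<forall>v'\<in>q ` {..<qt}. lab v = lab v' \<longleftrightarrow> (v, v') \<in> conn_via G D) \<and>
     (\<forall>j<k. \<exists>v\<in>q ` {..<qt}. lab v = j) \<and>
     (\<forall>v\<in>q ` {..<qh}. \<forall>e\<in>D. inc v e \<longrightarrow> (v = u \<longrightarrow> p \<le> e) \<longrightarrow> src e \<in> q ` {..<qt} \<and> dst e \<in> q ` {..<qt}) \<and>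
     (0 < p \<longrightarrow> u \<in> q ` {..<qh} \<and> inc u (p - 1)) \<and>
     {..<cur} \<subseteq> q ` {..<qt}"

text \<open>Remaining work: list entries of vertices not yet dequeued, entries left in the current
  list, dequeues, enqueues and moves of the root pointer.\<close>

definition bfs_measure :: "(nat \<Rightarrow> nat) \<Rightarrow> nat \<Rightarrow> nat \<Rightarrow> nat \<Rightarrow> nat \<Rightarrow> nat \<Rightarrow> nat" where
  "bfs_measure q p u qh qt cur =
     (\<Sum>v\<in>{..<n} - q ` {..<qh}. cnt v m) + cnt u p + (n - qh) + (n - qt) + (n - cur)"

lemma bfs_invD:
  assumes "bfs_inv D ph seen lab q p u qh qt cur k"
  shows "qh \<le> qt" "cur \<le> n" "p \<le> m" "inj_on q {..<qt}" "q ` {..<qt} \<subseteq> {..<n}"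
    "\<And>v. seen v \<le> ph" "\<And>v. seen v = ph \<longleftrightarrow> v \<in> q ` {..<qt}"
    "\<And>v. v \<in> q ` {..<qt} \<Longrightarrow> lab v < k"
    "\<And>v v'. \<lbrakk>v \<in> q ` {..<qt}; v' \<in> q ` {..<qt}\<rbrakk> \<Longrightarrow> lab v = lab v' \<longleftrightarrow> (v, v') \<in> conn_via G D"
    "\<And>j. j < k \<Longrightarrow> \<exists>v\<in>q ` {..<qt}. lab v = j"
    "\<And>v e. \<lbrakk>v \<in> q ` {..<qh}; e \<in> D; inc v e; v = u \<Longrightarrow> p \<le> e\<rbrakk> \<Longrightarrow> src e \<in> q ` {..<qt} \<and> dst e \<in> q ` {..<qt}"
    "0 < p \<Longrightarrow> u \<in> q ` {..<qh}" "0 < p \<Longrightarrow> inc u (p - 1)"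
    "{..<cur} \<subseteq> q ` {..<qt}"
  using assms unfolding bfs_inv_def by blast+

lemma bfs_invI:
  assumes "qh \<le> qt" "cur \<le> n" "p \<le> m" "inj_on q {..<qt}" "q ` {..<qt} \<subseteq> {..<n}"
    "\<And>v. seen v \<le> ph" "\<And>v. seen v = ph \<longleftrightarrow> v \<in> q ` {..<qt}"
    "\<And>v. v \<in> q ` {..<qt} \<Longrightarrow> lab v < k"
    "\<And>v v'. \<lbrakk>v \<in> q ` {..<qt}; v' \<in> q ` {..<qt}\<rbrakk> \<Longrightarrow> lab v = lab v' \<longleftrightarrow> (v, v') \<in> conn_via G D"
    "\<And>j. j < k \<Longrightarrow> \<exists>v\<in>q ` {..<qt}. lab v = j"
    "\<And>v e. \<lbrakk>v \<in> q ` {..<qh}; e \<in> D; inc v e; v = u \<Longrightarrow> p \<le> e\<rbrakk> \<Longrightarrow> src e \<in> q ` {..<qt} \<and> dst e \<in> q ` {..<qt}"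
    "0 < p \<Longrightarrow> u \<in> q ` {..<qh}" "0 < p \<Longrightarrow> inc u (p - 1)"
    "{..<cur} \<subseteq> q ` {..<qt}"
  shows "bfs_inv D ph seen lab q p u qh qt cur k"
  unfolding bfs_inv_def by (intro conjI allI impI ballI; (rule assms; blast)?) (use assms in blast)+

lemma bfs_init: "(\<And>v. seen v < ph) \<Longrightarrow> bfs_inv D ph seen lab q 0 u 0 0 0 0"
  by (rule bfs_invI) (auto simp: less_imp_le dest: less_imp_neq)

text \<open>The queue is injective into the vertices, and every label in use is attained on it. The
  bounds exclude overflow and leave room in the queue for an unseen vertex.\<close>

lemma bfs_counts:
  assumes I: "bfs_inv D ph seen lab q p u qh qt cur k"
  shows "qt \<le> n" "k \<le> qt" "\<lbrakk>x < n; seen x < ph\<rbrakk> \<Longrightarrow> qt < n"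
proof -
  note I = bfs_invD[OF I]
  have c: "card (q ` {..<qt}) = qt" using I(4) by (simp add: card_image)
  show "qt \<le> n" using card_mono[OF _ I(5)] c by simp
  have "{..<k} \<subseteq> lab ` q ` {..<qt}" using I(10) by blast
  then have "k \<le> card (lab ` q ` {..<qt})" using card_mono[of "lab ` q ` {..<qt}" "{..<k}"] by simp
  also have "\<dots> \<le> card (q ` {..<qt})" by (rule card_image_le) simp
  finally show "k \<le> qt" using c by simp
  assume "x < n" "seen x < ph"
  then have "x \<notin> q ` {..<qt}" using I(7)[of x] by simp
  then have "q ` {..<qt} \<subset> {..<n}" using I(5) \<open>x < n\<close> by blast
  from psubset_card_mono[OF _ this] c show "qt < n" by simp
qed

lemma image_enqueue:
  assumes "qh \<le> qt"
  shows "(q(qt := x)) ` {..<Suc qt} = insert x (q ` {..<qt})" "(q(qt := x)) ` {..<qh} = q ` {..<qh}"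
  using assms by (auto simp: lessThan_Suc image_iff)

text \<open>The machine computes the other endpoint as a sum minus \<open>u\<close>; truncated
  subtraction is harmless because \<open>u\<close> is one of the summands.\<close>

lemma other_end:
  assumes "e < m" "inc u e"
  shows "src e + dst e - u < n" "inc (src e + dst e - u) e" "{src e, dst e} = {u, src e + dst e - u}"
  using assms src_dst[OF assms(1)] by (auto simp: inc_def)

text \<open>Entry \<open>e\<close> in the list of \<open>u\<close> is passed without an enqueue.
  Marks never exceed \<open>ph\<close>, so a skipped edge of \<open>D\<close> leads to a vertex that
  is queued already.\<close>

lemma bfs_scan:
  assumes I: "bfs_inv D ph seen lab q (Suc e) u qh qt cur k"
    and skip: "e \<in> D \<Longrightarrow> ph \<le> seen (src e + dst e - u)"
  shows "bfs_inv D ph seen lab q (last_inc u e) u qh qt cur k"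
proof -
  note I' = bfs_invD[OF I]
  have u: "u \<in> q ` {..<qh}" "inc u e" "e < m" using I'(3,12,13) by auto
  have uQ: "u \<in> q ` {..<qt}" using u(1) I'(1) by auto
  show ?thesis
  proof (rule bfs_invI)
    show "last_inc u e \<le> m" using last_inc_le[of u e] u(3) by linarith
    show "src e' \<in> q ` {..<qt} \<and> dst e' \<in> q ` {..<qt}"
      if v: "v \<in> q ` {..<qh}" "e' \<in> D" "inc v e'" "v = u \<Longrightarrow> last_inc u e \<le> e'" for v e'
    proof (cases "v = u \<and> e' \<le> e")
      case True
      have "\<not> e' < e" using last_inc_gt[of u e' e] v(3,4) True by auto
      then have "e' = e" using True by simp
      have "seen (src e + dst e - u) = ph" using skip v(2) I'(6)[of "src e + dst e - u"] \<open>e' = e\<close> by simp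
      then have "src e + dst e - u \<in> q ` {..<qt}" using I'(7) by simp
      then show ?thesis using other_end(3)[OF u(3,2)] uQ \<open>e' = e\<close> by (metis doubleton_eq_iff)
    next
      case False
      then show ?thesis using I'(11)[OF v(1-3)] by auto
    qed
    show "0 < last_inc u e \<Longrightarrow> inc u (last_inc u e - 1)" by (rule inc_last_inc)
  qed (use I' in auto)
qed

lemma bfs_push:
  assumes D: "D \<subseteq> {..<m}" and I: "bfs_inv D ph seen lab q (Suc e) u qh qt cur k"
    and e: "e \<in> D" and x: "x = src e + dst e - u" "seen x < ph"
  shows "bfs_inv D ph (seen(x := ph)) (lab(x := lab u)) (q(qt := x)) (last_inc u e) u qh (Suc qt) cur k"
proof -
  note I' = bfs_invD[OF I]
  have u: "u \<in> q ` {..<qh}" "inc u e" "e < m" using I'(3,12,13) by auto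
  have uQ: "u \<in> q ` {..<qt}" using u(1) I'(1) by auto
  have xQ: "x \<notin> q ` {..<qt}" using I'(7)[of x] x(2) by simp
  have xn: "x < n" "inc x e" "{src e, dst e} = {u, x}" using other_end[OF u(3,2)] x by simp_all
  have un: "u < n" using uQ I'(5) by auto
  have ux: "(u, x) \<in> conn_via G D"
    using conn_via_edge[OF e, of G u x] ends[OF u(3)] xn un verts by simp
  note im = image_enqueue[OF I'(1), of q x]
  show ?thesis
  proof (rule bfs_invI)
    show "inj_on (q(qt := x)) {..<Suc qt}"
      using I'(4) xQ by (auto simp: lessThan_Suc inj_on_def)
    show "(q(qt := x)) ` {..<Suc qt} \<subseteq> {..<n}" using I'(5) xn unfolding im by auto
    show "(seen(x := ph)) v = ph \<longleftrightarrow> v \<in> (q(qt := x)) ` {..<Suc qt}" for v using I'(7) unfolding im by auto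
    show "(lab(x := lab u)) v < k" if "v \<in> (q(qt := x)) ` {..<Suc qt}" for v
      using that I'(8) uQ unfolding im by auto
    show "(lab(x := lab u)) v = (lab(x := lab u)) v' \<longleftrightarrow> (v, v') \<in> conn_via G D"
      if "v \<in> (q(qt := x)) ` {..<Suc qt}" "v' \<in> (q(qt := x)) ` {..<Suc qt}" for v v'
    proof -
      \<comment> \<open>\<open>f\<close> sends the new vertex to \<open>u\<close>, which has the
        same label and lies in the same component. The label condition thus reduces to vertices
        queued before.\<close>
      define f where "f = (\<lambda>v. if v = x then u else v)"
      have f: "f z \<in> q ` {..<qt}" "(lab(x := lab u)) z = lab (f z)" "(z, f z) \<in> conn_via G D"
        if "z \<in> (q(qt := x)) ` {..<Suc qt}" for z
      proof -
        have z: "z = x \<or> z \<in> q ` {..<qt}" using that unfolding im by simp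
        then show "f z \<in> q ` {..<qt}" "(lab(x := lab u)) z = lab (f z)" using uQ by (auto simp: f_def)
        show "(z, f z) \<in> conn_via G D"
          using z conn_via_sym[OF ux] conn_via_refl[of z G D] I'(5) verts by (auto simp: f_def)
      qed
      have "(v, v') \<in> conn_via G D \<longleftrightarrow> (f v, f v') \<in> conn_via G D"
        using f(3)[OF that(1)] f(3)[OF that(2)] conn_via_trans[of _ _ G D] conn_via_sym[of _ _ G D] by meson
      then show ?thesis using f that I'(9) by simp
    qed
    show "\<exists>v\<in>(q(qt := x)) ` {..<Suc qt}. (lab(x := lab u)) v = j" if j: "j < k" for j
    proof -
      obtain v where "v \<in> q ` {..<qt}" "lab v = j" using I'(10)[OF j] by blast
      moreover have "v \<noteq> x" using \<open>v \<in> q ` {..<qt}\<close> xQ by blast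
      ultimately show ?thesis unfolding im by auto
    qed
    show "last_inc u e \<le> m" using last_inc_le[of u e] u(3) by linarith
    show "src e' \<in> (q(qt := x)) ` {..<Suc qt} \<and> dst e' \<in> (q(qt := x)) ` {..<Suc qt}"
      if v: "v \<in> (q(qt := x)) ` {..<qh}" "e' \<in> D" "inc v e'" "v = u \<Longrightarrow> last_inc u e \<le> e'" for v e'
    proof (cases "v = u \<and> e' \<le> e")
      case True
      have "\<not> e' < e" using last_inc_gt[of u e' e] v(3,4) True by auto
      then have "e' = e" using True by simp
      then show ?thesis using xn(3) uQ unfolding im by (metis doubleton_eq_iff insertCI)
    next
      case False
      then show ?thesis using I'(11)[of v e'] v unfolding im by auto
    qed
    show "0 < last_inc u e \<Longrightarrow> inc u (last_inc u e - 1)" by (rule inc_last_inc)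
    show "u \<in> (q(qt := x)) ` {..<qh}" unfolding im by (rule u(1))
    show "{..<cur} \<subseteq> (q(qt := x)) ` {..<Suc qt}" using I'(14) unfolding im by auto
  qed (use I' in auto)
qed

text \<open>All edges at the dequeued vertex lie below its list head, so all of them count as
  pending. Since \<open>p\<close> is 0, nothing is pending at the previous \<open>u\<close>.\<close>

lemma bfs_pop:
  assumes D: "D \<subseteq> {..<m}" and I: "bfs_inv D ph seen lab q 0 u qh qt cur k" and "qh < qt"
  shows "bfs_inv D ph seen lab q (last_inc (q qh) m) (q qh) (Suc qh) qt cur k"
proof -
  note I' = bfs_invD[OF I]
  show ?thesis
  proof (rule bfs_invI)
    show "last_inc (q qh) m \<le> m" by (rule last_inc_le)
    show "src e \<in> q ` {..<qt} \<and> dst e \<in> q ` {..<qt}"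
      if v: "v \<in> q ` {..<Suc qh}" "e \<in> D" "inc v e" "v = q qh \<Longrightarrow> last_inc (q qh) m \<le> e" for v e
    proof (cases "v = q qh")
      case True
      then have "e < last_inc (q qh) m" using last_inc_gt[of "q qh" e m] v(2,3) D by auto
      then show ?thesis using v(4) True by simp
    next
      case False
      then show ?thesis using I'(11)[of v e] v by (auto simp: lessThan_Suc)
    qed
    show "0 < last_inc (q qh) m \<Longrightarrow> inc (q qh) (last_inc (q qh) m - 1)" by (rule inc_last_inc)
  qed (use I' \<open>qh < qt\<close> in auto)
qed

text \<open>With an empty queue and \<open>p = 0\<close>, every edge of \<open>D\<close> at a queued
  vertex has been scanned, so no such edge leaves the queued set.\<close>

lemma bfs_closed:
  assumes D: "D \<subseteq> {..<m}" and I: "bfs_inv D ph seen lab q 0 u qt qt cur k"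
    and "(v, v') \<in> conn_via G D" "v \<in> q ` {..<qt}"
  shows "v' \<in> q ` {..<qt}"
proof (rule conn_via_closed[OF assms(3,4)])
  fix e assume e: "e \<in> D" "ends G e \<inter> q ` {..<qt} \<noteq> {}"
  have en: "ends G e = {src e, dst e}" using ends e(1) D by auto
  then obtain v where "v \<in> q ` {..<qt}" "inc v e" using e(2) by (auto simp: inc_def)
  then show "ends G e \<subseteq> q ` {..<qt}" unfolding en using bfs_invD(11)[OF I, of v e] e(1) by auto
qed

text \<open>By \<open>bfs_closed\<close> no queued vertex is connected to \<open>cur\<close>, hence
  a fresh label is correct.\<close>

lemma bfs_new_root:
  assumes D: "D \<subseteq> {..<m}" and I: "bfs_inv D ph seen lab q 0 u qt qt cur k"
    and cur: "cur < n" "seen cur < ph"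
  shows "bfs_inv D ph (seen(cur := ph)) (lab(cur := k)) (q(qt := cur)) 0 u qt (Suc qt) cur (Suc k)"
proof -
  note I' = bfs_invD[OF I]
  have xQ: "cur \<notin> q ` {..<qt}" using I'(7)[of cur] cur(2) by simp
  note im = image_enqueue[OF I'(1), of q cur]
  have sep: "(v, cur) \<notin> conn_via G D" "(cur, v) \<notin> conn_via G D" if "v \<in> q ` {..<qt}" for v
    using bfs_closed[OF D I _ that] xQ conn_via_sym[of cur v G D] by blast+
  have rr: "(cur, cur) \<in> conn_via G D" using cur verts by (simp add: conn_via_refl)
  show ?thesis
  proof (rule bfs_invI)
    show "inj_on (q(qt := cur)) {..<Suc qt}"
      using I'(4) xQ by (auto simp: lessThan_Suc inj_on_def)
    show "(q(qt := cur)) ` {..<Suc qt} \<subseteq> {..<n}" using I'(5) cur unfolding im by auto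
    show "(seen(cur := ph)) v = ph \<longleftrightarrow> v \<in> (q(qt := cur)) ` {..<Suc qt}" for v using I'(7) unfolding im by auto
    show "(lab(cur := k)) v < Suc k" if "v \<in> (q(qt := cur)) ` {..<Suc qt}" for v
      using that I'(8) unfolding im by (auto simp: less_Suc_eq)
    show "(lab(cur := k)) v = (lab(cur := k)) v' \<longleftrightarrow> (v, v') \<in> conn_via G D"
      if "v \<in> (q(qt := cur)) ` {..<Suc qt}" "v' \<in> (q(qt := cur)) ` {..<Suc qt}" for v v'
      using that I'(8)[of v] I'(8)[of v'] I'(9)[of v v'] sep[of v] sep[of v'] rr unfolding im by auto
    show "\<exists>v\<in>(q(qt := cur)) ` {..<Suc qt}. (lab(cur := k)) v = j" if "j < Suc k" for j
    proof (cases "j = k")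
      case False
      then obtain v where "v \<in> q ` {..<qt}" "lab v = j" using I'(10)[of j] \<open>j < Suc k\<close> by (auto simp: less_Suc_eq)
      moreover have "v \<noteq> cur" using \<open>v \<in> q ` {..<qt}\<close> xQ by blast
      ultimately show ?thesis unfolding im by auto
    qed (auto simp: im)
    show "src e' \<in> (q(qt := cur)) ` {..<Suc qt} \<and> dst e' \<in> (q(qt := cur)) ` {..<Suc qt}"
      if v: "v \<in> (q(qt := cur)) ` {..<qt}" "e' \<in> D" "inc v e'" "v = u \<Longrightarrow> 0 \<le> e'" for v e'
      using I'(11)[of v e'] v unfolding im by auto
    show "{..<cur} \<subseteq> (q(qt := cur)) ` {..<Suc qt}" using I'(14) unfolding im by auto
  qed (use I' in auto)
qed

lemma bfs_old_root:
  assumes I: "bfs_inv D ph seen lab q p u qh qt cur k" and cur: "cur < n" "ph \<le> seen cur"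
  shows "bfs_inv D ph seen lab q p u qh qt (Suc cur) k"
proof -
  note I' = bfs_invD[OF I]
  have "cur \<in> q ` {..<qt}" using I'(7)[of cur] I'(6)[of cur] cur(2) by simp
  then show ?thesis using cur I' by (intro bfs_invI) (auto simp: lessThan_Suc)
qed

lemma bfs_final:
  assumes I: "bfs_inv D ph seen lab q p u qh qt n k"
  shows "\<And>v. v < n \<Longrightarrow> lab v < k" "\<And>j. j < k \<Longrightarrow> \<exists>v<n. lab v = j"
    "\<And>v v'. \<lbrakk>v < n; v' < n\<rbrakk> \<Longrightarrow> lab v = lab v' \<longleftrightarrow> (v, v') \<in> conn_via G D"
    "\<And>v. seen v \<le> ph"
proof -
  note I' = bfs_invD[OF I]
  have "q ` {..<qt} = {..<n}" using I'(5,14) by auto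
  then show "\<exists>v<n. lab v = j" if "j < k" for j using I'(10)[OF that] by auto
  from \<open>q ` {..<qt} = {..<n}\<close> I'(6,8,9) show "\<And>v. v < n \<Longrightarrow> lab v < k"
    "\<And>v v'. \<lbrakk>v < n; v' < n\<rbrakk> \<Longrightarrow> lab v = lab v' \<longleftrightarrow> (v, v') \<in> conn_via G D"
    "\<And>v. seen v \<le> ph" by auto
qed

lemma measure_scan:
  assumes "inc u e" "qt \<le> qt'" "\<And>i. i < qh \<Longrightarrow> q' i = q i"
  shows "bfs_measure q' (last_inc u e) u qh qt' cur < bfs_measure q (Suc e) u qh qt cur"
proof -
  have "q' ` {..<qh} = q ` {..<qh}" using assms(3) by (intro image_cong) auto
  then show ?thesis using assms(1,2) by (simp add: bfs_measure_def cnt_last_inc)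
qed

text \<open>The degree of the dequeued vertex passes from the first summand to the second, and
  \<open>n - qh\<close> falls.\<close>

lemma measure_pop:
  assumes "bfs_inv D ph seen lab q 0 u qh qt cur k" "qh < qt"
  shows "bfs_measure q (last_inc (q qh) m) (q qh) (Suc qh) qt cur < bfs_measure q 0 u qh qt cur"
proof -
  note I' = bfs_invD[OF assms(1)]
  have x: "q qh \<in> {..<n} - q ` {..<qh}"
  proof
    show "q qh \<in> {..<n}" using I'(5) assms(2) by auto
    show "q qh \<notin> q ` {..<qh}"
    proof
      assume "q qh \<in> q ` {..<qh}"
      then obtain i where "i < qh" "q qh = q i" by auto
      then show False using inj_onD[OF I'(4), of qh i] assms(2) by simp
    qed
  qed
  have "{..<n} - q ` {..<Suc qh} = ({..<n} - q ` {..<qh}) - {q qh}" by (auto simp: lessThan_Suc)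
  then have "(\<Sum>v\<in>{..<n} - q ` {..<qh}. cnt v m) = cnt (q qh) m + (\<Sum>v\<in>{..<n} - q ` {..<Suc qh}. cnt v m)"
    using sum.remove[OF _ x] by simp
  moreover have "qh < n" using bfs_counts(1)[OF assms(1)] assms(2) by simp
  ultimately show ?thesis by (simp add: bfs_measure_def cnt_last_inc)
qed

lemma measure_enqueue:
  assumes "qt < n"
  shows "bfs_measure (q(qt := x)) 0 u qt (Suc qt) cur < bfs_measure q 0 u qt qt cur"
  using assms by (simp add: bfs_measure_def)

lemma measure_root: "cur < n \<Longrightarrow> bfs_measure q p u qh qt (Suc cur) < bfs_measure q p u qh qt cur"
  by (simp add: bfs_measure_def)

lemma measure_init: "bfs_measure q 0 u 0 0 0 = 2 * m + 3 * n"
  using sum_cnt[of m] by (simp add: bfs_measure_def)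

end

text \<open>The nested loops over roots, queue and adjacency lists are flattened: one round handles
  one list entry, one dequeue or one root. The body is therefore loop-free, and a single measure
  yields linear time.\<close>

definition Bfs_Step :: com where
  "Bfs_Step =
    Cond (Less (Const 0) (Var ''p''))
      (Seq (Assign ''e'' (Sub (Var ''p'') (Const 1)))
      (Seq (Cond (Eq (Load ''tail'' (Var ''e'')) (Var ''u''))
             (Assign ''p'' (Load ''nt'' (Var ''e''))) (Assign ''p'' (Load ''nh'' (Var ''e''))))
      (Seq (Assign ''x'' (Sub (Add (Load ''tail'' (Var ''e'')) (Load ''head'' (Var ''e''))) (Var ''u'')))
           (Cond (Conj (Less (Const 0) (Load ''contracted'' (Var ''e''))) (Less (Load ''seen'' (Var ''x'')) (Var ''ph'')))
             (Seq (Store ''seen'' (Var ''x'') (Var ''ph''))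
             (Seq (Store ''label'' (Var ''x'') (Load ''label'' (Var ''u'')))
             (Seq (Store ''queue'' (Var ''qt'') (Var ''x''))
                  (Assign ''qt'' (Add (Var ''qt'') (Const 1))))))
             Skip))))
      (Cond (Less (Var ''qh'') (Var ''qt''))
        (Seq (Assign ''u'' (Load ''queue'' (Var ''qh'')))
        (Seq (Assign ''qh'' (Add (Var ''qh'') (Const 1)))
             (Assign ''p'' (Load ''first'' (Var ''u'')))))
        (Cond (Less (Load ''seen'' (Var ''cur'')) (Var ''ph''))
          (Seq (Store ''seen'' (Var ''cur'') (Var ''ph''))
          (Seq (Store ''label'' (Var ''cur'') (Var ''n_out''))
          (Seq (Assign ''n_out'' (Add (Var ''n_out'') (Const 1)))
          (Seq (Store ''queue'' (Var ''qt'') (Var ''cur''))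
               (Assign ''qt'' (Add (Var ''qt'') (Const 1)))))))
          (Assign ''cur'' (Add (Var ''cur'') (Const 1)))))"

text \<open>A second search uses a larger mark \<open>ph\<close> instead of clearing
  \<open>seen\<close>.\<close>

definition Bfs :: "nat \<Rightarrow> com" where
  "Bfs ph =
    Seq (Seq (Assign ''ph'' (Const ph)) (Seq (Assign ''p'' (Const 0)) (Seq (Assign ''qh'' (Const 0))
      (Seq (Assign ''qt'' (Const 0)) (Seq (Assign ''cur'' (Const 0)) (Assign ''n_out'' (Const 0)))))))
    (While (Less (Var ''cur'') (Var ''n'')) Bfs_Step)"

section \<open>Correctness and running time of the search\<close>

context input_graph
begin

lemma w_pos: "0 < w"
  using big_facts(3) by (cases w) simp_all

definition bfs_state :: "nat set \<Rightarrow> nat \<Rightarrow> state \<Rightarrow> bool" where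
  "bfs_state D ph s \<longleftrightarrow> base s \<and> adjacency s \<and> (\<forall>e<m. arr s ''contracted'' e \<noteq> 0 \<longleftrightarrow> e \<in> D) \<and> var s ''ph'' = ph \<and>
     bfs_inv D ph (arr s ''seen'') (arr s ''label'') (arr s ''queue'')
       (var s ''p'') (var s ''u'') (var s ''qh'') (var s ''qt'') (var s ''cur'') (var s ''n_out'')"

definition state_measure :: "state \<Rightarrow> nat" where
  "state_measure s = bfs_measure (arr s ''queue'') (var s ''p'') (var s ''u'') (var s ''qh'') (var s ''qt'') (var s ''cur'')"

lemma Bfs_Step_scan:
  assumes D: "D \<subseteq> {..<m}" and S: "bfs_state D ph s" and p: "var s ''p'' = Suc e"
  shows "bfs_state D ph (exec w Bfs_Step s) \<and> state_measure (exec w Bfs_Step s) < state_measure s"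
proof -
  have b: "base s" "adjacency s" and c: "\<And>e. e < m \<Longrightarrow> arr s ''contracted'' e \<noteq> 0 \<longleftrightarrow> e \<in> D" and ph: "var s ''ph'' = ph"
    and I: "bfs_inv D ph (arr s ''seen'') (arr s ''label'') (arr s ''queue'')
       (Suc e) (var s ''u'') (var s ''qh'') (var s ''qt'') (var s ''cur'') (var s ''n_out'')"
    using S p by (auto simp: bfs_state_def)
  define u where "u = var s ''u''"
  define x where "x = src e + dst e - u"
  have e: "e < m" "inc u e" using bfs_invD(3,13)[OF I] by (auto simp: u_def)
  have xn: "x < n" unfolding x_def by (rule other_end(1)[OF e])
  have md: "(src e + dst e) mod 2 ^ w = src e + dst e" using src_dst[OF e(1)] by (intro big_facts(5)) simp
  have push: "bfs_inv D ph ((arr s ''seen'')(x := ph)) ((arr s ''label'')(x := arr s ''label'' u))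
      ((arr s ''queue'')(var s ''qt'' := x)) (last_inc u e) u (var s ''qh'') (Suc (var s ''qt'')) (var s ''cur'') (var s ''n_out'')"
    if "e \<in> D" "arr s ''seen'' x < ph"
    unfolding u_def by (rule bfs_push[OF D I that(1)]) (use that x_def u_def in auto)
  have skip: "bfs_inv D ph (arr s ''seen'') (arr s ''label'') (arr s ''queue'') (last_inc u e) u
      (var s ''qh'') (var s ''qt'') (var s ''cur'') (var s ''n_out'')"
    if "\<not> (e \<in> D \<and> arr s ''seen'' x < ph)"
    unfolding u_def by (rule bfs_scan[OF I]) (use that x_def u_def in auto)
  have md2: "Suc (var s ''qt'') mod 2 ^ w = Suc (var s ''qt'')"
    using bfs_counts(1)[OF I] by (intro mod_Suc_eq) simp
  have qh: "var s ''qh'' \<le> var s ''qt''" by (rule bfs_invD(1)[OF I])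
  have m1: "bfs_measure (arr s ''queue'') (last_inc u e) u (var s ''qh'') (var s ''qt'') (var s ''cur'') < state_measure s"
    unfolding state_measure_def p u_def[symmetric] by (rule measure_scan[OF e(2)]) simp_all
  have m2: "bfs_measure ((arr s ''queue'')(var s ''qt'' := x)) (last_inc u e) u (var s ''qh'') (Suc (var s ''qt'')) (var s ''cur'') < state_measure s"
    unfolding state_measure_def p u_def[symmetric] by (rule measure_scan[OF e(2)]) (use qh in auto)
  have te: "arr s ''tail'' e = src e" "arr s ''head'' e = dst e" using b(1) by (simp_all add: base_def)
  \<comment> \<open>Whether \<open>u\<close> is the tail or the head of \<open>e\<close> decides
    which of the two successor pointers belongs to its list.\<close>
  have ends_u: "(src e = u \<and> dst e = x \<and> u \<noteq> x \<and> arr s ''nt'' e = last_inc u e) \<or>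
      (src e = x \<and> dst e = u \<and> u \<noteq> x \<and> arr s ''nh'' e = last_inc u e)"
    using e b(2) src_dst[OF e(1)] by (auto simp: inc_def adjacency_def x_def)
  show ?thesis
  proof (cases "e \<in> D \<and> arr s ''seen'' x < ph")
    case True
    define s' where "s' = exec w Bfs_Step s"
    have "var s' = (var s)(''e'' := e, ''p'' := last_inc u e, ''x'' := x, ''qt'' := Suc (var s ''qt'')) \<and>
      arr s' = (arr s)(''seen'' := (arr s ''seen'')(x := ph), ''label'' := (arr s ''label'')(x := arr s ''label'' u),
         ''queue'' := (arr s ''queue'')(var s ''qt'' := x))"
      using ends_u
    proof
      assume "src e = u \<and> dst e = x \<and> u \<noteq> x \<and> arr s ''nt'' e = last_inc u e"
      then show ?thesis using True c[OF e(1)] md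
        by (simp add: s'_def Bfs_Step_def u_def[symmetric] p te md2 ph w_pos)
    next
      assume "src e = x \<and> dst e = u \<and> u \<noteq> x \<and> arr s ''nh'' e = last_inc u e"
      then show ?thesis using True c[OF e(1)] md
        by (simp add: s'_def Bfs_Step_def u_def[symmetric] p te md2 ph w_pos)
    qed
    then have "bfs_state D ph s' \<and> state_measure s' < state_measure s"
      using push True m2 b c ph
      by (simp add: bfs_state_def base_def adjacency_def) (simp add: state_measure_def u_def)
    then show ?thesis by (simp add: s'_def)
  next
    case False
    define s' where "s' = exec w Bfs_Step s"
    have "var s' = (var s)(''e'' := e, ''p'' := last_inc u e, ''x'' := x) \<and> arr s' = arr s"
      using ends_u
    proof
      assume "src e = u \<and> dst e = x \<and> u \<noteq> x \<and> arr s ''nt'' e = last_inc u e"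
      then show ?thesis using False c[OF e(1)] md
        by (auto simp: s'_def Bfs_Step_def u_def[symmetric] p te md2 ph w_pos)
    next
      assume "src e = x \<and> dst e = u \<and> u \<noteq> x \<and> arr s ''nh'' e = last_inc u e"
      then show ?thesis using False c[OF e(1)] md
        by (auto simp: s'_def Bfs_Step_def u_def[symmetric] p te md2 ph w_pos)
    qed
    then have "bfs_state D ph s' \<and> state_measure s' < state_measure s"
      using skip[OF False] m1 b c ph
      by (simp add: bfs_state_def base_def adjacency_def) (simp add: state_measure_def u_def)
    then show ?thesis by (simp add: s'_def)
  qed
qed

lemma Bfs_Step_pop:
  assumes D: "D \<subseteq> {..<m}" and S: "bfs_state D ph s" and p: "var s ''p'' = 0" and q: "var s ''qh'' < var s ''qt''"
  shows "bfs_state D ph (exec w Bfs_Step s) \<and> state_measure (exec w Bfs_Step s) < state_measure s"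
proof -
  have b: "base s" "adjacency s" and c: "\<And>e. e < m \<Longrightarrow> arr s ''contracted'' e \<noteq> 0 \<longleftrightarrow> e \<in> D" and ph: "var s ''ph'' = ph"
    and I: "bfs_inv D ph (arr s ''seen'') (arr s ''label'') (arr s ''queue'')
       0 (var s ''u'') (var s ''qh'') (var s ''qt'') (var s ''cur'') (var s ''n_out'')"
    using S p by (auto simp: bfs_state_def)
  have f: "arr s ''first'' v = last_inc v m" for v using b(2) by (simp add: adjacency_def)
  have md: "Suc (var s ''qh'') mod 2 ^ w = Suc (var s ''qh'')"
    using bfs_counts(1)[OF I] q by (intro mod_Suc_eq) simp
  define s' where "s' = exec w Bfs_Step s"
  define v where "v = arr s ''queue'' (var s ''qh'')"
  have "var s' = (var s)(''u'' := v, ''qh'' := Suc (var s ''qh''), ''p'' := last_inc v m)" "arr s' = arr s"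
    by (simp_all add: s'_def Bfs_Step_def p q md f v_def w_pos)
  then have "bfs_state D ph s' \<and> state_measure s' < state_measure s"
    using bfs_pop[OF D I q, folded v_def] measure_pop[OF I q, folded v_def] b c ph
    by (simp add: bfs_state_def base_def adjacency_def) (simp add: state_measure_def p)
  then show ?thesis by (simp add: s'_def)
qed

lemma Bfs_Step_root:
  assumes D: "D \<subseteq> {..<m}" and S: "bfs_state D ph s" and p: "var s ''p'' = 0"
    and q: "\<not> var s ''qh'' < var s ''qt''" and r: "var s ''cur'' < n"
  shows "bfs_state D ph (exec w Bfs_Step s) \<and> state_measure (exec w Bfs_Step s) < state_measure s"
proof -
  define v where "v = var s ''cur''"
  have b: "base s" "adjacency s" and c: "\<And>e. e < m \<Longrightarrow> arr s ''contracted'' e \<noteq> 0 \<longleftrightarrow> e \<in> D" and ph: "var s ''ph'' = ph"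
    and I0: "bfs_inv D ph (arr s ''seen'') (arr s ''label'') (arr s ''queue'')
       0 (var s ''u'') (var s ''qh'') (var s ''qt'') v (var s ''n_out'')"
    using S p by (auto simp: bfs_state_def v_def)
  have qh: "var s ''qh'' = var s ''qt''" using bfs_invD(1)[OF I0] q by simp
  note I = I0[unfolded qh]
  have vn: "v < n" using r by (simp add: v_def)
  define s' where "s' = exec w Bfs_Step s"
  show ?thesis
  proof (cases "arr s ''seen'' v < ph")
    case True
    have k: "var s ''n_out'' \<le> n" "var s ''qt'' < n" using bfs_counts[OF I] vn True by auto
    then have md: "Suc (var s ''n_out'') mod 2 ^ w = Suc (var s ''n_out'')" "Suc (var s ''qt'') mod 2 ^ w = Suc (var s ''qt'')"
      by (auto intro!: mod_Suc_eq)
    have "var s' = (var s)(''n_out'' := Suc (var s ''n_out''), ''qt'' := Suc (var s ''qt''))"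
      "arr s' = (arr s)(''seen'' := (arr s ''seen'')(v := ph), ''label'' := (arr s ''label'')(v := var s ''n_out''),
         ''queue'' := (arr s ''queue'')(var s ''qt'' := v))"
      using True by (simp_all add: s'_def Bfs_Step_def p qh md v_def ph w_pos)
    then have "bfs_state D ph s' \<and> state_measure s' < state_measure s"
      using bfs_new_root[OF D I vn True] measure_enqueue[OF k(2), of "arr s ''queue''" v "var s ''u''" v] b c ph
      by (simp add: bfs_state_def base_def adjacency_def p qh v_def[symmetric]) (simp add: state_measure_def p qh v_def[symmetric])
    then show ?thesis by (simp add: s'_def)
  next
    case False
    have md: "Suc v mod 2 ^ w = Suc v" using vn by (intro mod_Suc_eq) simp
    have "var s' = (var s)(''cur'' := Suc v)" "arr s' = arr s"
      using False by (simp_all add: s'_def Bfs_Step_def p qh md v_def[symmetric] ph w_pos)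
    then have "bfs_state D ph s' \<and> state_measure s' < state_measure s"
      using bfs_old_root[OF I vn] False measure_root[OF vn, of "arr s ''queue''" 0 "var s ''u''" "var s ''qt''" "var s ''qt''"] b c ph
      by (simp add: bfs_state_def base_def adjacency_def p qh) (simp add: state_measure_def p qh v_def[symmetric])
    then show ?thesis by (simp add: s'_def)
  qed
qed

definition components_labelled :: "nat set \<Rightarrow> state \<Rightarrow> bool" where
  "components_labelled D s \<longleftrightarrow>
     (\<forall>v<n. arr s ''label'' v < var s ''n_out'') \<and> (\<forall>j<var s ''n_out''. \<exists>v<n. arr s ''label'' v = j) \<and>
     (\<forall>v<n. \<forall>v'<n. arr s ''label'' v = arr s ''label'' v' \<longleftrightarrow> (v, v') \<in> conn_via G D)"

lemma ensures_Bfs: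
  assumes D: "D \<subseteq> {..<m}" and s: "base s" "adjacency s" and c: "\<forall>e<m. arr s ''contracted'' e \<noteq> 0 \<longleftrightarrow> e \<in> D"
    and seen: "\<forall>v. arr s ''seen'' v < ph" and ph: "ph < 2 ^ w"
  shows "ensures w (25 * (2 * m + 3 * n) + 14) (Bfs ph) s
    (\<lambda>s'. components_labelled D s' \<and> (\<forall>v. arr s' ''seen'' v \<le> ph))"
proof -
  let ?init = "Seq (Assign ''ph'' (Const ph)) (Seq (Assign ''p'' (Const 0)) (Seq (Assign ''qh'' (Const 0))
      (Seq (Assign ''qt'' (Const 0)) (Seq (Assign ''cur'' (Const 0)) (Assign ''n_out'' (Const 0))))))"
  let ?Q = "\<lambda>s. bfs_state D ph s \<and> state_measure s = 2 * m + 3 * n"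
  have init: "ensures w (cost ?init) ?init s ?Q"
  proof (rule ensures_exec)
    show "?Q (exec w ?init s)"
      using s c bfs_init[of "arr s ''seen''" ph D "arr s ''label''" "arr s ''queue''" "var s ''u''"] seen ph
      by (simp add: bfs_state_def state_measure_def measure_init base_def adjacency_def)
  qed simp
  have loop: "ensures w (25 * (2 * m + 3 * n) + 2) (While (Less (Var ''cur'') (Var ''n'')) Bfs_Step) s'
      (\<lambda>s'. components_labelled D s' \<and> (\<forall>v. arr s' ''seen'' v \<le> ph))" if Q: "?Q s'" for s'
  proof -
    have "ensures w ((22 + 3) * state_measure s' + 2) (While (Less (Var ''cur'') (Var ''n'')) Bfs_Step) s'
      (\<lambda>s'. bfs_state D ph s' \<and> \<not> bval w s' (Less (Var ''cur'') (Var ''n'')))"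
    proof (rule ensures_While[where M = state_measure])
      fix s assume S: "bfs_state D ph s" and "bval w s (Less (Var ''cur'') (Var ''n''))"
      then have r: "var s ''cur'' < n" by (simp add: bfs_state_def base_def)
      have step: "bfs_state D ph (exec w Bfs_Step s) \<and> state_measure (exec w Bfs_Step s) < state_measure s"
      proof (cases "var s ''p''")
        case 0
        then show ?thesis using Bfs_Step_pop[OF D S] Bfs_Step_root[OF D S _ _ r] by (cases "var s ''qh'' < var s ''qt''") auto
      next
        case (Suc e)
        then show ?thesis by (rule Bfs_Step_scan[OF D S])
      qed
      have lf: "loop_free Bfs_Step" and cost: "cost Bfs_Step \<le> 22" by (simp_all add: Bfs_Step_def)
      have "ensures w (cost Bfs_Step) Bfs_Step s (\<lambda>s'. bfs_state D ph s' \<and> state_measure s' < state_measure s)"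
        by (rule ensures_exec[OF lf]) (rule step)
      then show "ensures w 22 Bfs_Step s (\<lambda>s'. bfs_state D ph s' \<and> state_measure s' < state_measure s)"
        by (rule ensures_conseq[OF _ cost])
    qed (use Q in simp)
    then show ?thesis
    proof (rule ensures_conseq)
      fix s assume "bfs_state D ph s \<and> \<not> bval w s (Less (Var ''cur'') (Var ''n''))"
      then have I: "bfs_inv D ph (arr s ''seen'') (arr s ''label'') (arr s ''queue'')
        (var s ''p'') (var s ''u'') (var s ''qh'') (var s ''qt'') (var s ''cur'') (var s ''n_out'')" and "\<not> var s ''cur'' < n"
        by (auto simp: bfs_state_def base_def)
      then have "var s ''cur'' = n" using bfs_invD(2)[OF I] by simp
      from bfs_final[OF I[unfolded this]]
      show "components_labelled D s \<and> (\<forall>v. arr s ''seen'' v \<le> ph)" by (simp add: components_labelled_def)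
    qed (use Q in simp)
  qed
  from ensures_Seq[OF init loop] show ?thesis
    unfolding Bfs_def by (rule ensures_conseq) simp_all
qed

end

section \<open>The contraction algorithm\<close>

context input_graph
begin

lemma cnt_mono: "i \<le> j \<Longrightarrow> cnt v i \<le> cnt v j"
  by (rule lift_Suc_mono_le) auto

lemma cnt_less: "\<lbrakk>inc v e; e < k\<rbrakk> \<Longrightarrow> cnt v e < cnt v k"
  using cnt_mono[of "Suc e" k v] by simp

lemma degree_eq: "degree G v = cnt v m"
proof -
  have "{e \<in> edges G. v \<in> ends G e} = {e. e < m \<and> inc v e}"
    using edges ends by (auto simp: inc_def)
  then show ?thesis by (simp add: degree_def cnt_eq_card)
qed

text \<open>Ranks increase strictly along the edges at \<open>v\<close>, which gives injectivity;
  equal cardinalities give the rest.\<close>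

lemma bij_betw_cnt: "bij_betw (cnt v) {e. e < m \<and> inc v e} {..<cnt v m}"
  unfolding bij_betw_def
proof
  show inj: "inj_on (cnt v) {e. e < m \<and> inc v e}"
  proof (rule inj_onI)
    fix e e' assume "e \<in> {e. e < m \<and> inc v e}" "e' \<in> {e. e < m \<and> inc v e}" "cnt v e = cnt v e'"
    then show "e = e'" using cnt_less[of v e e'] cnt_less[of v e' e] by (cases e e' rule: linorder_cases) auto
  qed
  show "cnt v ` {e. e < m \<and> inc v e} = {..<cnt v m}"
  proof (rule card_subset_eq)
    show "cnt v ` {e. e < m \<and> inc v e} \<subseteq> {..<cnt v m}" using cnt_less by auto
    show "card (cnt v ` {e. e < m \<and> inc v e}) = card {..<cnt v m}"
      using card_image[OF inj] cnt_eq_card[of v m] by simp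
  qed simp
qed

text \<open>Inverse of the rank; it instantiates the parameter \<open>ch\<close> of
  \<open>out_choice\<close>.\<close>

definition nth_edge :: "nat \<Rightarrow> nat \<Rightarrow> nat" where
  "nth_edge v = inv_into {e. e < m \<and> inc v e} (cnt v)"

lemma nth_edge_iff:
  assumes "k < cnt v m"
  shows "e = nth_edge v k \<longleftrightarrow> e < m \<and> inc v e \<and> cnt v e = k"
proof -
  have k: "k \<in> cnt v ` {e. e < m \<and> inc v e}" using bij_betw_cnt assms by (simp add: bij_betw_def)
  show ?thesis
  proof
    assume "e = nth_edge v k"
    then show "e < m \<and> inc v e \<and> cnt v e = k"
      using inv_into_into[OF k] f_inv_into_f[OF k] by (simp add: nth_edge_def)
  next
    assume "e < m \<and> inc v e \<and> cnt v e = k"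
    then show "e = nth_edge v k"
      using inv_into_f_f[OF bij_betw_imp_inj_on[OF bij_betw_cnt], of e v] by (simp add: nth_edge_def)
  qed
qed

lemma encodes_output_contract:
  assumes L: "components_labelled D s" and S: "survivors_listed m s"
  shows "encodes_output (contract G D) s" "var s ''n_out'' = comps G D"
    "var s ''m_out'' = card (edges (contract G D))"
proof -
  let ?R = "conn_via G D"
  define lab where "lab = arr s ''label''"
  \<comment> \<open>A node of the contraction is a set of vertices with a common label, so any
    representative yields its number.\<close>
  define f where "f = (\<lambda>X. lab (SOME v. v \<in> X))"
  have lab: "\<And>v. v < n \<Longrightarrow> lab v < var s ''n_out''" "\<And>j. j < var s ''n_out'' \<Longrightarrow> \<exists>v<n. lab v = j"
    "\<And>v v'. \<lbrakk>v < n; v' < n\<rbrakk> \<Longrightarrow> lab v = lab v' \<longleftrightarrow> (v, v') \<in> ?R"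
    using L by (auto simp: components_labelled_def lab_def)
  have f: "f (?R `` {v}) = lab v" if "v < n" for v
  proof -
    have "v \<in> ?R `` {v}" using that verts by (simp add: conn_via_refl)
    then have "(SOME v'. v' \<in> ?R `` {v}) \<in> ?R `` {v}" by (rule someI)
    moreover have "lab v' = lab v" if "v' \<in> ?R `` {v}" for v'
      using that \<open>v < n\<close> lab(3)[of v v'] verts by (auto simp: conn_via_iff)
    ultimately show ?thesis by (simp add: f_def)
  qed
  have V: "verts G // ?R = (\<lambda>v. ?R `` {v}) ` {..<n}" unfolding verts by (auto simp: quotient_def)
  have bij: "bij_betw f (verts (contract G D)) {..<var s ''n_out''}"
    unfolding bij_betw_def
  proof
    show "inj_on f (verts (contract G D))"
    proof (rule inj_onI)
      fix X Y assume "X \<in> verts (contract G D)" "Y \<in> verts (contract G D)" "f X = f Y"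
      then obtain v v' where v: "v < n" "v' < n" "X = ?R `` {v}" "Y = ?R `` {v'}" "lab v = lab v'"
        using f by (auto simp: V)
      then have "(v, v') \<in> ?R" using lab(3) by simp
      then show "X = Y" unfolding v(3,4) by (rule equiv_class_eq[OF equiv_conn_via])
    qed
    show "f ` verts (contract G D) = {..<var s ''n_out''}"
    proof
      show "f ` verts (contract G D) \<subseteq> {..<var s ''n_out''}" using f lab(1) by (auto simp: V)
      show "{..<var s ''n_out''} \<subseteq> f ` verts (contract G D)"
      proof
        fix j assume "j \<in> {..<var s ''n_out''}"
        then obtain v where v: "v < n" "lab v = j" using lab(2)[of j] by auto
        have "f (?R `` {v}) \<in> f ` verts (contract G D)" using v(1) by (auto simp: V)
        then show "j \<in> f ` verts (contract G D)" using f[OF v(1)] v(2) by simp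
      qed
    qed
  qed
  have E: "edges (contract G D) = {e. e < m \<and> lab (src e) \<noteq> lab (dst e)}"
  proof (rule set_eqI)
    fix e
    show "e \<in> edges (contract G D) \<longleftrightarrow> e \<in> {e. e < m \<and> lab (src e) \<noteq> lab (dst e)}"
    proof (cases "e < m")
      case True
      then show ?thesis
        using edges_contract_iff[OF ends[OF True], of D] src_dst[OF True] lab(3)[of "src e" "dst e"] verts edges by simp
    next
      case False
      then show ?thesis using edges_contract_subset[of G D] edges by auto
    qed
  qed
  have ids: "bij_betw (arr s ''id_out'') {..<var s ''m_out''} (edges (contract G D))"
    using S by (simp add: survivors_listed_def E lab_def)
  show "encodes_output (contract G D) s"
    unfolding encodes_output_def
  proof (rule exI[of _ f], intro conjI bij ids ballI allI impI)
    fix X v assume X: "X \<in> verts (contract G D)" "v \<in> X"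
    then obtain v' where v': "v' < n" "X = ?R `` {v'}" by (auto simp: V)
    then have "(v', v) \<in> ?R" using X(2) by simp
    then show "arr s ''label'' v = f X"
      using f[OF v'(1)] v' lab(3)[of v' v] verts by (auto simp: lab_def conn_via_iff)
  next
    fix j assume j: "j < var s ''m_out''"
    let ?e = "arr s ''id_out'' j"
    have e: "?e < m" using bij_betwE[OF ids] j E by auto
    have t: "arr s ''tail_out'' j = lab (src ?e)" "arr s ''head_out'' j = lab (dst ?e)"
      using S j by (auto simp: survivors_listed_def lab_def)
    show "f ` ends (contract G D) ?e = {arr s ''tail_out'' j, arr s ''head_out'' j}"
      using f src_dst[OF e] by (simp add: ends[OF e] t)
  qed
  show "var s ''n_out'' = comps G D"
    using bij_betw_same_card[OF bij] by (simp add: comps_def)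
  show "var s ''m_out'' = card (edges (contract G D))"
    using bij_betw_same_card[OF ids] by simp
qed

end

text \<open>In a simple graph the edges at \<open>v\<close> lead to distinct vertices of its
  component, so every component has at least \<open>\<delta>\<close> vertices.\<close>

lemma comps_all_edges:
  assumes G: "simple_graph G" and deg: "\<And>v. v \<in> verts G \<Longrightarrow> \<delta> \<le> degree G v" and \<delta>: "1 \<le> \<delta>"
  shows "comps G (edges G) * \<delta> \<le> card (verts G)" "edges (contract G (edges G)) = {}"
proof -
  let ?R = "conn_via G (edges G)"
  have fin: "finite (verts G)" "finite (edges G)" and inj: "inj_on (ends G) (edges G)"
    using G by (auto simp: simple_graph_def)
  have size: "\<delta> \<le> card (?R `` {v})" if v: "v \<in> verts G" for v
  proof -
    let ?I = "{e \<in> edges G. v \<in> ends G e}"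
    have "degree G v = card (ends G ` ?I)"
      unfolding degree_def by (rule card_image[symmetric], rule inj_on_subset[OF inj]) auto
    also have "\<dots> \<le> card ((\<lambda>x. {v, x}) ` (?R `` {v}))"
    proof (intro card_mono finite_imageI subsetI)
      show "finite (?R `` {v})" using fin(1) by (rule rev_finite_subset) (auto simp: conn_via_iff)
      fix X assume "X \<in> ends G ` ?I"
      then obtain e where e: "e \<in> edges G" "v \<in> ends G e" "X = ends G e" by auto
      obtain x where x: "ends G e = {v, x}" "x \<in> verts G" by (rule simple_graph_ends_at[OF G e(1,2)])
      then have "(v, x) \<in> ?R" using conn_via_edge[OF e(1) x(1) v x(2)] by simp
      then show "X \<in> (\<lambda>x. {v, x}) ` (?R `` {v})" using e x by auto
    qed
    also have "\<dots> \<le> card (?R `` {v})"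
      by (rule card_image_le, rule rev_finite_subset[OF fin(1)]) (auto simp: conn_via_iff)
    finally show ?thesis using deg[OF v] by simp
  qed
  have "real (comps G (edges G)) = (\<Sum>v\<in>verts G. 1 / real (card (?R `` {v})))"
    unfolding comps_def by (rule card_quotient_eq_sum[OF fin(1) equiv_conn_via])
  also have "\<dots> \<le> (\<Sum>v\<in>verts G. 1 / real \<delta>)"
    using size \<delta> by (intro sum_mono frac_le) auto
  finally have "real (comps G (edges G)) * real \<delta> \<le> real (card (verts G))" using \<delta> by (simp add: field_simps)
  then show "comps G (edges G) * \<delta> \<le> card (verts G)" by (simp only: of_nat_mult[symmetric] of_nat_le_iff)
  show "edges (contract G (edges G)) = {}"
  proof (rule ccontr)
    assume "edges (contract G (edges G)) \<noteq> {}"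
    then obtain e where e: "e \<in> edges (contract G (edges G))" by auto
    then have "e \<in> edges G" using edges_contract_subset[of G "edges G"] by blast
    then obtain x y where xy: "ends G e = {x, y}" "x \<in> verts G" "y \<in> verts G" by (rule simple_graph_ends[OF G])
    then show False using edges_contract_iff[OF xy, of "edges G"] conn_via_edge[OF \<open>e \<in> edges G\<close> xy] e by simp
  qed
qed

section \<open>Assembly of the program\<close>

definition Finish :: "nat \<Rightarrow> com" where
  "Finish ph = Seq (Bfs ph) Output"

text \<open>The test compares products to avoid the quotient \<open>n / \<delta>\<close>. They fit
  into a word because \<open>n_out * d\<close> is at most \<open>n * m\<close>.\<close>

definition Small :: "nat \<Rightarrow> nat \<Rightarrow> bexp" where
  "Small c1 c2 = Conj (Neg (Less (Mult (Const c1) (Var ''n'')) (Mult (Var ''n_out'') (Var ''d''))))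
     (Neg (Less (Mult (Const c2) (Var ''n'')) (Var ''m_out'')))"

definition Post :: "nat \<Rightarrow> nat \<Rightarrow> com" where
  "Post c1 c2 = Seq Mark (Seq (Finish 1) (Cond (Small c1 c2) Skip (Seq Mark_All (Finish 2))))"

definition Prog :: "nat \<Rightarrow> nat \<Rightarrow> com" where
  "Prog c1 c2 = Seq (Seq Build Min_Deg)
    (Seq (Sample ''j'' ''x'' ''r'' (Add (Var ''n'') (Var ''n'')) (Load ''deg'' (Div (Var ''j'') (Const 2))))
    (Seq (Sample ''j'' ''x'' ''coin'' (Var ''m'') (Add (Var ''d'') (Const 1)))
         (Post c1 c2)))"

context input_graph
begin

lemma base_frame: "\<lbrakk>base s; same_outside X A s s'; {''n'', ''m''} \<inter> X = {}; {''tail'', ''head''} \<inter> A = {}\<rbrakk> \<Longrightarrow> base s'"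
  by (auto simp: base_def same_outside_def)

lemma adjacency_frame:
  "\<lbrakk>adjacency s; same_outside X A s s'; {''deg'', ''first'', ''rt'', ''rh'', ''nt'', ''nh''} \<inter> A = {}\<rbrakk> \<Longrightarrow> adjacency s'"
  by (auto simp: adjacency_def same_outside_def)

lemma frame_sets:
  "mod_vars (Bfs ph) = {''ph'', ''p'', ''qh'', ''qt'', ''cur'', ''n_out'', ''e'', ''x'', ''u''}"
  "mod_arrs (Bfs ph) = {''seen'', ''label'', ''queue''}"
  "mod_vars Output = {''m_out'', ''e''}" "mod_arrs Output = {''id_out'', ''tail_out'', ''head_out''}"
  "mod_vars Mark = {''e''}" "mod_arrs Mark = {''contracted''}"
  "mod_vars Mark_All = {''e''}" "mod_arrs Mark_All = {''contracted''}"
  "mod_vars Build = {''e''}" "mod_arrs Build = {''deg'', ''first'', ''rt'', ''rh'', ''nt'', ''nh''}"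
  "mod_vars Min_Deg = {''d'', ''v''}" "mod_arrs Min_Deg = {}"
  by (auto simp: Bfs_def Bfs_Step_def Output_def Mark_def Mark_All_def Build_def Min_Deg_def)

lemma ensures_Finish:
  assumes D: "D \<subseteq> {..<m}" and s: "base s" "adjacency s" and c: "\<forall>e<m. arr s ''contracted'' e \<noteq> 0 \<longleftrightarrow> e \<in> D"
    and seen: "\<forall>v. arr s ''seen'' v < ph" and ph: "ph < 2 ^ w"
  shows "ensures w (63 * m + 75 * n + 21) (Finish ph) s
    (\<lambda>s'. base s' \<and> adjacency s' \<and> contracted_edges G s' = D \<and> var s' ''d'' = var s ''d'' \<and>
       components_labelled D s' \<and> survivors_listed m s' \<and> (\<forall>v. arr s' ''seen'' v \<le> ph))"
proof -
  have "ensures w ((25 * (2 * m + 3 * n) + 14) + (13 * m + 6) + 1) (Finish ph) s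
    (\<lambda>s'. base s' \<and> adjacency s' \<and> contracted_edges G s' = D \<and> var s' ''d'' = var s ''d'' \<and>
       components_labelled D s' \<and> survivors_listed m s' \<and> (\<forall>v. arr s' ''seen'' v \<le> ph))"
    unfolding Finish_def
  proof (rule ensures_Seq[OF ensures_frame[OF ensures_Bfs[OF assms]]], unfold frame_sets)
    fix s1 assume s1: "(components_labelled D s1 \<and> (\<forall>v. arr s1 ''seen'' v \<le> ph)) \<and>
      same_outside {''ph'', ''p'', ''qh'', ''qt'', ''cur'', ''n_out'', ''e'', ''x'', ''u''} {''seen'', ''label'', ''queue''} s s1"
    have b1: "base s1" by (rule base_frame[OF s(1) conjunct2[OF s1]]) simp_all
    have a1: "adjacency s1" by (rule adjacency_frame[OF s(2) conjunct2[OF s1]]) simp_all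
    have c1: "arr s1 ''contracted'' = arr s ''contracted''" "var s1 ''d'' = var s ''d''"
      using s1 by (auto simp: same_outside_def)
    show "ensures w (13 * m + 6) Output s1 (\<lambda>s'. base s' \<and> adjacency s' \<and> contracted_edges G s' = D \<and> var s' ''d'' = var s ''d'' \<and>
       components_labelled D s' \<and> survivors_listed m s' \<and> (\<forall>v. arr s' ''seen'' v \<le> ph))"
    proof (rule ensures_conseq[OF ensures_frame[OF ensures_Output[OF b1]]], rule order_refl, unfold frame_sets)
      fix s2 assume s2: "survivors_listed m s2 \<and> same_outside {''m_out'', ''e''} {''id_out'', ''tail_out'', ''head_out''} s1 s2"
      have same: "arr s2 ''contracted'' = arr s ''contracted''" "var s2 ''d'' = var s ''d''" "arr s2 ''label'' = arr s1 ''label''"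
        "arr s2 ''seen'' = arr s1 ''seen''" "var s2 ''n_out'' = var s1 ''n_out''"
        using s2 c1 by (auto simp: same_outside_def)
      have "contracted_edges G s2 = D"
        using c D edges by (auto simp: contracted_edges_def same)
      moreover have "components_labelled D s2" using s1 by (simp add: components_labelled_def same)
      moreover have "base s2" by (rule base_frame[OF b1 conjunct2[OF s2]]) simp_all
      moreover have "adjacency s2" by (rule adjacency_frame[OF a1 conjunct2[OF s2]]) simp_all
      ultimately show "base s2 \<and> adjacency s2 \<and> contracted_edges G s2 = D \<and> var s2 ''d'' = var s ''d'' \<and>
       components_labelled D s2 \<and> survivors_listed m s2 \<and> (\<forall>v. arr s2 ''seen'' v \<le> ph)"
        using s1 s2 by (simp add: same)
    qed
  qed
  then show ?thesis by (rule ensures_conseq) simp_all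
qed

definition small :: "nat \<Rightarrow> nat \<Rightarrow> nat set \<Rightarrow> bool" where
  "small c1 c2 D \<longleftrightarrow> comps G D * min_degree G \<le> c1 * n \<and> card (edges (contract G D)) \<le> c2 * n"

definition post_ok :: "nat \<Rightarrow> nat \<Rightarrow> nat set \<Rightarrow> state \<Rightarrow> bool" where
  "post_ok c1 c2 D s \<longleftrightarrow> encodes_output (contract G (contracted_edges G s)) s \<and>
     contracted_edges G s = (if small c1 c2 D then D else {..<m})"

lemma ensures_Post:
  assumes s: "base s" "adjacency s" and c: "arr s ''contracted'' = (\<lambda>_. 0)" and seen: "arr s ''seen'' = (\<lambda>_. 0)"
    and d: "var s ''d'' = min_degree G" "min_degree G \<le> m" and cs: "c1 * n < 2 ^ w" "c2 * n < 2 ^ w" "n * m < 2 ^ w" and n: "0 < n"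
  shows "ensures w (139 * m + 150 * n + 60) (Post c1 c2) s (post_ok c1 c2 (choice_edges (arr s ''r'') (arr s ''coin'')))"
proof -
  define D where "D = choice_edges (arr s ''r'') (arr s ''coin'')"
  have D: "D \<subseteq> {..<m}" by (auto simp: D_def choice_edges_def)
  \<comment> \<open>The constants in the program text are reduced modulo \<open>2 ^ w\<close> as
    well; by \<open>0 < n\<close> they are bounded by the products.\<close>
  have c12: "c1 < 2 ^ w" "c2 < 2 ^ w"
    using cs(1,2) n by (auto intro: le_less_trans[rotated])
  have "ensures w ((7 * m + 4) + ((63 * m + 75 * n + 21) + (((6 * m + 4) + (63 * m + 75 * n + 21) + 1) + 1) + 1) + 1)
      (Post c1 c2) s (post_ok c1 c2 D)"
    unfolding Post_def
  proof (rule ensures_Seq[OF ensures_frame[OF ensures_Mark[OF s c]]], unfold frame_sets D_def[symmetric])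
    fix s1 assume s1: "(\<forall>e<m. (arr s1 ''contracted'' e \<noteq> 0) = (e \<in> D)) \<and> same_outside {''e''} {''contracted''} s s1"
    have b1: "base s1" by (rule base_frame[OF s(1) conjunct2[OF s1]]) simp_all
    have a1: "adjacency s1" by (rule adjacency_frame[OF s(2) conjunct2[OF s1]]) simp_all
    have e1: "\<forall>v. arr s1 ''seen'' v < 1" "var s1 ''d'' = min_degree G"
      using s1 seen d by (auto simp: same_outside_def)
    show "ensures w ((63 * m + 75 * n + 21) + (((6 * m + 4) + (63 * m + 75 * n + 21) + 1) + 1) + 1)
      (Seq (Finish 1) (Cond (Small c1 c2) Skip (Seq Mark_All (Finish 2)))) s1 (post_ok c1 c2 D)"
    proof (rule ensures_Seq[OF ensures_Finish[OF D b1 a1 conjunct1[OF s1] e1(1) big_facts(3)]])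
      fix s2 assume s2: "base s2 \<and> adjacency s2 \<and> contracted_edges G s2 = D \<and> var s2 ''d'' = var s1 ''d'' \<and>
       components_labelled D s2 \<and> survivors_listed m s2 \<and> (\<forall>v. arr s2 ''seen'' v \<le> 1)"
      then have L: "components_labelled D s2" "survivors_listed m s2" by auto
      note out = encodes_output_contract[OF L]
      \<comment> \<open>Excludes overflow in the product that \<open>Small\<close> tests.\<close>
      have "comps G D \<le> n" 
        unfolding comps_def verts quotient_def using card_image_le[of "{..<n}" "\<lambda>v. conn_via G D `` {v}"]
        by (simp add: UNION_singleton_eq_range)
      then have "comps G D * min_degree G \<le> n * m" using d(2) by (rule mult_le_mono)
      then have prod: "comps G D * min_degree G < 2 ^ w" using cs(3) by simp
      have small: "bval w s2 (Small c1 c2) \<longleftrightarrow> small c1 c2 D"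
        using s2 cs prod out c12 e1(2) by (auto simp: Small_def small_def base_def not_less)
      have "ensures w ((6 * m + 4) + (63 * m + 75 * n + 21) + 1) (if bval w s2 (Small c1 c2) then Skip else Seq Mark_All (Finish 2)) s2 (post_ok c1 c2 D)"
      proof (cases "small c1 c2 D")
        case True
        have "ensures w ((6 * m + 4) + (63 * m + 75 * n + 21) + 1) Skip s2 (post_ok c1 c2 D)"
          using runs_Skip[of w "(6 * m + 4) + (63 * m + 75 * n + 21) + 1" s2] s2 out(1) True unfolding ensures_def post_ok_def by auto
        then show ?thesis using True small by simp
      next
        case False
        have b2: "base s2" "adjacency s2" using s2 by auto
        have "ensures w ((6 * m + 4) + (63 * m + 75 * n + 21) + 1) (Seq Mark_All (Finish 2)) s2 (post_ok c1 c2 D)"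
        proof (rule ensures_Seq[OF ensures_frame[OF ensures_Mark_All[OF b2(1)]]], unfold frame_sets)
          fix s3 assume s3: "(\<forall>e<m. arr s3 ''contracted'' e \<noteq> 0) \<and> same_outside {''e''} {''contracted''} s2 s3"
          have b3: "base s3" by (rule base_frame[OF b2(1) conjunct2[OF s3]]) simp_all
          have a3: "adjacency s3" by (rule adjacency_frame[OF b2(2) conjunct2[OF s3]]) simp_all
          \<comment> \<open>The first search left marks of at most 1, so the mark 2 of the second
            search is above all of them.\<close>
          have e3: "\<forall>v. arr s3 ''seen'' v < 2" using s2 s3 by (auto simp: same_outside_def less_Suc_eq_le numeral_2_eq_2)
          have c3: "\<forall>e<m. arr s3 ''contracted'' e \<noteq> 0 \<longleftrightarrow> e \<in> {..<m}" using s3 by auto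
          show "ensures w (63 * m + 75 * n + 21) (Finish 2) s3 (post_ok c1 c2 D)"
          proof (rule ensures_conseq[OF ensures_Finish[OF order_refl b3 a3 c3 e3 big_facts(4)] order_refl])
            fix s4 assume s4: "base s4 \<and> adjacency s4 \<and> contracted_edges G s4 = {..<m} \<and> var s4 ''d'' = var s3 ''d'' \<and>
              components_labelled {..<m} s4 \<and> survivors_listed m s4 \<and> (\<forall>v. arr s4 ''seen'' v \<le> 2)"
            then have L: "components_labelled {..<m} s4" "survivors_listed m s4" by auto
            show "post_ok c1 c2 D s4" using encodes_output_contract(1)[OF L] s4 False by (simp add: post_ok_def)
          qed
        qed
        then show ?thesis using False small by simp
      qed
      then show "ensures w (((6 * m + 4) + (63 * m + 75 * n + 21) + 1) + 1) (Cond (Small c1 c2) Skip (Seq Mark_All (Finish 2))) s2 (post_ok c1 c2 D)"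
        unfolding ensures_def by (elim exE conjE, intro exI conjI) (rule runs_Cond)
    qed
  qed
  then show ?thesis unfolding D_def by (rule ensures_conseq) simp_all
qed

end

section \<open>Law of the final state\<close>

context input_graph
begin

definition run_prefix :: "state \<Rightarrow> bool" where
  "run_prefix s \<longleftrightarrow> base s \<and> adjacency s \<and> var s ''d'' = min_degree G \<and>
     arr s ''contracted'' = (\<lambda>_. 0) \<and> arr s ''seen'' = (\<lambda>_. 0)"

abbreviation rank_pmf :: "(nat \<Rightarrow> nat) pmf" where
  "rank_pmf \<equiv> Pi_pmf {..<2 * n} 0 (\<lambda>j. pmf_of_set {..<max (Suc 0) (cnt (j div 2) m)})"

abbreviation coins_pmf :: "(nat \<Rightarrow> nat) pmf" where
  "coins_pmf \<equiv> Pi_pmf {..<m} 0 (\<lambda>_. pmf_of_set {..<max (Suc 0) (Suc (min_degree G))})"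

lemma min_degree_eq: "min_degree G = Min ((\<lambda>v. cnt v m) ` {..<n})"
proof -
  have "degree G = (\<lambda>v. cnt v m)" by (rule ext) (rule degree_eq)
  then show ?thesis by (simp only: min_degree_def verts)
qed

lemma ensures_prefix:
  assumes s: "base s" and z: "\<And>a. a \<notin> {''tail'', ''head''} \<Longrightarrow> arr s a = (\<lambda>_. 0)" and n: "0 < n"
  shows "ensures w (20 * m + 8 * n + 11) (Seq Build Min_Deg) s
    (\<lambda>s'. run_prefix s' \<and> arr s' ''r'' = (\<lambda>_. 0) \<and> arr s' ''coin'' = (\<lambda>_. 0) \<and> var s' ''x'' = var s ''x'')"
proof -
  have "ensures w ((20 * m + 4) + (8 * n + 6) + 1) (Seq Build Min_Deg) s
    (\<lambda>s'. run_prefix s' \<and> arr s' ''r'' = (\<lambda>_. 0) \<and> arr s' ''coin'' = (\<lambda>_. 0) \<and> var s' ''x'' = var s ''x'')"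
  proof (rule ensures_Seq[OF ensures_frame[OF ensures_Build[OF s]]], unfold frame_sets)
    show "arr s ''deg'' = (\<lambda>_. 0)" "arr s ''first'' = (\<lambda>_. 0)" by (simp_all add: z)
  next
    fix s1 assume s1: "adjacency s1 \<and> same_outside {''e''} {''deg'', ''first'', ''rt'', ''rh'', ''nt'', ''nh''} s s1"
    have b1: "base s1" by (rule base_frame[OF s conjunct2[OF s1]]) simp_all
    have deg: "\<forall>v. arr s1 ''deg'' v = cnt v m" using s1 by (simp add: adjacency_def)
    show "ensures w (8 * n + 6) Min_Deg s1
      (\<lambda>s'. run_prefix s' \<and> arr s' ''r'' = (\<lambda>_. 0) \<and> arr s' ''coin'' = (\<lambda>_. 0) \<and> var s' ''x'' = var s ''x'')"
    proof (rule ensures_conseq[OF ensures_frame[OF ensures_Min_Deg[OF b1 n deg]] order_refl], unfold frame_sets min_degree_eq[symmetric])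
      fix s2 assume s2: "var s2 ''d'' = min_degree G \<and> same_outside {''d'', ''v''} {} s1 s2"
      have "base s2" by (rule base_frame[OF b1 conjunct2[OF s2]]) simp_all
      moreover have "adjacency s2" by (rule adjacency_frame[OF conjunct1[OF s1] conjunct2[OF s2]]) simp_all
      moreover have "arr s2 ''contracted'' = arr s ''contracted''" "arr s2 ''seen'' = arr s ''seen''"
        "arr s2 ''r'' = arr s ''r''" "arr s2 ''coin'' = arr s ''coin''" "var s2 ''x'' = var s ''x''"
        using s1 s2 by (simp_all add: same_outside_def)
      ultimately show "run_prefix s2 \<and> arr s2 ''r'' = (\<lambda>_. 0) \<and> arr s2 ''coin'' = (\<lambda>_. 0) \<and> var s2 ''x'' = var s ''x''"
        using s2 by (simp add: run_prefix_def z)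
    qed
  qed
  then show ?thesis by (rule ensures_conseq) simp_all
qed

text \<open>All randomness sits in two arrays that are drawn before \<open>Post\<close> starts.
  \<open>Post\<close> is deterministic, so the final state is a function \<open>fin\<close> of these
  arrays, and no further analysis of runs is needed.\<close>

lemma runs_Prog:
  assumes s: "base s" and z: "\<And>a. a \<notin> {''tail'', ''head''} \<Longrightarrow> arr s a = (\<lambda>_. 0)" "var s ''x'' = 0" and n: "0 < n"
    and d: "min_degree G \<le> m" and cs: "c1 * n < 2 ^ w" "c2 * n < 2 ^ w" "n * m < 2 ^ w"
  shows "\<exists>fin. runs w (170 * m + 180 * n + 82) (Prog c1 c2) s (map_pmf fin (pair_pmf rank_pmf coins_pmf)) \<and>
    (\<forall>r c. post_ok c1 c2 (choice_edges r c) (fin (r, c)))"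
proof -
  obtain s1 where s1: "runs w (20 * m + 8 * n + 11) (Seq Build Min_Deg) s (return_pmf s1)" "run_prefix s1"
    "arr s1 ''r'' = (\<lambda>_. 0)" "arr s1 ''coin'' = (\<lambda>_. 0)" "var s1 ''x'' = 0"
    using ensures_prefix[OF s z(1) n] z(2) by (auto simp: ensures_def)
  have P1: "base s1" "adjacency s1" "var s1 ''d'' = min_degree G" "arr s1 ''contracted'' = (\<lambda>_. 0)" "arr s1 ''seen'' = (\<lambda>_. 0)"
    using s1(2) by (auto simp: run_prefix_def)
  define st where "st = (\<lambda>r. s1\<lparr>var := (var s1)(''j'' := 2 * n, ''x'' := 0), arr := (arr s1)(''r'' := r)\<rparr>)"
  define st2 where "st2 = (\<lambda>(s :: state) c. s\<lparr>var := (var s)(''j'' := m, ''x'' := 0), arr := (arr s)(''coin'' := c)\<rparr>)"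
  have S1: "runs w (11 * (2 * n) + 4) (Sample ''j'' ''x'' ''r'' (Add (Var ''n'') (Var ''n'')) (Load ''deg'' (Div (Var ''j'') (Const 2))))
      s1 (map_pmf st rank_pmf)"
    unfolding st_def
  proof (rule runs_Sample)
    show "2 * n < 2 ^ w" by (rule le_less_trans[OF _ big]) simp
    fix k f
    show "aval w (s1\<lparr>var := (var s1)(''j'' := k, ''x'' := 0), arr := (arr s1)(''r'' := f)\<rparr>) (Add (Var ''n'') (Var ''n'')) = 2 * n"
      using P1(1) big_facts(5)[of "2 * n"] by (simp add: base_def mult_2)
    show "aval w (s1\<lparr>var := (var s1)(''j'' := k, ''x'' := 0), arr := (arr s1)(''r'' := f)\<rparr>) (Load ''deg'' (Div (Var ''j'') (Const 2))) = cnt (k div 2) m"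
      using P1(2) big_facts(8) by (simp add: adjacency_def)
  qed (use s1 in simp_all)
  have S2: "runs w (11 * m + 4) (Sample ''j'' ''x'' ''coin'' (Var ''m'') (Add (Var ''d'') (Const 1))) (st r) (map_pmf (st2 (st r)) coins_pmf)" for r
    unfolding st2_def
  proof (rule runs_Sample)
    show "m < 2 ^ w" by (rule big_facts(1))
    fix k f
    show "aval w ((st r)\<lparr>var := (var (st r))(''j'' := k, ''x'' := 0), arr := (arr (st r))(''coin'' := f)\<rparr>) (Var ''m'') = m"
      using P1(1) by (simp add: base_def st_def)
    have "Suc (min_degree G) mod 2 ^ w = Suc (min_degree G)" using d by (intro mod_Suc_eq) simp
    then show "aval w ((st r)\<lparr>var := (var (st r))(''j'' := k, ''x'' := 0), arr := (arr (st r))(''coin'' := f)\<rparr>) (Add (Var ''d'') (Const 1)) = Suc (min_degree G)"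
      using P1(3) w_pos by (simp add: st_def)
  qed (use s1 in \<open>simp_all add: st_def\<close>)
  have "ensures w (139 * m + 150 * n + 60) (Post c1 c2) (st2 (st r) c) (post_ok c1 c2 (choice_edges r c))" for r c
  proof -
    have "base (st2 (st r) c)" "adjacency (st2 (st r) c)" using P1 by (simp_all add: base_def adjacency_def st_def st2_def)
    moreover have "arr (st2 (st r) c) ''r'' = r" "arr (st2 (st r) c) ''coin'' = c"
      "arr (st2 (st r) c) ''contracted'' = (\<lambda>_. 0)" "arr (st2 (st r) c) ''seen'' = (\<lambda>_. 0)" "var (st2 (st r) c) ''d'' = min_degree G"
      using P1 by (simp_all add: st_def st2_def)
    ultimately show ?thesis using ensures_Post[of "st2 (st r) c" c1 c2] d cs n by simp
  qed
  then have "\<forall>x. \<exists>s'. runs w (139 * m + 150 * n + 60) (Post c1 c2) (st2 (st (fst x)) (snd x)) (return_pmf s') \<and>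
      post_ok c1 c2 (choice_edges (fst x) (snd x)) s'"
    unfolding ensures_def by blast
  then obtain fin where fin: "\<And>x. runs w (139 * m + 150 * n + 60) (Post c1 c2) (st2 (st (fst x)) (snd x)) (return_pmf (fin x))"
      "\<And>x. post_ok c1 c2 (choice_edges (fst x) (snd x)) (fin x)"
    by metis
  have inv: "arr (st2 (st r) c) ''r'' = r" "arr (st2 (st r) c) ''coin'' = c" "arr (st r) ''r'' = r" for r c
    by (simp_all add: st_def st2_def)
  \<comment> \<open>The drawn arrays are read back from the state, because the law of
    \<open>Post\<close> has to be given as a function of its initial state.\<close>
  let ?g = "\<lambda>s'. return_pmf (fin (arr s' ''r'', arr s' ''coin''))"
  have "runs w ((20 * m + 8 * n + 11) + ((11 * (2 * n) + 4) + ((11 * m + 4) + (139 * m + 150 * n + 60) + 1) + 1) + 1) (Prog c1 c2) s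
    (bind_pmf (return_pmf s1) (\<lambda>_. bind_pmf (map_pmf st rank_pmf) (\<lambda>s2. bind_pmf (map_pmf (st2 s2) coins_pmf) ?g)))"
    unfolding Prog_def
  proof (rule runs_Seq[OF s1(1)])
    fix s' assume "s' \<in> set_pmf (return_pmf s1)"
    then have "s' = s1" by simp
    show "runs w ((11 * (2 * n) + 4) + ((11 * m + 4) + (139 * m + 150 * n + 60) + 1) + 1)
     (Seq (Sample ''j'' ''x'' ''r'' (Add (Var ''n'') (Var ''n'')) (Load ''deg'' (Div (Var ''j'') (Const 2))))
       (Seq (Sample ''j'' ''x'' ''coin'' (Var ''m'') (Add (Var ''d'') (Const 1))) (Post c1 c2))) s'
     (bind_pmf (map_pmf st rank_pmf) (\<lambda>s2. bind_pmf (map_pmf (st2 s2) coins_pmf) ?g))"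
      unfolding \<open>s' = s1\<close>
    proof (rule runs_Seq[OF S1])
      fix s2 assume "s2 \<in> set_pmf (map_pmf st rank_pmf)"
      then obtain r where r: "s2 = st r" by auto
      show "runs w ((11 * m + 4) + (139 * m + 150 * n + 60) + 1)
         (Seq (Sample ''j'' ''x'' ''coin'' (Var ''m'') (Add (Var ''d'') (Const 1))) (Post c1 c2)) s2
         (bind_pmf (map_pmf (st2 s2) coins_pmf) ?g)"
        unfolding r
      proof (rule runs_Seq[OF S2])
        fix s3 assume "s3 \<in> set_pmf (map_pmf (st2 (st r)) coins_pmf)"
        then obtain c where c: "s3 = st2 (st r) c" by auto
        show "runs w (139 * m + 150 * n + 60) (Post c1 c2) s3 (?g s3)"
          unfolding c inv using fin(1)[of "(r, c)"] by simp
      qed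
    qed
  qed
  moreover have "bind_pmf (return_pmf s1) (\<lambda>_. bind_pmf (map_pmf st rank_pmf) (\<lambda>s2. bind_pmf (map_pmf (st2 s2) coins_pmf) ?g))
    = map_pmf fin (pair_pmf rank_pmf coins_pmf)"
    by (simp add: bind_return_pmf bind_map_pmf inv) (simp add: pair_pmf_def map_pmf_def bind_assoc_pmf bind_return_pmf)
  ultimately have "runs w ((20 * m + 8 * n + 11) + ((11 * (2 * n) + 4) + ((11 * m + 4) + (139 * m + 150 * n + 60) + 1) + 1) + 1) (Prog c1 c2) s
    (map_pmf fin (pair_pmf rank_pmf coins_pmf))" by (simp only:)
  then have "runs w (170 * m + 180 * n + 82) (Prog c1 c2) s (map_pmf fin (pair_pmf rank_pmf coins_pmf))"
    by (rule runs_mono) simp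
  moreover have "\<forall>r c. post_ok c1 c2 (choice_edges r c) (fin (r, c))"
    using fin(2)[of "(_, _)"] by simp
  ultimately show ?thesis by blast
qed

section \<open>Transfer of the probabilistic bounds to the program\<close>

lemma min_degree_le:
  assumes "v < n" shows "min_degree G \<le> cnt v m"
  using assms unfolding min_degree_eq by (intro Min_le) auto

lemma out_choice_nth_edge:
  assumes "1 \<le> min_degree G"
  shows "out_choice G nth_edge (min_degree G)"
proof
  fix v assume v: "v \<in> verts G"
  have "{e \<in> edges G. v \<in> ends G e} = {e. e < m \<and> inc v e}" using edges ends by (auto simp: inc_def)
  then show "bij_betw (nth_edge v) {..<degree G v} {e \<in> edges G. v \<in> ends G e}"
    unfolding degree_eq nth_edge_def by (simp add: bij_betw_inv_into[OF bij_betw_cnt])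
qed (use simple assms in auto)

text \<open>The range condition on \<open>r\<close> is there because \<open>nth_edge v\<close>
  inverts the rank only below the degree of \<open>v\<close>.\<close>

lemma choice_edges_eq_sampled:
  assumes \<delta>: "1 \<le> min_degree G" and r: "\<And>j. j < 2 * n \<Longrightarrow> r j < cnt (j div 2) m"
  shows "choice_edges r c = out_choice.sampled G nth_edge (r, c)"
proof -
  interpret out_choice G nth_edge "min_degree G" by (rule out_choice_nth_edge[OF \<delta>])
  have slots: "slots = {..<2 * n}" by (auto simp: slots_def verts)
  have "e \<in> choice_edges r c \<longleftrightarrow> e \<in> sampled (r, c)" for e
  proof -
    have "e \<in> outs slots r \<longleftrightarrow> (\<exists>j<2 * n. e = nth_edge (j div 2) (r j))" by (auto simp: outs_def slots)
    also have "\<dots> \<longleftrightarrow> (\<exists>j<2 * n. e < m \<and> inc (j div 2) e \<and> cnt (j div 2) e = r j)"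
      using nth_edge_iff[OF r] by blast
    also have "\<dots> \<longleftrightarrow> e < m \<and> (cnt (src e) e = r (2 * src e) \<or> cnt (src e) e = r (2 * src e + 1) \<or>
       cnt (dst e) e = r (2 * dst e) \<or> cnt (dst e) e = r (2 * dst e + 1))" (is "?L \<longleftrightarrow> ?R")
    proof
      assume ?L
      then obtain j where j: "e < m" "inc (j div 2) e" "cnt (j div 2) e = r j" by blast
      have "j = 2 * (j div 2) \<or> j = 2 * (j div 2) + 1" by presburger
      then show ?R using j by (auto simp: inc_def)
    next
      assume R: ?R
      then have e: "src e < n" "dst e < n" "inc (src e) e" "inc (dst e) e" using src_dst by (auto simp: inc_def)
      from R have e': "e < m" and "cnt (src e) e = r (2 * src e) \<or> cnt (src e) e = r (2 * src e + 1) \<or>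
       cnt (dst e) e = r (2 * dst e) \<or> cnt (dst e) e = r (2 * dst e + 1)" by auto
      then consider "cnt (src e) e = r (2 * src e)" | "cnt (src e) e = r (2 * src e + 1)"
        | "cnt (dst e) e = r (2 * dst e)" | "cnt (dst e) e = r (2 * dst e + 1)" by blast
      then show ?L
      proof cases
        case 1 then show ?thesis using e e' by (intro exI[of _ "2 * src e"]) simp
      next
        case 2 then show ?thesis using e e' by (intro exI[of _ "2 * src e + 1"]) simp
      next
        case 3 then show ?thesis using e e' by (intro exI[of _ "2 * dst e"]) simp
      next
        case 4 then show ?thesis using e e' by (intro exI[of _ "2 * dst e + 1"]) simp
      qed
    qed
    finally show ?thesis by (auto simp: choice_edges_def sampled_def edges)
  qed
  then show ?thesis by blast
qed

lemma prob_small_preserved: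
  assumes \<delta>: "1 \<le> min_degree G"
    and S: "nontrivial_cut G S" "approx_min_cut (2 - \<epsilon>) G S" and \<epsilon>: "0 < \<epsilon>" "\<epsilon> \<le> 1"
    and c1: "20 * exp (20 / \<epsilon>) \<le> real c1" and c2: "40 * exp (20 / \<epsilon>) \<le> real c2"
  shows "exp (- 20 / \<epsilon>) / 2 \<le> measure_pmf.prob (pair_pmf rank_pmf coins_pmf)
    {(r, c). preserves_cut G (choice_edges r c) S \<and> small c1 c2 (choice_edges r c)}"
proof -
  interpret out_choice G nth_edge "min_degree G" by (rule out_choice_nth_edge[OF \<delta>])
  have slots: "slots = {..<2 * n}" by (auto simp: slots_def verts)
  have pmfs: "out_pmf slots = rank_pmf" "coin_pmf = coins_pmf"
    by (simp_all add: slots degree_eq coin_pmf_def edges max_def)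
  have cn: "card (verts G) = n" by (simp add: verts)
  let ?A = "{x. preserves_cut G (sampled x) S \<and>
        real (comps G (sampled x)) * real (min_degree G) \<le> real c1 * real (card (verts G)) \<and>
        real (card (edges (contract G (sampled x)))) \<le> real c2 * real (card (verts G))}"
  have "exp (- 20 / \<epsilon>) / 2 \<le> measure_pmf.prob (pair_pmf rank_pmf coins_pmf) ?A"
    using prob_good[OF S \<epsilon> c1 c2] unfolding pmfs .
  \<comment> \<open>On the support every drawn number is below the degree, as
    \<open>choice_edges_eq_sampled\<close> demands.\<close>
  also have "\<dots> = measure_pmf.prob (pair_pmf rank_pmf coins_pmf) (?A \<inter> set_pmf (pair_pmf rank_pmf coins_pmf))"
    by (simp only: measure_Int_set_pmf)
  also have "\<dots> \<le> measure_pmf.prob (pair_pmf rank_pmf coins_pmf)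
    {(r, c). preserves_cut G (choice_edges r c) S \<and> small c1 c2 (choice_edges r c)}"
  proof (intro measure_pmf.finite_measure_mono subsetI)
    fix x assume x: "x \<in> ?A \<inter> set_pmf (pair_pmf rank_pmf coins_pmf)"
    obtain r c where rc: "x = (r, c)" by (cases x)
    have "r \<in> set_pmf rank_pmf" using x rc by simp
    then have "r \<in> PiE_dflt {..<2 * n} 0 (\<lambda>j. {..<max (Suc 0) (cnt (j div 2) m)})"
      by (simp add: set_Pi_pmf comp_def)
    moreover have "1 \<le> cnt (j div 2) m" if "j < 2 * n" for j
    proof -
      have "j div 2 < n" using that by (intro less_mult_imp_div_less) simp
      then show ?thesis using min_degree_le[of "j div 2"] \<delta> by simp
    qed
    ultimately have "r j < cnt (j div 2) m" if "j < 2 * n" for j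
      using that by (fastforce simp: PiE_dflt_def max_def)
    then have eq: "choice_edges r c = sampled x"
      using choice_edges_eq_sampled[OF \<delta>] rc by simp
    have "small c1 c2 (sampled x)"
      using x unfolding small_def cn by (simp only: Int_iff mem_Collect_eq of_nat_mult[symmetric] of_nat_le_iff)
    then show "x \<in> {(r, c). preserves_cut G (choice_edges r c) S \<and> small c1 c2 (choice_edges r c)}"
      using x rc eq by simp
  qed simp
  finally show ?thesis .
qed

text \<open>The summand 1 in \<open>c1 + 1\<close> covers the branch that contracts all
  edges.\<close>

lemma post_ok_sizes:
  assumes ok: "post_ok c1 c2 D s" and \<delta>: "1 \<le> min_degree G"
  shows "card (verts (contract G (contracted_edges G s))) * min_degree G \<le> (c1 + 1) * n"
    "card (edges (contract G (contracted_edges G s))) \<le> c2 * n"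
proof -
  have "card (verts (contract G (contracted_edges G s))) * min_degree G \<le> (c1 + 1) * n \<and>
    card (edges (contract G (contracted_edges G s))) \<le> c2 * n"
  proof (cases "small c1 c2 D")
    case True
    then show ?thesis using ok by (auto simp: post_ok_def small_def comps_def)
  next
    case False
    have deg: "\<And>v. v \<in> verts G \<Longrightarrow> min_degree G \<le> degree G v"
      using min_degree_le by (simp add: degree_eq verts)
    show ?thesis
      using False ok comps_all_edges[OF simple deg \<delta>] by (simp add: post_ok_def comps_def edges verts)
  qed
  then show "card (verts (contract G (contracted_edges G s))) * min_degree G \<le> (c1 + 1) * n"
    "card (edges (contract G (contracted_edges G s))) \<le> c2 * n" by auto
qed

text \<open>Turns a running time linear in \<open>n\<close> and \<open>m\<close> into one linear in
  \<open>m\<close>.\<close>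

lemma n_le_2m:
  assumes "1 \<le> min_degree G" shows "n \<le> 2 * m"
proof -
  have "n = (\<Sum>v<n. 1)" by simp
  also have "\<dots> \<le> (\<Sum>v<n. cnt v m)" using min_degree_le assms by (intro sum_mono) (meson lessThan_iff order_trans)
  also have "\<dots> = 2 * m" by (rule sum_cnt) simp
  finally show ?thesis .
qed

end

text \<open>Two extra units in the exponent provide the square, and
  \<open>k < 2 ^ k \<le> N ^ k\<close> absorbs the constant factor \<open>k\<close>.\<close>

lemma pow_bound:
  fixes N k :: nat
  assumes "2 \<le> N" shows "k * N ^ 2 < N ^ (k + 2)"
proof -
  have "k < 2 ^ k" by (rule less_exp)
  also have "\<dots> \<le> N ^ k" using assms by (rule power_mono) simp
  finally have "k * N ^ 2 < N ^ k * N ^ 2" using assms by simp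
  then show ?thesis by (simp only: power_add)
qed

theorem theorem2p2:
  fixes \<epsilon> :: real
  assumes "0 < \<epsilon>" and "\<epsilon> \<le> 1"
  shows "\<exists>(P :: com) (\<kappa> :: nat) (c_time :: nat) (c_nodes :: real) (c_edges :: real) (p :: real).
    0 < p \<and>
    (\<forall>(G :: (nat, nat) mgraph) (s\<^sub>0 :: state) (w :: nat) (n :: nat) (m :: nat) (\<delta> :: nat).
       simple_graph G \<and> n = card (verts G) \<and> m = card (edges G) \<and> \<delta> = min_degree G \<and> 1 \<le> \<delta> \<and>
       encodes_input G s\<^sub>0 \<and> (n + m) ^ \<kappa> \<le> 2 ^ w \<longrightarrow>
       (\<forall>(c, s) \<in> set_pmf (run w (c_time * m) (P, s\<^sub>0)).
          c = Skip \<and>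
          encodes_output (contract G (contracted_edges G s)) s \<and>
          real (card (verts (contract G (contracted_edges G s)))) \<le> c_nodes * (real n / real \<delta>) \<and>
          real (card (edges (contract G (contracted_edges G s)))) \<le> c_edges * real n) \<and>
       (\<forall>S. nontrivial_cut G S \<and> approx_min_cut (2 - \<epsilon>) G S \<longrightarrow>
          measure_pmf.prob (run w (c_time * m) (P, s\<^sub>0))
            {(c, s). preserves_cut G (contracted_edges G s) S} \<ge> p))"
proof -
  define c1 where "c1 = nat \<lceil>20 * exp (20 / \<epsilon>)\<rceil>"
  define c2 where "c2 = nat \<lceil>40 * exp (20 / \<epsilon>)\<rceil>"
  \<comment> \<open>The numbers to be stored are at most \<open>c1 + c2 + 4\<close> times the square
    of \<open>n + m\<close>: the square covers \<open>n * m\<close>, the summand 4 covers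
    \<open>2 * (n + m) + 2\<close>. By \<open>pow_bound\<close> this exponent suffices.\<close>
  define \<kappa> where "\<kappa> = (c1 + c2 + 4) + 2"
  define p where "p = exp (- 20 / \<epsilon>) / 2"
  have c12: "20 * exp (20 / \<epsilon>) \<le> real c1" "40 * exp (20 / \<epsilon>) \<le> real c2"
    unfolding c1_def c2_def by (rule real_nat_ceiling_ge)+
  have main: "(\<forall>(c, s) \<in> set_pmf (run w (1000 * m) (Prog c1 c2, s\<^sub>0)).
          c = Skip \<and>
          encodes_output (contract G (contracted_edges G s)) s \<and>
          real (card (verts (contract G (contracted_edges G s)))) \<le> real (c1 + 1) * (real n / real \<delta>) \<and>
          real (card (edges (contract G (contracted_edges G s)))) \<le> real c2 * real n) \<and>
       (\<forall>S. nontrivial_cut G S \<and> approx_min_cut (2 - \<epsilon>) G S \<longrightarrow>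
          measure_pmf.prob (run w (1000 * m) (Prog c1 c2, s\<^sub>0))
            {(c, s). preserves_cut G (contracted_edges G s) S} \<ge> p)"
    if asm: "simple_graph G" "n = card (verts G)" "m = card (edges G)" "\<delta> = min_degree G" "1 \<le> \<delta>"
       "encodes_input G s\<^sub>0" "(n + m) ^ \<kappa> \<le> 2 ^ w"
    for G :: "(nat, nat) mgraph" and s\<^sub>0 w n m \<delta>
  proof -
    define src where "src = arr s\<^sub>0 ''tail''"
    define dst where "dst = arr s\<^sub>0 ''head''"
    have V: "verts G = {..<var s\<^sub>0 ''n''}" "edges G = {..<var s\<^sub>0 ''m''}"
      "\<And>e. e \<in> edges G \<Longrightarrow> ends G e = {src e, dst e}"
      "\<And>x. x \<notin> {''n'', ''m''} \<Longrightarrow> var s\<^sub>0 x = 0"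
      "\<And>a i. a \<notin> {''tail'', ''head''} \<Longrightarrow> arr s\<^sub>0 a i = 0"
      using asm(6) by (auto simp: encodes_input_def src_def dst_def)
    have nm: "var s\<^sub>0 ''n'' = n" "var s\<^sub>0 ''m'' = m" using V(1,2) asm(2,3) by simp_all
    have VE: "verts G = {..<n}" "edges G = {..<m}" using V(1,2) nm by simp_all
    have n: "0 < n" using asm(1) VE(1) by (cases n) (auto simp: simple_graph_def)
    have deg: "\<delta> \<le> degree G 0" unfolding asm(4) min_degree_def using n VE by (intro Min_le) auto
    have "degree G 0 \<le> card (edges G)" unfolding degree_def VE(2) by (intro card_mono) auto
    then have \<delta>m: "\<delta> \<le> m" using deg asm(3) by simp
    define N where "N = n + m"
    have N: "2 \<le> N" using n \<delta>m asm(5) by (simp add: N_def)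
    have "(c1 + c2 + 4) * N ^ 2 < N ^ \<kappa>" unfolding \<kappa>_def by (rule pow_bound[OF N])
    then have large: "(c1 + c2 + 4) * N ^ 2 < 2 ^ w" using asm(7) by (simp add: N_def)
    have N2: "N \<le> N ^ 2" "1 \<le> N ^ 2" using N by (simp_all add: power2_eq_square)
    have bound: "x < 2 ^ w" if "x \<le> (c1 + c2 + 4) * N ^ 2" for x using that large by (rule le_less_trans)
    have b1: "2 * (n + m) + 2 < 2 ^ w"
    proof (rule bound)
      have "2 * (n + m) + 2 \<le> 4 * N ^ 2" using N2 by (simp add: N_def)
      also have "\<dots> \<le> (c1 + c2 + 4) * N ^ 2" by (rule mult_le_mono1) simp
      finally show "2 * (n + m) + 2 \<le> (c1 + c2 + 4) * N ^ 2" .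
    qed
    have b2: "c1 * n < 2 ^ w" "c2 * n < 2 ^ w" "n * m < 2 ^ w"
    proof -
      have "n \<le> N" "m \<le> N" by (simp_all add: N_def)
      then have nN: "n \<le> N ^ 2" "n * m \<le> N ^ 2"
        using le_trans[OF _ N2(1)] mult_le_mono[of n N m N] by (simp_all only: power2_eq_square)
      show "c1 * n < 2 ^ w" "c2 * n < 2 ^ w" by (rule bound, rule mult_le_mono; (use nN in simp))+
      have "n * m \<le> 1 * N ^ 2" using nN by simp
      also have "\<dots> \<le> (c1 + c2 + 4) * N ^ 2" by (rule mult_le_mono1) simp
      finally show "n * m < 2 ^ w" by (rule bound)
    qed
    interpret input_graph G n m w src dst
      using asm(1) VE V(3) b1 by unfold_locales auto
    have base0: "base s\<^sub>0" unfolding base_def using nm by (simp add: src_def dst_def)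
    have zero: "arr s\<^sub>0 a = (\<lambda>_. 0)" if "a \<notin> {''tail'', ''head''}" for a using V(5)[OF that] by (simp add: fun_eq_iff)
    obtain fin where fin: "runs w (170 * m + 180 * n + 82) (Prog c1 c2) s\<^sub>0 (map_pmf fin (pair_pmf rank_pmf coins_pmf))"
      "\<And>r c. post_ok c1 c2 (choice_edges r c) (fin (r, c))"
      using runs_Prog[OF base0 zero V(4)[of "''x''"] n \<delta>m[unfolded asm(4)] b2] by auto
    have \<delta>1: "1 \<le> min_degree G" using asm(4,5) by simp
    \<comment> \<open>With \<open>n \<le> 2 * m\<close> and \<open>1 \<le> m\<close> the left side
      is at most \<open>612 * m\<close>.\<close>
    have "170 * m + 180 * n + 82 \<le> 1000 * m" using n_le_2m[OF \<delta>1] \<delta>m asm(5) by simp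
    from runs_mono[OF fin(1) this]
    have R: "run w (1000 * m) (Prog c1 c2, s\<^sub>0) = map_pmf (Pair Skip) (map_pmf fin (pair_pmf rank_pmf coins_pmf))"
      by (simp add: runs_def)
    show ?thesis
    proof (intro conjI allI impI)
      show "\<forall>(c, s) \<in> set_pmf (run w (1000 * m) (Prog c1 c2, s\<^sub>0)).
          c = Skip \<and>
          encodes_output (contract G (contracted_edges G s)) s \<and>
          real (card (verts (contract G (contracted_edges G s)))) \<le> real (c1 + 1) * (real n / real \<delta>) \<and>
          real (card (edges (contract G (contracted_edges G s)))) \<le> real c2 * real n"
      proof (rule ballI, rule case_prodI2)
        fix x c s assume x: "x \<in> set_pmf (run w (1000 * m) (Prog c1 c2, s\<^sub>0))" "x = (c, s)"
        then obtain y where y: "c = Skip" "s = fin y" unfolding R by auto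
        obtain r c' where rc: "y = (r, c')" by (cases y)
        have ok: "post_ok c1 c2 (choice_edges r c') s" using fin(2) y rc by simp
        note sz = post_ok_sizes[OF ok \<delta>1]
        have "real (card (verts (contract G (contracted_edges G s)))) * real \<delta> \<le> real (c1 + 1) * real n"
          using sz(1) unfolding asm(4) by (simp only: of_nat_mult[symmetric] of_nat_le_iff)
        then have v: "real (card (verts (contract G (contracted_edges G s)))) \<le> real (c1 + 1) * (real n / real \<delta>)"
          using asm(5) by (simp add: pos_le_divide_eq)
        have e: "real (card (edges (contract G (contracted_edges G s)))) \<le> real c2 * real n"
          using sz(2) by (simp only: of_nat_mult[symmetric] of_nat_le_iff)
        show "c = Skip \<and> encodes_output (contract G (contracted_edges G s)) s \<and>
          real (card (verts (contract G (contracted_edges G s)))) \<le> real (c1 + 1) * (real n / real \<delta>) \<and>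
          real (card (edges (contract G (contracted_edges G s)))) \<le> real c2 * real n"
          by (intro conjI y(1) v e) (rule conjunct1[OF ok[unfolded post_ok_def]])
      qed
    next
      fix S assume S: "nontrivial_cut G S \<and> approx_min_cut (2 - \<epsilon>) G S"
      have "p \<le> measure_pmf.prob (pair_pmf rank_pmf coins_pmf)
        {(r, c). preserves_cut G (choice_edges r c) S \<and> small c1 c2 (choice_edges r c)}"
        unfolding p_def using S by (intro prob_small_preserved \<delta>1 assms c12) auto
      \<comment> \<open>If the sampled set passes the size test, it is the reported set, so its
        survival event is contained in that of the program.\<close>
      also have "\<dots> \<le> measure_pmf.prob (pair_pmf rank_pmf coins_pmf)
        {x. preserves_cut G (contracted_edges G (fin x)) S}"
      proof (intro measure_pmf.finite_measure_mono subsetI)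
        fix x assume "x \<in> {(r, c). preserves_cut G (choice_edges r c) S \<and> small c1 c2 (choice_edges r c)}"
        moreover obtain r c where "x = (r, c)" by (cases x)
        moreover have "contracted_edges G (fin (r, c)) = (if small c1 c2 (choice_edges r c) then choice_edges r c else {..<m})"
          using fin(2)[of r c] unfolding post_ok_def by (rule conjunct2)
        ultimately show "x \<in> {x. preserves_cut G (contracted_edges G (fin x)) S}" by simp
      qed simp
      also have "\<dots> = measure_pmf.prob (run w (1000 * m) (Prog c1 c2, s\<^sub>0))
            {(c, s). preserves_cut G (contracted_edges G s) S}"
        unfolding R by (simp add: vimage_def)
      finally show "measure_pmf.prob (run w (1000 * m) (Prog c1 c2, s\<^sub>0))
            {(c, s). preserves_cut G (contracted_edges G s) S} \<ge> p" .
    qed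
  qed
  have "0 < p" by (simp add: p_def)
  show ?thesis
  proof (rule exI[of _ "Prog c1 c2"], rule exI[of _ \<kappa>], rule exI[of _ 1000], rule exI[of _ "real (c1 + 1)"],
      rule exI[of _ "real c2"], rule exI[of _ p], rule conjI[OF \<open>0 < p\<close>], intro allI, rule impI, elim conjE)
    fix G s\<^sub>0 w n m \<delta>
    assume "simple_graph G" "n = card (verts G)" "m = card (edges G)" "\<delta> = min_degree G" "1 \<le> \<delta>"
       "encodes_input G s\<^sub>0" "(n + m) ^ \<kappa> \<le> 2 ^ w"
    from main[OF this] show "(\<forall>(c, s) \<in> set_pmf (run w (1000 * m) (Prog c1 c2, s\<^sub>0)).
          c = Skip \<and>
          encodes_output (contract G (contracted_edges G s)) s \<and>
          real (card (verts (contract G (contracted_edges G s)))) \<le> real (c1 + 1) * (real n / real \<delta>) \<and>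
          real (card (edges (contract G (contracted_edges G s)))) \<le> real c2 * real n) \<and>
       (\<forall>S. nontrivial_cut G S \<and> approx_min_cut (2 - \<epsilon>) G S \<longrightarrow>
          measure_pmf.prob (run w (1000 * m) (Prog c1 c2, s\<^sub>0))
            {(c, s). preserves_cut G (contracted_edges G s) S} \<ge> p)" .
  qed
qed

end
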